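(* Let $f\in\mathbb M$ be a full branch piecewise monotone map of $[0,1]$ with $N$ branches (as in the context). The operator $\mathcal L_0$, when acting on $W^{1,1}([0,1])$, has the spectral decomposition $$\mathcal L_0h=N\cdot\mu_{\mathrm{BM}}(h)+Q(h),$$ where $Q1=0$, $\mu_{\mathrm{BM}}(Q(h))=0$ for all $h\in W^{1,1}$, $\sigma_{W^{1,1}}(Q)\subset\{z\in\mathbb C:|z|\le1\}$, and $\mu_{\mathrm{BM}}$ is a measure of maximal entropy of $f$.
   Context: Let $\mathcal P=\{I_1,\dots,I_N\}$, $N\in\{1,2,\dots\}$, be open disjoint intervals with $\bigcup_{i=1}^N\overline{I_i}=[0,1]$. $\mathbb M_*$ is the set of maps $f:[0,1]\to[0,1]$ such that, for such a $\mathcal P$, each $f|_{I_i}$ is strictly monotone and $\mathcal C^1$, and $\Lambda=\|f'\|_\infty<\infty$. $\mathbb M=\{f\in\mathbb M_*: f(I_i)=(0,1)\text{ for all }i\}$ (full branch maps). Such maps may have attracting periodic orbits. $\mathcal L_0h(x)=\sum_{y\in f^{-1}(x)}h(y)$ (sum over the $N$ inverse branches). For $f\in\mathbb M$ the operator is considered on $W^{1,1}([0,1])$; the paper's setting is that $\mathcal L_0W^{1,1}\subset W^{1,1}$. $\sigma_{W^{1,1}}$ is the spectrum on $W^{1,1}$. A measure of maximal entropy is an $f$-invariant probability measure $\mu$ whose Kolmogorov–Sinai entropy $h_\mu(f)$ attains $\sup_\nu h_\nu(f)$ over all invariant probability measures $\nu$; for $f\in\mathbb M$ this supremum is $h_{\mathrm{top}}=\ln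 N$.
   Formalization: For N=1 the map f is additionally assumed continuous on [0,1]; with arbitrary endpoint values the claim fails, e.g. f(x)=x^2 on (0,1) with f(0)=f(1)=1/2 has no invariant probability measure. *)

theory Defs
  imports "HOL-Probability.Probability"
begin

section \<open>Full branch piecewise monotone maps\<close>

definition interval_partition :: "real set set \<Rightarrow> bool" where
  "interval_partition P \<longleftrightarrow>
     finite P \<and> disjoint P \<and> (\<forall>I\<in>P. \<exists>a b. a < b \<and> I = {a<..<b}) \<and>
     (\<Union>I\<in>P. closure I) = {0..1}"

text \<open>
  The values of \<open>f\<close> at the finitely many end points of the intervals are not constrained. Pitfall:
  with a single full branch these values matter for the existence of invariant measures
  (\<open>x\<^sup>2\<close> on \<open>(0,1)\<close> with \<open>f 0 = f 1 = 1/2\<close> has no invariant probability measure).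
\<close>

definition pw_monotone :: "(real \<Rightarrow> real) \<Rightarrow> real set set \<Rightarrow> bool" where
  "pw_monotone f P \<longleftrightarrow>
     interval_partition P \<and> f \<in> {0..1} \<rightarrow> {0..1} \<and>
     (\<forall>I\<in>P. (strict_mono_on I f \<or> strict_antimono_on I f) \<and> f C1_differentiable_on I) \<and>
     (\<exists>\<Lambda>. \<forall>x\<in>\<Union>P. \<bar>deriv f x\<bar> \<le> \<Lambda>)"

definition full_branch :: "(real \<Rightarrow> real) \<Rightarrow> real set set \<Rightarrow> bool" where
  "full_branch f P \<longleftrightarrow> pw_monotone f P \<and> (\<forall>I\<in>P. f ` I = {0<..<1})"

section \<open>The Sobolev space \<open>W\<^sup>1\<^sup>,\<^sup>1([0,1])\<close>\<close>

text \<open>Test functions are the compactly supported \<open>C\<^sup>1\<close> functions on the open unit interval.\<close>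

definition test_fun :: "(real \<Rightarrow> real) \<Rightarrow> bool" where
  "test_fun \<phi> \<longleftrightarrow> \<phi> C1_differentiable_on UNIV \<and>
     (\<exists>K. compact K \<and> K \<subseteq> {0<..<1} \<and> (\<forall>x. x \<notin> K \<longrightarrow> \<phi> x = 0))"

definition weak_deriv :: "(real \<Rightarrow> complex) \<Rightarrow> (real \<Rightarrow> complex) \<Rightarrow> bool" where
  "weak_deriv h g \<longleftrightarrow> set_integrable lborel {0<..<1} g \<and>
     (\<forall>\<phi>. test_fun \<phi> \<longrightarrow>
        (LINT x:{0<..<1}|lborel. deriv \<phi> x *\<^sub>R h x) = - (LINT x:{0<..<1}|lborel. \<phi> x *\<^sub>R g x))"

text \<open>
  An element of \<open>W\<^sup>1\<^sup>,\<^sup>1([0,1])\<close> is represented by its unique continuous representative on \<open>[0,1]\<close>,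
  so that it can be integrated against measures that are singular to Lebesgue measure.
  Outside \<open>[0,1]\<close> the representative is set to \<open>0\<close>; equality in \<open>W\<^sup>1\<^sup>,\<^sup>1\<close> is thus equality of functions.
\<close>

definition W11 :: "(real \<Rightarrow> complex) set" where
  "W11 = {h. continuous_on {0..1} h \<and> (\<forall>x. x \<notin> {0..1} \<longrightarrow> h x = 0) \<and> (\<exists>g. weak_deriv h g)}"

text \<open>The weak derivative is unique almost everywhere, so the choice below does not matter.\<close>

definition W11_norm :: "(real \<Rightarrow> complex) \<Rightarrow> real" where
  "W11_norm h = (LINT x:{0<..<1}|lborel. norm (h x)) +
     (LINT x:{0<..<1}|lborel. norm ((SOME g. weak_deriv h g) x))"

definition one_W11 :: "real \<Rightarrow> complex" where
  "one_W11 = indicator {0..1}"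

section \<open>Bounded operators and spectrum\<close>

text \<open>\<open>V\<close> is the carrier of a complex function space and \<open>nrm\<close> its norm.\<close>

definition bounded_operator_on ::
    "('a \<Rightarrow> complex) set \<Rightarrow> (('a \<Rightarrow> complex) \<Rightarrow> real) \<Rightarrow> (('a \<Rightarrow> complex) \<Rightarrow> 'a \<Rightarrow> complex) \<Rightarrow> bool" where
  "bounded_operator_on V nrm T \<longleftrightarrow>
     T \<in> V \<rightarrow> V \<and>
     (\<forall>g\<in>V. \<forall>h\<in>V. T (\<lambda>x. g x + h x) = (\<lambda>x. T g x + T h x)) \<and>
     (\<forall>c. \<forall>h\<in>V. T (\<lambda>x. c * h x) = (\<lambda>x. c * T h x)) \<and>
     (\<exists>C. \<forall>h\<in>V. nrm (T h) \<le> C * nrm h)"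

definition spectrum_on ::
    "('a \<Rightarrow> complex) set \<Rightarrow> (('a \<Rightarrow> complex) \<Rightarrow> real) \<Rightarrow> (('a \<Rightarrow> complex) \<Rightarrow> 'a \<Rightarrow> complex) \<Rightarrow> complex set" where
  "spectrum_on V nrm T =
     {z. \<not> (\<exists>R. bounded_operator_on V nrm R \<and>
              (\<forall>h\<in>V. R (\<lambda>x. z * h x - T h x) = h \<and> (\<lambda>x. z * R h x - T (R h) x) = h))}"

section \<open>The transfer operator\<close>

text \<open>
  For a full branch map every \<open>x \<in> (0,1)\<close> has exactly one preimage in each interval of \<open>P\<close>.
  At \<open>0\<close> and \<open>1\<close> the inverse branches, and hence \<open>L0 f P h\<close> for continuous \<open>h\<close>, are extended by
  continuity, so that \<open>L0 f P h\<close> is the continuous representative.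
\<close>

definition L0 :: "(real \<Rightarrow> real) \<Rightarrow> real set set \<Rightarrow> (real \<Rightarrow> complex) \<Rightarrow> real \<Rightarrow> complex" where
  "L0 f P h x =
     (let S = (\<lambda>t. \<Sum>y | y \<in> \<Union>P \<and> f y = t. h y) in
      if x \<in> {0<..<1} then S x
      else if x \<in> {0, 1} then Lim (at x within {0<..<1}) S
      else 0)"

section \<open>Kolmogorov--Sinai entropy\<close>

definition invariant_prob :: "(real \<Rightarrow> real) \<Rightarrow> real measure \<Rightarrow> bool" where
  "invariant_prob f \<nu> \<longleftrightarrow>
     prob_space \<nu> \<and> sets \<nu> = sets (restrict_space borel {0..1}) \<and>
     f \<in> measurable \<nu> \<nu> \<and> distr \<nu> \<nu> f = \<nu>"

definition partition_entropy :: "'a measure \<Rightarrow> 'a set set \<Rightarrow> real" where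
  "partition_entropy \<nu> \<alpha> = - (\<Sum>A\<in>\<alpha>. measure \<nu> A * ln (measure \<nu> A))"

definition pullback_partition :: "'a measure \<Rightarrow> ('a \<Rightarrow> 'a) \<Rightarrow> 'a set set \<Rightarrow> nat \<Rightarrow> 'a set set" where
  "pullback_partition \<nu> f \<alpha> k = (\<lambda>A. (f ^^ k) -` A \<inter> space \<nu>) ` \<alpha> - {{}}"

definition dyn_refinement :: "'a measure \<Rightarrow> ('a \<Rightarrow> 'a) \<Rightarrow> 'a set set \<Rightarrow> nat \<Rightarrow> 'a set set" where
  "dyn_refinement \<nu> f \<alpha> n = common_refinement (pullback_partition \<nu> f \<alpha> ` {..<n})"

definition entropy_wrt_partition :: "'a measure \<Rightarrow> ('a \<Rightarrow> 'a) \<Rightarrow> 'a set set \<Rightarrow> real" where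
  "entropy_wrt_partition \<nu> f \<alpha> = lim (\<lambda>n. partition_entropy \<nu> (dyn_refinement \<nu> f \<alpha> n) / real n)"

definition ks_entropy :: "'a measure \<Rightarrow> ('a \<Rightarrow> 'a) \<Rightarrow> ereal" where
  "ks_entropy \<nu> f =
     (SUP \<alpha> \<in> {\<alpha>. finite \<alpha> \<and> \<alpha> \<subseteq> sets \<nu> \<and> partition_on (space \<nu>) \<alpha>}.
        ereal (entropy_wrt_partition \<nu> f \<alpha>))"

definition max_entropy_measure :: "(real \<Rightarrow> real) \<Rightarrow> real measure \<Rightarrow> bool" where
  "max_entropy_measure f \<mu> \<longleftrightarrow>
     invariant_prob f \<mu> \<and> ks_entropy \<mu> f = (SUP \<nu> \<in> {\<nu>. invariant_prob f \<nu>}. ks_entropy \<nu> f)"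

end

theory Submission
  imports Defs
begin

text \<open>
  Why the theorem holds. Each inverse branch is monotone, so disjoint intervals have disjoint
  images under all inverse branches together, and the transfer operator does not increase the
  total variation of a function (\<open>var_bound_L0\<close>, \<open>w11_var_L0\<close>). No expansion of \<open>f\<close> enters, which
  is why attracting periodic orbits do no harm. Let \<open>\<mu>\<close> be a probability measure on \<open>[0,1]\<close> with
  \<open>\<integral> L0 h d\<mu> = N \<integral> h d\<mu>\<close>, and put \<open>Q h = L0 h - N \<mu>(h) 1\<close>. Then \<open>Q\<close> kills constants, its range
  consists of functions with mean zero, and a function with mean zero is bounded by its variation.
  Hence all powers of \<open>Q\<close> are bounded on \<open>W\<^sup>1\<^sup>,\<^sup>1\<close> by one constant, and the Neumann series inverts
  \<open>z - Q\<close> whenever \<open>|z| > 1\<close> (\<open>spectral_decomposition\<close>, \<open>spectrum_power_bounded\<close>). On \<open>W\<^sup>1\<^sup>,\<^sup>1\<close>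
  the norm of the weak derivative is the total variation of the continuous representative
  (\<open>var_bound_weak_deriv\<close>, \<open>weak_deriv_norm_le_var\<close>), so the change of variables formula, delicate
  at zeros of \<open>f'\<close>, never appears.

  For \<open>N \<ge> 2\<close> the measure \<open>\<mu>\<close> is the one that gives every branch an equal share of each preimage:
  \<open>\<mu>(I \<inter> f\<^sup>-\<^sup>1 B) = \<mu>(B) / N\<close> (\<open>balanced\<close>). Its distribution function is the fixed point of a
  contraction and semiconjugates \<open>f\<close> to a piecewise linear map with slopes \<open>\<plusminus>N\<close>
  (\<open>balanced_exists\<close>). Such a measure is invariant, has the duality above, and gives each cylinder
  of length \<open>n\<close> the mass \<open>N\<^sup>-\<^sup>n\<close>; its entropy is therefore at least \<open>ln N\<close>. For \<open>N = 1\<close> a unit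
  mass at a fixed point takes its place.

  No invariant measure \<open>\<nu>\<close> has larger entropy (\<open>entropy_le_ln_card\<close>). A partition into intervals
  has at most polynomially many times \<open>N\<^sup>n\<close> itineraries of length \<open>n\<close>, because the preimages of a
  finite set under the first \<open>n\<close> iterates number at most a constant times \<open>n\<^sup>2 N\<^sup>n\<close>. A general
  partition agrees with a partition into intervals off a set of small measure, and the resulting
  loss of entropy is estimated by the Gibbs inequality (\<open>cyl_entropy_le_itineraries\<close>): the
  itineraries of the interval partition, passed through a channel that misreads each letter with
  small probability, give a probability vector on the words of the original partition.
\<close>

section \<open>Weak derivatives and primitives\<close>

lemma test_fun_deriv:
  assumes "test_fun \<phi>"
  shows "(\<phi> has_real_derivative deriv \<phi> x) (at x)" "continuous_on S (deriv \<phi>)" "x \<notin> {0<..<1} \<Longrightarrow> \<phi> x = 0"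
proof -
  obtain D where D: "\<And>x. (\<phi> has_vector_derivative D x) (at x)" and c: "continuous_on UNIV D"
    using assms unfolding test_fun_def C1_differentiable_on_def by auto
  have "deriv \<phi> x = D x" for x
    using D[of x] by (simp add: DERIV_imp_deriv has_real_derivative_iff_has_vector_derivative)
  then have "deriv \<phi> = D" by auto
  then show "(\<phi> has_real_derivative deriv \<phi> x) (at x)" "continuous_on S (deriv \<phi>)"
    using D[of x] c by (auto simp: has_real_derivative_iff_has_vector_derivative intro: continuous_on_subset)
  show "x \<notin> {0<..<1} \<Longrightarrow> \<phi> x = 0" using assms unfolding test_fun_def by auto
qed

lemma test_fun_measurable:
  assumes "test_fun \<phi>"
  shows "\<phi> \<in> borel_measurable borel" "deriv \<phi> \<in> borel_measurable borel"
proof -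
  have "continuous_on UNIV \<phi>"
    using test_fun_deriv(1)[OF assms] by (meson DERIV_isCont continuous_at_imp_continuous_on)
  then show "\<phi> \<in> borel_measurable borel" by (rule borel_measurable_continuous_onI)
  show "deriv \<phi> \<in> borel_measurable borel"
    by (rule borel_measurable_continuous_onI[OF test_fun_deriv(2)[OF assms]])
qed

lemma integral_deriv_test_fun:
  assumes "test_fun \<phi>" "0 \<le> t" "t \<le> 1"
  shows "(\<integral>x. indicator {t..1} x * deriv \<phi> x \<partial>lborel) = - \<phi> t"
proof -
  have "(\<integral>x. indicator {t..1} x *\<^sub>R deriv \<phi> x \<partial>lborel) = \<phi> 1 - \<phi> t"
    by (rule integral_FTC_atLeastAtMost)
       (use assms test_fun_deriv in \<open>auto simp: has_real_derivative_iff_has_vector_derivative[symmetric]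
           intro: DERIV_subset\<close>)
  with test_fun_deriv(3)[OF assms(1), of 1] show ?thesis by simp
qed

lemma lborel_AE_neq: "AE x in lborel. x \<noteq> (a::real)"
  by (rule AE_lborel_singleton)

text \<open>
  Fubini on the triangle \<open>t \<le> x\<close>: integrating \<open>\<phi>'\<close> over \<open>[t, 1]\<close> first leaves \<open>- \<phi> t\<close>, because
  \<open>\<phi> 1 = 0\<close>.
\<close>

lemma primitive_by_parts:
  fixes k :: "real \<Rightarrow> complex"
  assumes \<phi>: "test_fun \<phi>" and k: "integrable lborel k" and k0: "\<And>t. t \<notin> {0<..<1} \<Longrightarrow> k t = 0"
  shows "(LINT x:{0<..<1}|lborel. deriv \<phi> x *\<^sub>R (LINT t:{..x}|lborel. k t)) = - (LINT t:{0<..<1}|lborel. \<phi> t *\<^sub>R k t)"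
proof -
  note [measurable] = test_fun_measurable[OF \<phi>]
  have [measurable]: "k \<in> borel_measurable borel" using k by auto
  obtain C where C: "\<And>x. x \<in> {0..1} \<Longrightarrow> \<bar>deriv \<phi> x\<bar> \<le> C"
    using compact_imp_bounded[OF compact_continuous_image[OF test_fun_deriv(2)[OF \<phi>] compact_Icc[of 0 1]]]
    unfolding bounded_iff by (metis imageI real_norm_def)
  have C0: "0 \<le> C" using C[of 0] by auto
  define F where "F = (\<lambda>x t. (indicator {0<..<1} x * indicator {t..} x * deriv \<phi> x) *\<^sub>R k t)"
  have Fm [measurable]: "case_prod F \<in> borel_measurable (lborel \<Otimes>\<^sub>M lborel)"
    unfolding F_def atLeast_def indicator_def split_beta' by measurable
  have int_F: "integrable (lborel \<Otimes>\<^sub>M lborel) (case_prod F)"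
  proof (rule integrableI_bounded)
    show "case_prod F \<in> borel_measurable (lborel \<Otimes>\<^sub>M lborel)" by fact
    have "(\<integral>\<^sup>+ p. ennreal (norm (case_prod F p)) \<partial>(lborel \<Otimes>\<^sub>M lborel))
        \<le> (\<integral>\<^sup>+ p. ennreal C * indicator {0<..<1::real} (fst p) * ennreal (norm (k (snd p))) \<partial>(lborel \<Otimes>\<^sub>M lborel))"
    proof (rule nn_integral_mono)
      fix p :: "real \<times> real"
      obtain a b where p: "p = (a, b)" by (cases p)
      show "ennreal (norm (case_prod F p)) \<le> ennreal C * indicator {0<..<1} (fst p) * ennreal (norm (k (snd p)))"
        using C[of a] C0 by (auto simp: p F_def indicator_def ennreal_mult[symmetric] intro!: ennreal_leI
            mult_right_mono)
    qed
    also have "\<dots> = (\<integral>\<^sup>+x. \<integral>\<^sup>+y. ennreal C * indicator {0<..<1::real} x * ennreal (norm (k y)) \<partial>lborel \<partial>lborel)"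
      by (subst lborel.nn_integral_fst[symmetric]) auto
    also have "\<dots> = (\<integral>\<^sup>+x. ennreal C * indicator {0<..<1} (x::real) \<partial>lborel) * (\<integral>\<^sup>+y. ennreal (norm (k y)) \<partial>lborel)"
      by (simp add: nn_integral_cmult nn_integral_multc)
    also have "\<dots> = ennreal C * (\<integral>\<^sup>+y. ennreal (norm (k y)) \<partial>lborel)"
      by (simp add: nn_integral_cmult_indicator)
    also have "\<dots> < \<infinity>"
      using k unfolding integrable_iff_bounded by (auto simp: ennreal_mult_less_top)
    finally show "(\<integral>\<^sup>+ p. ennreal (norm (case_prod F p)) \<partial>(lborel \<Otimes>\<^sub>M lborel)) < \<infinity>" .
  qed
  have "(\<integral>x. (\<integral>t. F x t \<partial>lborel) \<partial>lborel) = (\<integral>t. (\<integral>x. F x t \<partial>lborel) \<partial>lborel)"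
    by (rule lborel_pair.Fubini_integral[OF int_F, symmetric])
  moreover have "(\<integral>t. F x t \<partial>lborel) = indicator {0<..<1} x *\<^sub>R deriv \<phi> x *\<^sub>R (LINT t:{..x}|lborel. k t)" for x
  proof -
    have "(\<integral>t. F x t \<partial>lborel) = (\<integral>t. (indicator {0<..<1} x * deriv \<phi> x) *\<^sub>R (indicator {..x} t *\<^sub>R k t) \<partial>lborel)"
      by (rule Bochner_Integration.integral_cong) (auto simp: F_def indicator_def)
    also have "\<dots> = (indicator {0<..<1} x * deriv \<phi> x) *\<^sub>R (\<integral>t. (indicator {..x} t *\<^sub>R k t) \<partial>lborel)"
      by (rule integral_scaleR_right)
    finally show ?thesis by (simp add: set_lebesgue_integral_def)
  qed
  moreover have "(\<integral>x. F x t \<partial>lborel) = - (indicator {0<..<1} t *\<^sub>R \<phi> t *\<^sub>R k t)" for t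
  proof (cases "t \<in> {0<..<1}")
    case True
    have "(\<integral>x. F x t \<partial>lborel) = (\<integral>x. (indicator {t..1} x * deriv \<phi> x) *\<^sub>R k t \<partial>lborel)"
    proof (rule integral_cong_AE)
      show "AE x in lborel. F x t = (indicator {t..1} x * deriv \<phi> x) *\<^sub>R k t"
        using lborel_AE_neq[of 1] by eventually_elim (use True in \<open>auto simp: F_def indicator_def\<close>)
      show "(\<lambda>x. F x t) \<in> borel_measurable lborel"
        by measurable
    qed measurable
    also have "\<dots> = (\<integral>x. indicator {t..1} x * deriv \<phi> x \<partial>lborel) *\<^sub>R k t"
    proof (rule integral_scaleR_left)
      have "set_integrable lborel {t..1} (deriv \<phi>)"
        by (rule borel_integrable_atLeastAtMost'[OF test_fun_deriv(2)[OF \<phi>]])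
      then show "integrable lborel (\<lambda>x. indicator {t..1} x * deriv \<phi> x)"
        by (simp add: set_integrable_def)
    qed
    also have "\<dots> = - (\<phi> t *\<^sub>R k t)" using integral_deriv_test_fun[OF \<phi>, of t] True by simp
    finally show ?thesis using True by simp
  next
    case False then show ?thesis using k0 by (simp add: F_def)
  qed
  ultimately show ?thesis by (simp add: set_lebesgue_integral_def)
qed

text \<open>
  The test function with derivative \<open>\<psi> (u - c)\<close>, where \<open>\<psi>\<close> is a nonnegative bump and \<open>c\<close> the mean
  of \<open>u\<close> with weight \<open>\<psi>\<close>, turns the hypothesis into \<open>\<integral> \<psi> (u - c)\<^sup>2 = 0\<close>. The bump may fill any
  compact part of the open interval.
\<close>

lemma du_Bois_Reymond:
  fixes u :: "real \<Rightarrow> real"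
  assumes u: "continuous_on {0..1} u"
    and orth: "\<And>\<phi>. test_fun \<phi> \<Longrightarrow> (LINT x:{0<..<1}|lborel. deriv \<phi> x * u x) = 0"
    and x: "x \<in> {0..1}" and y: "y \<in> {0..1}"
  shows "u x = u y"
proof -
  have key: "\<exists>c. \<forall>x\<in>{d<..<1-d}. u x = c" if d: "0 < d" "d < 1/2" for d
  proof -
    \<comment> \<open>a bump that is positive exactly on the interval from \<open>d\<close> to \<open>1 - d\<close>\<close>
    define \<psi> where "\<psi> = (\<lambda>x. max 0 ((x - d) * (1 - d - x)))"
    have c\<psi>: "continuous_on S \<psi>" for S unfolding \<psi>_def by (intro continuous_intros)
    have \<psi>pos: "\<psi> x > 0 \<longleftrightarrow> x \<in> {d<..<1-d}" for x
      using d by (auto simp: \<psi>_def zero_less_mult_iff less_max_iff_disj)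
    have \<psi>nn: "\<psi> x \<ge> 0" for x by (simp add: \<psi>_def)
    have \<psi>0: "\<psi> x = 0" if "x \<notin> {d<..<1-d}" for x using \<psi>pos[of x] \<psi>nn[of x] that by linarith
    \<comment> \<open>extends \<open>u\<close> continuously to the line\<close>
    define w where "w = (\<lambda>x. u (max 0 (min 1 x)))"
    have cw: "continuous_on S w" for S
      unfolding w_def by (rule continuous_on_compose2[OF u]) (auto intro!: continuous_intros)
    define c where "c = integral {0..1} (\<lambda>x. \<psi> x * w x) / integral {0..1} \<psi>"
    have I\<psi>: "integral {0..1} \<psi> > 0"
    proof -
      have "integral {0..1} \<psi> \<noteq> 0"
      proof
        assume "integral {0..1} \<psi> = 0"
        then have "(\<psi> has_integral 0) {0..1}" 
          using integrable_integral[OF integrable_continuous_real[OF c\<psi>, of 0 1]] by simp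
        then have "\<psi> (1/2) = 0"
          using has_integral_0_cbox_imp_0[of 0 1 \<psi> "1/2"] c\<psi> \<psi>nn by simp
        then show False using \<psi>pos[of "1/2"] d by auto
      qed
      moreover have "integral {0..1} \<psi> \<ge> 0"
        by (intro integral_nonneg integrable_continuous_real c\<psi> \<psi>nn)
      ultimately show ?thesis by simp
    qed
    define \<rho> where "\<rho> = (\<lambda>x. \<psi> x * (w x - c))"
    have c\<rho>: "continuous_on S \<rho>" for S unfolding \<rho>_def by (intro continuous_intros c\<psi> cw)
    define \<phi> where "\<phi> = (\<lambda>x. integral {0..x} \<rho>)"
    have int\<rho>: "integral {0..1} \<rho> = 0"
    proof -
      have "integral {0..1} \<rho> = integral {0..1} (\<lambda>x. \<psi> x * w x - c * \<psi> x)"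
        by (simp add: \<rho>_def algebra_simps)
      also have "\<dots> = integral {0..1} (\<lambda>x. \<psi> x * w x) - c * integral {0..1} \<psi>"
        by (subst integral_diff) (auto intro!: integrable_continuous_real continuous_intros c\<psi> cw)
      finally show ?thesis using I\<psi> by (simp add: c_def)
    qed
    have \<phi>low: "\<phi> x = 0" if "x \<le> d" for x
    proof -
      have "\<phi> x = integral {0..x} (\<lambda>_. 0)"
        unfolding \<phi>_def by (rule integral_cong) (use that \<psi>0 in \<open>auto simp: \<rho>_def\<close>)
      then show ?thesis by simp
    qed
    have \<phi>mid: "(\<phi> has_real_derivative \<rho> x) (at x)" if "0 < x" for x
    proof -
      have "(\<phi> has_real_derivative \<rho> x) (at x within {0..x+1})"
        unfolding \<phi>_def by (rule integral_has_real_derivative) (use that c\<rho> in auto)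
      then show ?thesis using that by (simp add: at_within_Icc_at)
    qed
    have \<phi>high: "\<phi> x = 0" if "1 - d \<le> x" for x
    proof -
      have "\<phi> x = \<phi> 1" if x: "1 - d \<le> x" for x
      proof -
        have c: "\<phi> y = integral {0..1-d} \<rho>" if "y \<ge> 1 - d" for y
        proof -
          have "integral {0..1-d} \<rho> + integral {1-d..y} \<rho> = \<phi> y"
            unfolding \<phi>_def by (rule Henstock_Kurzweil_Integration.integral_combine)
              (use that d in \<open>auto intro!: integrable_continuous_real c\<rho>\<close>)
          moreover have "integral {1-d..y} \<rho> = integral {1-d..y} (\<lambda>_. 0)"
            by (rule integral_cong) (use \<psi>0 in \<open>auto simp: \<rho>_def\<close>)
          ultimately show ?thesis by simp
        qed
        show ?thesis using c[OF x] c[of 1] d by simp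
      qed
      from this[OF that] show ?thesis using int\<rho> unfolding \<phi>_def by simp
    qed
    have \<phi>d: "(\<phi> has_real_derivative \<rho> x) (at x)" for x
    proof (cases "0 < x")
      case False
      then have "\<rho> x = 0" using \<psi>0[of x] d by (auto simp: \<rho>_def)
      have "(\<phi> has_real_derivative 0) (at x)"
      proof (rule has_field_derivative_transform_within_open[of "\<lambda>_. 0" _ _ "{..<d}"])
        show "x \<in> {..<d}" using False d by auto
      qed (use \<phi>low in auto)
      then show ?thesis using \<open>\<rho> x = 0\<close> by simp
    qed (use \<phi>mid in auto)
    have tf: "test_fun \<phi>"
      unfolding test_fun_def C1_differentiable_on_def
    proof (intro conjI exI ballI allI impI)
      show "(\<phi> has_vector_derivative \<rho> x) (at x)" for x
        using \<phi>d by (simp add: has_real_derivative_iff_has_vector_derivative)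
      show "compact {d..1-d}" by simp
      show "{d..1-d} \<subseteq> {0<..<1}" using d by auto
      show "\<phi> x = 0" if "x \<notin> {d..1-d}" for x using that \<phi>low[of x] \<phi>high[of x] by fastforce
    qed (rule c\<rho>)
    have d\<phi>: "deriv \<phi> x = \<rho> x" for x using \<phi>d by (rule DERIV_imp_deriv)
    have "integral {0..1} (\<lambda>x. \<rho> x * w x) = 0"
    proof -
      have "set_integrable lborel {0..1} (\<lambda>x. \<rho> x * w x)"
        by (rule borel_integrable_atLeastAtMost') (intro continuous_intros c\<rho> cw)
      then have "integral {0..1} (\<lambda>x. \<rho> x * w x) = (LINT x:{0..1}|lborel. \<rho> x * w x)"
        using set_borel_integral_eq_integral(2) by metis
      also have "\<dots> = (LINT x:{0<..<1}|lborel. \<rho> x * w x)"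
      proof -
        note [measurable] = borel_measurable_continuous_onI[OF c\<rho>] borel_measurable_continuous_onI[OF cw]
        have "AE x in lborel. x \<noteq> 0 \<and> x \<noteq> (1::real)"
          using lborel_AE_neq[of 0] lborel_AE_neq[of 1] by eventually_elim auto
        then have "AE x in lborel. indicator {0..1} x *\<^sub>R (\<rho> x * w x) = indicator {0<..<1} x *\<^sub>R (\<rho> x * w x)"
          by eventually_elim (auto simp: indicator_def)
        then show ?thesis
          unfolding set_lebesgue_integral_def by (intro integral_cong_AE) measurable
      qed
      also have "\<dots> = (LINT x:{0<..<1}|lborel. deriv \<phi> x * u x)"
        unfolding set_lebesgue_integral_def
        by (rule Bochner_Integration.integral_cong) (auto simp: d\<phi> w_def indicator_def)
      finally show ?thesis using orth[OF tf] by simp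
    qed
    moreover have "integral {0..1} (\<lambda>x. \<psi> x * (w x - c)^2) = integral {0..1} (\<lambda>x. \<rho> x * w x) - c * integral {0..1} \<rho>"
    proof -
      have "integral {0..1} (\<lambda>x. \<psi> x * (w x - c)^2) = integral {0..1} (\<lambda>x. \<rho> x * w x - c * \<rho> x)"
        by (simp add: \<rho>_def power2_eq_square algebra_simps)
      also have "\<dots> = integral {0..1} (\<lambda>x. \<rho> x * w x) - c * integral {0..1} \<rho>"
        by (subst integral_diff) (auto intro!: integrable_continuous_real continuous_intros c\<rho> cw)
      finally show ?thesis .
    qed
    ultimately have z: "integral {0..1} (\<lambda>x. \<psi> x * (w x - c)^2) = 0" using int\<rho> by simp
    have cont: "continuous_on {0..1} (\<lambda>x. \<psi> x * (w x - c)^2)" by (intro continuous_intros c\<psi> cw)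
    have "((\<lambda>x. \<psi> x * (w x - c)^2) has_integral 0) (cbox 0 1)"
      using integrable_integral[OF integrable_continuous_real[OF cont]] z by simp
    then have zero: "\<psi> x * (w x - c)^2 = 0" if "x \<in> {0..1}" for x
      using has_integral_0_cbox_imp_0[of 0 1 "\<lambda>x. \<psi> x * (w x - c)^2" x] cont \<psi>nn that by simp
    have "u x = c" if "x \<in> {d<..<1-d}" for x
      using zero[of x] \<psi>pos[of x] that d by (auto simp: w_def)
    then show ?thesis by blast
  qed
  have const: "u x = u (1/2)" if "x \<in> {0<..<1}" for x
  proof -
    define d where "d = min x (1-x) / 2"
    have d: "0 < d" "d < 1/2" "x \<in> {d<..<1-d}" "1/2 \<in> {d<..<1-d}" using that by (auto simp: d_def min_def field_simps)
    then show ?thesis using key[OF d(1,2)] by fastforce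
  qed
  have "u x = u (1/2)" if "x \<in> {0..1}" for x
  proof (rule continuous_constant_on_closure[of "{0<..<1}" u])
    show "continuous_on (closure {0<..<1}) u" using u by simp
    show "u z = u (1/2)" if "z \<in> {0<..<1}" for z using that by (rule const)
    show "x \<in> closure {0<..<1}" using that by simp
  qed
  with x y show ?thesis by metis
qed

section \<open>Weak derivatives and total variation\<close>

text \<open>
  One direction is integration by parts for the primitive \<open>K\<close> of \<open>g\<close>. For the other, \<open>h - K\<close> is
  orthogonal to all derivatives of test functions, so its real and imaginary parts are constant.
\<close>

lemma weak_deriv_iff_primitive:
  fixes h g :: "real \<Rightarrow> complex"
  assumes h: "continuous_on {0..1} h"
  shows "weak_deriv h g \<longleftrightarrow> set_integrable lborel {0<..<1} g \<and>
    (\<forall>x y. 0 \<le> x \<and> x \<le> y \<and> y \<le> 1 \<longrightarrow> h y - h x = (LINT t:{x<..<y}|lborel. g t))"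
proof (cases "set_integrable lborel {0<..<1} g")
  case False then show ?thesis by (simp add: weak_deriv_def)
next
  case g: True
  define k where "k = (\<lambda>t. indicator {0<..<1} t *\<^sub>R g t)"
  define K where "K = (\<lambda>x. LINT t:{..x}|lborel. k t)"
  have ik: "integrable lborel k" using g by (simp add: k_def set_integrable_def)
  have ikS: "integrable lborel (\<lambda>t. indicator S t *\<^sub>R k t)" if "S \<in> sets borel" for S
    using that ik by (intro integrable_mult_indicator) auto
  have k0: "k t = 0" if "t \<notin> {0<..<1}" for t using that by (simp add: k_def)
  have Kdiff: "K y - K x = (LINT t:{x<..<y}|lborel. g t)" if "0 \<le> x" "x \<le> y" "y \<le> 1" for x y
  proof -
    have "K y - K x = (\<integral>t. indicator {..y} t *\<^sub>R k t - indicator {..x} t *\<^sub>R k t \<partial>lborel)"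
      unfolding K_def set_lebesgue_integral_def by (rule Bochner_Integration.integral_diff[symmetric]) (auto intro: ikS)
    also have "\<dots> = (\<integral>t. indicator {x<..y} t *\<^sub>R k t \<partial>lborel)"
      by (rule Bochner_Integration.integral_cong) (use that in \<open>auto simp: indicator_def\<close>)
    also have "\<dots> = (\<integral>t. indicator {x<..<y} t *\<^sub>R k t \<partial>lborel)"
    proof (rule integral_cong_AE)
      show "AE t in lborel. indicator {x<..y} t *\<^sub>R k t = indicator {x<..<y} t *\<^sub>R k t"
        using lborel_AE_neq[of y] by eventually_elim (auto simp: indicator_def)
    qed (use ik in auto)
    also have "\<dots> = (LINT t:{x<..<y}|lborel. g t)"
      unfolding set_lebesgue_integral_def
      by (rule Bochner_Integration.integral_cong) (use that in \<open>auto simp: indicator_def k_def\<close>)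
    finally show ?thesis .
  qed
  have Kcont: "continuous_on {0..1} K"
  proof -
    have s: "set_integrable lborel {0..x} k" for x
      unfolding set_integrable_def by (rule ikS) simp
    have "K x = integral {0..x} k" for x
    proof -
      have "K x = (LINT t:{0..x}|lborel. k t)"
        unfolding K_def set_lebesgue_integral_def
        by (rule Bochner_Integration.integral_cong) (use k0 in \<open>auto simp: indicator_def\<close>)
      then show ?thesis using set_borel_integral_eq_integral(2)[OF s] by simp
    qed
    moreover have "continuous_on {0..1} (\<lambda>x. integral {0..x} k)"
      by (rule indefinite_integral_continuous_1) (rule set_borel_integral_eq_integral(1)[OF s])
    ultimately show ?thesis by simp
  qed
  have parts: "(LINT x:{0<..<1}|lborel. deriv \<phi> x *\<^sub>R K x) = - (LINT x:{0<..<1}|lborel. \<phi> x *\<^sub>R g x)"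
    if \<phi>: "test_fun \<phi>" for \<phi>
  proof -
    have "(LINT t:{0<..<1}|lborel. \<phi> t *\<^sub>R k t) = (LINT x:{0<..<1}|lborel. \<phi> x *\<^sub>R g x)"
      unfolding set_lebesgue_integral_def
      by (rule Bochner_Integration.integral_cong) (auto simp: indicator_def k_def)
    then show ?thesis using primitive_by_parts[OF \<phi> ik k0] by (simp add: K_def)
  qed
  have si: "set_integrable lborel {0<..<1} (\<lambda>x. deriv \<phi> x *\<^sub>R w x)" if "test_fun \<phi>" "continuous_on {0..1} w"
    for \<phi> and w :: "real \<Rightarrow> complex"
  proof (rule set_integrable_subset)
    show "set_integrable lborel {0..1} (\<lambda>x. deriv \<phi> x *\<^sub>R w x)"
      by (rule borel_integrable_atLeastAtMost') (intro continuous_intros that test_fun_deriv)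
  qed auto
  show ?thesis
  proof
    assume wd: "weak_deriv h g"
    define u where "u = (\<lambda>x. h x - K x)"
    have cu: "continuous_on {0..1} u" unfolding u_def by (intro continuous_intros h Kcont)
    have orth: "(LINT x:{0<..<1}|lborel. deriv \<phi> x *\<^sub>R u x) = 0" if \<phi>: "test_fun \<phi>" for \<phi>
    proof -
      have "(LINT x:{0<..<1}|lborel. deriv \<phi> x *\<^sub>R u x) =
          (LINT x:{0<..<1}|lborel. deriv \<phi> x *\<^sub>R h x) - (LINT x:{0<..<1}|lborel. deriv \<phi> x *\<^sub>R K x)"
        unfolding u_def scaleR_diff_right
        by (rule set_integral_diff(2)) (intro si \<phi> h Kcont)+
      then show ?thesis using parts[OF \<phi>] wd \<phi> unfolding weak_deriv_def by simp
    qed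
    have Re0: "(LINT x:{0<..<1}|lborel. deriv \<phi> x * Re (u x)) = 0" 
     and Im0: "(LINT x:{0<..<1}|lborel. deriv \<phi> x * Im (u x)) = 0" if \<phi>: "test_fun \<phi>" for \<phi>
    proof -
      have i: "integrable lborel (\<lambda>x. indicator {0<..<1} x *\<^sub>R deriv \<phi> x *\<^sub>R u x)"
        using si[OF \<phi> cu] by (simp add: set_integrable_def)
      show "(LINT x:{0<..<1}|lborel. deriv \<phi> x * Re (u x)) = 0"
        using integral_Re[OF i] orth[OF \<phi>] by (simp add: set_lebesgue_integral_def mult.assoc)
      show "(LINT x:{0<..<1}|lborel. deriv \<phi> x * Im (u x)) = 0"
        using integral_Im[OF i] orth[OF \<phi>] by (simp add: set_lebesgue_integral_def mult.assoc)
    qed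
    have "u x = u y" if "x \<in> {0..1}" "y \<in> {0..1}" for x y
      using du_Bois_Reymond[OF continuous_on_Re[OF cu] Re0 that] du_Bois_Reymond[OF continuous_on_Im[OF cu] Im0 that]
      by (simp add: complex_eq_iff)
    then have "h y - h x = K y - K x" if "x \<in> {0..1}" "y \<in> {0..1}" for x y
    proof -
      have "h x - K x = h y - K y" using \<open>\<And>y x. x \<in> {0..1} \<Longrightarrow> y \<in> {0..1} \<Longrightarrow> u x = u y\<close>[OF that] by (simp add: u_def)
      then show ?thesis by (simp add: algebra_simps)
    qed
    then show "set_integrable lborel {0<..<1} g \<and>
      (\<forall>x y. 0 \<le> x \<and> x \<le> y \<and> y \<le> 1 \<longrightarrow> h y - h x = (LINT t:{x<..<y}|lborel. g t))"
      using g Kdiff by auto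
  next
    assume *: "set_integrable lborel {0<..<1} g \<and>
      (\<forall>x y. 0 \<le> x \<and> x \<le> y \<and> y \<le> 1 \<longrightarrow> h y - h x = (LINT t:{x<..<y}|lborel. g t))"
    have K0: "K 0 = 0" 
    proof -
      have "(\<lambda>t. indicator {..0} t *\<^sub>R k t) = (\<lambda>_. 0)" using k0 by (auto simp: indicator_def)
      then show ?thesis by (simp add: K_def set_lebesgue_integral_def)
    qed
    have hK: "h x = K x + h 0" if "x \<in> {0..1}" for x
      using that Kdiff[of 0 x] * K0 by (auto simp: algebra_simps)
    show "weak_deriv h g"
      unfolding weak_deriv_def
    proof (intro conjI allI impI g)
      fix \<phi> assume \<phi>: "test_fun \<phi>"
      have "(LINT x:{0<..<1}|lborel. deriv \<phi> x *\<^sub>R h x) = (LINT x:{0<..<1}|lborel. deriv \<phi> x *\<^sub>R K x + deriv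
          \<phi> x *\<^sub>R h 0)"
        unfolding set_lebesgue_integral_def
      proof (rule Bochner_Integration.integral_cong[OF refl])
        fix x :: real
        show "indicator {0<..<1} x *\<^sub>R deriv \<phi> x *\<^sub>R h x = indicator {0<..<1} x *\<^sub>R (deriv \<phi> x *\<^sub>R K x +
            deriv \<phi> x *\<^sub>R h 0)"
        proof (cases "x \<in> {0<..<1}")
          case True
          then have "h x = K x + h 0" by (intro hK) auto
          then show ?thesis by (simp add: scaleR_add_right)
        qed simp
      qed
      also have "\<dots> = (LINT x:{0<..<1}|lborel. deriv \<phi> x *\<^sub>R K x) + (LINT x:{0<..<1}|lborel. deriv \<phi> x *\<^sub>R h 0)"
        by (rule set_integral_add(2)) (intro si \<phi> Kcont continuous_intros)+
      also have "(LINT x:{0<..<1}|lborel. deriv \<phi> x *\<^sub>R h 0) = 0"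
      proof -
        have i: "integrable lborel (\<lambda>x. indicator {0..1} x * deriv \<phi> x)"
          using borel_integrable_atLeastAtMost'[OF test_fun_deriv(2)[OF \<phi>], of 0 1] by (simp add: set_integrable_def)
        have "(LINT x:{0<..<1}|lborel. deriv \<phi> x *\<^sub>R h 0) = (\<integral>x. (indicator {0..1} x * deriv \<phi> x) *\<^sub>R h 0 \<partial>lborel)"
          unfolding set_lebesgue_integral_def
        proof (rule integral_cong_AE)
          show "AE x in lborel. indicator {0<..<1} x *\<^sub>R deriv \<phi> x *\<^sub>R h 0 = (indicator {0..1} x * deriv \<phi> x) *\<^sub>R h 0"
            using lborel_AE_neq[of 0] lborel_AE_neq[of 1] by eventually_elim (auto simp: indicator_def)
        qed (use test_fun_measurable[OF \<phi>] in auto)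
        also have "\<dots> = (\<integral>x. indicator {0..1} x * deriv \<phi> x \<partial>lborel) *\<^sub>R h 0"
          by (rule integral_scaleR_left) (rule i)
        also have "(\<integral>x. indicator {0..1} x * deriv \<phi> x \<partial>lborel) = 0"
          using integral_deriv_test_fun[OF \<phi>, of 0] test_fun_deriv(3)[OF \<phi>, of 0] by simp
        finally show ?thesis by simp
      qed
      finally show "(LINT x:{0<..<1}|lborel. deriv \<phi> x *\<^sub>R h x) = - (LINT x:{0<..<1}|lborel. \<phi> x *\<^sub>R g x)"
        using parts[OF \<phi>] by simp
    qed
  qed
qed

text \<open>
  \<open>B\<close> bounds the total variation of \<open>h\<close> on \<open>S\<close>. Families of nonoverlapping intervals, rather than
  increasing sequences of points, are used because the images of such a family under the inverse
  branches again form one, whatever the order of the images.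
\<close>

definition var_bound :: "real set \<Rightarrow> (real \<Rightarrow> complex) \<Rightarrow> real \<Rightarrow> bool" where
  "var_bound S h B \<longleftrightarrow> (\<forall>D. finite D \<longrightarrow> (\<forall>(a, b)\<in>D. a \<in> S \<and> b \<in> S \<and> a \<le> b) \<longrightarrow>
     disjoint_family_on (\<lambda>(a, b). {a<..<b}) D \<longrightarrow> (\<Sum>(a, b)\<in>D. norm (h b - h a)) \<le> B)"

lemma var_boundD:
  assumes "var_bound S h B" "finite D" "\<And>a b. (a, b) \<in> D \<Longrightarrow> a \<in> S \<and> b \<in> S \<and> a \<le> b"
    "disjoint_family_on (\<lambda>(a, b). {a<..<b}) D"
  shows "(\<Sum>(a, b)\<in>D. norm (h b - h a)) \<le> B"
  using assms unfolding var_bound_def by blast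

lemma var_bound_weak_deriv:
  assumes h: "continuous_on {0..1} h" and wd: "weak_deriv h g"
  shows "var_bound {0..1} h (LINT x:{0<..<1}|lborel. norm (g x))"
  unfolding var_bound_def
proof (intro allI impI)
  fix D :: "(real \<times> real) set"
  assume D: "finite D" "\<forall>(a, b)\<in>D. a \<in> {0..1} \<and> b \<in> {0..1} \<and> a \<le> b" 
    and disj: "disjoint_family_on (\<lambda>(a, b). {a<..<b}) D"
  have g: "set_integrable lborel {0<..<1} g"
    and hg: "\<And>x y. 0 \<le> x \<Longrightarrow> x \<le> y \<Longrightarrow> y \<le> 1 \<Longrightarrow> h y - h x = (LINT t:{x<..<y}|lborel. g t)"
    using wd weak_deriv_iff_primitive[OF h] by auto
  have sub: "{a<..<b} \<subseteq> {0<..<1}" if "(a, b) \<in> D" for a b using D that by fastforce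
  have ig: "set_integrable lborel {a<..<b} g" if "(a, b) \<in> D" for a b
    by (rule set_integrable_subset[OF g _ sub[OF that]]) auto
  have ign: "set_integrable lborel {a<..<b} (\<lambda>x. norm (g x))" if "(a, b) \<in> D" for a b
    by (rule set_integrable_norm) (rule ig[OF that])
  have "(\<Sum>(a, b)\<in>D. norm (h b - h a)) \<le> (\<Sum>p\<in>D. LINT t:(case p of (a, b) \<Rightarrow> {a<..<b})|lborel. norm (g t))"
  proof (rule sum_mono, clarify)
    fix a b assume ab: "(a, b) \<in> D"
    have "norm (h b - h a) = norm (LINT t:{a<..<b}|lborel. g t)" using hg D ab by fastforce
    also have "\<dots> \<le> (LINT t:{a<..<b}|lborel. norm (g t))"
      by (rule set_integral_norm_bound) (rule ig[OF ab])
    finally show "norm (h b - h a) \<le> (LINT t:{a<..<b}|lborel. norm (g t))" .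
  qed
  also have "\<dots> = (LINT t|lborel. (\<Sum>p\<in>D. indicator (case p of (a, b) \<Rightarrow> {a<..<b}) t *\<^sub>R norm (g t)))"
    unfolding set_lebesgue_integral_def
    by (rule Bochner_Integration.integral_sum[symmetric]) (use ign in \<open>auto simp: set_integrable_def\<close>)
  also have "\<dots> \<le> (LINT t:{0<..<1}|lborel. norm (g t))"
    unfolding set_lebesgue_integral_def
  proof (rule integral_mono)
    show "integrable lborel (\<lambda>t. \<Sum>p\<in>D. indicator (case p of (a, b) \<Rightarrow> {a<..<b}) t *\<^sub>R norm (g t))"
      by (rule Bochner_Integration.integrable_sum) (use ign in \<open>auto simp: set_integrable_def\<close>)
    show "integrable lborel (\<lambda>t. indicator {0<..<1} t *\<^sub>R norm (g t))"
      using set_integrable_norm[OF g] by (simp add: set_integrable_def)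
    fix t
    have "(\<Sum>p\<in>D. indicator (case p of (a, b) \<Rightarrow> {a<..<b}) t) = (indicator (\<Union>p\<in>D. case p of (a, b) \<Rightarrow> {a<..<b}) t :: real)"
      by (rule indicator_UN_disjoint[OF D(1) disj, symmetric])
    also have "\<dots> \<le> indicator {0<..<1} t"
    proof -
      have "(\<Union>p\<in>D. case p of (a, b) \<Rightarrow> {a<..<b}) \<subseteq> {0<..<1}" using sub by fastforce
      then show ?thesis by (auto simp: indicator_def)
    qed
    finally show "(\<Sum>p\<in>D. indicator (case p of (a, b) \<Rightarrow> {a<..<b}) t *\<^sub>R norm (g t)) \<le> indicator {0<..<1} t
        *\<^sub>R norm (g t)"
      unfolding scaleR_sum_left[symmetric] by (simp add: mult_right_mono)
  qed
  finally show "(\<Sum>(a, b)\<in>D. norm (h b - h a)) \<le> (LINT x:{0<..<1}|lborel. norm (g x))" .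
qed

text \<open>
  Henstock's lemma: on a fine tagged division the Riemann sum of \<open>norm \<circ> g\<close> is close to the sum of
  the \<open>norm (integral K g)\<close>, and \<open>integral K g\<close> is the increment of \<open>h\<close> over \<open>K\<close>.
\<close>

lemma weak_deriv_norm_le_var:
  assumes h: "continuous_on {0..1} h" and wd: "weak_deriv h g" and vb: "var_bound {0..1} h B"
  shows "(LINT x:{0<..<1}|lborel. norm (g x)) \<le> B"
proof (rule field_le_epsilon)
  fix e :: real assume e: "e > 0"
  have g: "set_integrable lborel {0<..<1} g"
    and hg: "\<And>x y. 0 \<le> x \<Longrightarrow> x \<le> y \<Longrightarrow> y \<le> 1 \<Longrightarrow> h y - h x = (LINT t:{x<..<y}|lborel. g t)"
    using wd weak_deriv_iff_primitive[OF h] by auto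
  define k where "k = (\<lambda>t. indicator {0<..<1} t *\<^sub>R g t)"
  have ik: "integrable lborel k" using g by (simp add: k_def set_integrable_def)
  have sk: "set_integrable lborel S k" if "S \<in> sets borel" for S
    unfolding set_integrable_def using that ik by (intro integrable_mult_indicator) auto
  have intk: "integral {a..b} k = h b - h a" if "0 \<le> a" "a \<le> b" "b \<le> 1" for a b
  proof -
    have "integral {a..b} k = (LINT t:{a..b}|lborel. k t)"
      using set_borel_integral_eq_integral(2)[OF sk[of "{a..b}"]] by simp
    also have "\<dots> = (LINT t:{a<..<b}|lborel. g t)"
      unfolding set_lebesgue_integral_def
    proof (rule integral_cong_AE)
      show "AE t in lborel. indicator {a..b} t *\<^sub>R k t = indicator {a<..<b} t *\<^sub>R g t"
        using lborel_AE_neq[of a] lborel_AE_neq[of b] by eventually_elim (use that in \<open>auto simp: indicator_def k_def\<close>)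
      show "(\<lambda>t. indicator {a<..<b} t *\<^sub>R g t) \<in> borel_measurable lborel"
      proof -
        have "{a<..<b} \<subseteq> {0<..<1}" using that by auto
        then have "set_integrable lborel {a<..<b} g" using set_integrable_subset[OF g, of "{a<..<b}"] by simp
        then show ?thesis unfolding set_integrable_def by (rule borel_measurable_integrable)
      qed
    qed (use ik in auto)
    finally show ?thesis using hg that by simp
  qed
  have k_on: "k integrable_on cbox 0 1"
    using set_borel_integral_eq_integral(1)[OF sk[of "{0..1}"]] by simp
  have sn: "set_integrable lborel {0..1} (\<lambda>x. norm (k x))"
    by (rule set_integrable_norm) (rule sk, simp)
  define I where "I = (LINT x:{0<..<1}|lborel. norm (g x))"
  have "integral {0..1} (\<lambda>x. norm (k x)) = (LINT x:{0..1}|lborel. norm (k x))"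
    using set_borel_integral_eq_integral(2)[OF sn] by simp
  also have "\<dots> = I" unfolding I_def set_lebesgue_integral_def
    by (rule Bochner_Integration.integral_cong) (auto simp: indicator_def k_def)
  finally have nI: "((\<lambda>x. norm (k x)) has_integral I) (cbox 0 1)"
    using integrable_integral[OF set_borel_integral_eq_integral(1)[OF sn]] by simp
  have e2: "e / 2 > 0" using e by simp
  obtain \<gamma>1 where \<gamma>1: "gauge \<gamma>1" "\<And>p. \<lbrakk>p tagged_partial_division_of (cbox 0 1); \<gamma>1 fine p\<rbrakk> \<Longrightarrow>
             (\<Sum>(x,K)\<in>p. norm (measure lborel K *\<^sub>R k x - integral K k)) < e / 2"
    by (rule Henstock_lemma[OF k_on e2]) (rule that)
  obtain \<gamma>2 where \<gamma>2: "gauge \<gamma>2" "\<forall>p. p tagged_division_of (cbox 0 1) \<and> \<gamma>2 fine p \<longrightarrow>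
             norm ((\<Sum>(x,K)\<in>p. measure lborel K *\<^sub>R norm (k x)) - I) < e / 2"
    using nI[unfolded has_integral, THEN spec, THEN mp, OF e2] by (elim exE conjE) (rule that)
  obtain p where p: "p tagged_division_of (cbox 0 (1::real))" "(\<lambda>x. \<gamma>1 x \<inter> \<gamma>2 x) fine p"
    by (rule fine_division_exists[OF gauge_Int[OF \<gamma>1(1) \<gamma>2(1)]]) (rule that)
  have fine: "\<gamma>1 fine p" "\<gamma>2 fine p" using p(2) by (auto simp: fine_def)
  have finp: "finite p" using p(1) by blast
  have "I \<le> (\<Sum>(x,K)\<in>p. measure lborel K *\<^sub>R norm (k x)) + e / 2"
    using \<gamma>2(2)[THEN spec, THEN mp, OF conjI[OF p(1) fine(2)]] unfolding real_norm_def by linarith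
  also have "(\<Sum>(x,K)\<in>p. measure lborel K *\<^sub>R norm (k x)) \<le>
      (\<Sum>(x,K)\<in>p. norm (measure lborel K *\<^sub>R k x - integral K k) + norm (integral K k))"
  proof (rule sum_mono, clarify)
    fix x :: real and K :: "real set"
    have "measure lborel K *\<^sub>R norm (k x) = norm (measure lborel K *\<^sub>R k x)" by simp
    also have "\<dots> \<le> norm (measure lborel K *\<^sub>R k x - integral K k) + norm (integral K k)"
      using norm_triangle_ineq[of "measure lborel K *\<^sub>R k x - integral K k" "integral K k"] by simp
    finally show "measure lborel K *\<^sub>R norm (k x) \<le> norm (measure lborel K *\<^sub>R k x - integral K k) + norm
        (integral K k)" .
  qed
  also have "\<dots> = (\<Sum>(x,K)\<in>p. norm (measure lborel K *\<^sub>R k x - integral K k)) + (\<Sum>(x,K)\<in>p. norm (integral K k))"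
    by (simp add: sum.distrib split_def)
  also have "(\<Sum>(x,K)\<in>p. norm (measure lborel K *\<^sub>R k x - integral K k)) \<le> e / 2"
    using \<gamma>1(2)[OF _ fine(1)] p(1) by (simp add: tagged_division_of_def less_imp_le)
  also have "(\<Sum>(x,K)\<in>p. norm (integral K k)) = (\<Sum>K\<in>snd ` p. norm (integral K k))"
  proof (rule sum.over_tagged_division_lemma[OF p(1)])
    show "norm (integral (cbox u v) k) = 0" if "box u v = {}" for u v :: real
      using that by (cases "u = v") auto
  qed
  also have "\<dots> \<le> B"
  proof -
    have dv: "snd ` p division_of cbox 0 1" by (rule division_of_tagged_division[OF p(1)])
    have K: "\<exists>a b. K = {a..b} \<and> 0 \<le> a \<and> a \<le> b \<and> b \<le> 1" if KP: "K \<in> snd ` p" for K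
    proof -
      obtain a b where "K = cbox a b" "K \<noteq> {}" "K \<subseteq> cbox 0 1"
        using division_ofD(2,3,4)[OF dv KP] by metis
      then show ?thesis by (intro exI[of _ a] exI[of _ b]) auto
    qed
    \<comment> \<open>recovers the end points of a closed interval of the division\<close>
    define ends where "ends = (\<lambda>K :: real set. (Inf K, Sup K))"
    have eK: "ends {a..b} = (a, b)" if "a \<le> b" for a b using that by (simp add: ends_def)
    have inj: "inj_on ends (snd ` p)"
    proof (rule inj_onI)
      fix K L assume "K \<in> snd ` p" "L \<in> snd ` p" "ends K = ends L"
      with K[of K] K[of L] eK show "K = L" by (metis prod.inject)
    qed
    have "(\<Sum>K\<in>snd ` p. norm (integral K k)) = (\<Sum>K\<in>snd ` p. (\<lambda>(a, b). norm (h b - h a)) (ends K))"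
    proof (rule sum.cong[OF refl])
      fix K assume "K \<in> snd ` p"
      then obtain a b where "K = {a..b}" "0 \<le> a" "a \<le> b" "b \<le> 1" using K by metis
      then show "norm (integral K k) = (\<lambda>(a, b). norm (h b - h a)) (ends K)" by (simp add: eK intk)
    qed
    also have "\<dots> = (\<Sum>(a, b)\<in>ends ` snd ` p. norm (h b - h a))"
      by (simp only: sum.reindex[OF inj] o_def)
    also have "\<dots> \<le> B"
    proof (rule var_boundD[OF vb])
      show "finite (ends ` snd ` p)" using finp by simp
      fix a b assume "(a, b) \<in> ends ` snd ` p"
      then obtain K where "(a, b) = ends K" "K \<in> snd ` p" by (rule imageE)
      moreover obtain c d where "K = {c..d}" "0 \<le> c" "c \<le> d" "d \<le> 1"
        using K[OF \<open>K \<in> snd ` p\<close>] by (elim exE conjE) (rule that)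
      ultimately show "a \<in> {0..1} \<and> b \<in> {0..1} \<and> a \<le> b" by (simp add: eK)
    next
      show "disjoint_family_on (\<lambda>(a, b). {a<..<b}) (ends ` snd ` p)"
        unfolding disjoint_family_on_def
      proof (intro ballI impI)
        fix m n assume mn: "m \<in> ends ` snd ` p" "n \<in> ends ` snd ` p" "m \<noteq> n"
        obtain K where K1: "m = ends K" "K \<in> snd ` p" using mn(1) by (rule imageE)
        obtain L where L1: "n = ends L" "L \<in> snd ` p" using mn(2) by (rule imageE)
        obtain a b where ab: "K = {a..b}" "a \<le> b" using K[OF K1(2)] by (elim exE conjE) (rule that)
        obtain c d where cd: "L = {c..d}" "c \<le> d" using K[OF L1(2)] by (elim exE conjE) (rule that)
        have "K \<noteq> L" using mn(3) unfolding K1(1) L1(1) by auto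
        then have "interior K \<inter> interior L = {}" by (rule division_ofD(5)[OF dv K1(2) L1(2)])
        then show "(case m of (a, b) \<Rightarrow> {a<..<b}) \<inter> (case n of (a, b) \<Rightarrow> {a<..<b}) = {}"
          unfolding K1(1) L1(1) ab(1) cd(1) eK[OF ab(2)] eK[OF cd(2)] by simp
      qed
    qed
    finally show ?thesis .
  qed
  finally show "(LINT x:{0<..<1}|lborel. norm (g x)) \<le> B + e" unfolding I_def by simp
qed

text \<open>
  Affine maps \<open>s n\<close> squeeze \<open>[0, 1]\<close> into the open interval and tend to the identity; continuity
  passes the bound to the limit.
\<close>

lemma var_bound_interior:
  assumes h: "continuous_on {0..1} h" and vb: "var_bound {0<..<1} h B"
  shows "var_bound {0..1} h B"
  unfolding var_bound_def
proof (intro allI impI)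
  fix D :: "(real \<times> real) set"
  assume D: "finite D" "\<forall>(a, b)\<in>D. a \<in> {0..1} \<and> b \<in> {0..1} \<and> a \<le> b" 
    and disj: "disjoint_family_on (\<lambda>(a, b). {a<..<b}) D"
  define s where "s = (\<lambda>(n::nat) x. (x + inverse (Suc n)) / (1 + 2 * inverse (real (Suc n))))"
  have pos: "1 + 2 * inverse (real (Suc n)) > 0" for n by (simp add: add_pos_nonneg)
  have s01: "s n x \<in> {0<..<1}" if "x \<in> {0..1}" for n x
  proof -
    define i where "i = inverse (real (Suc n))"
    have i: "i > 0" unfolding i_def by simp
    have "0 < x + i" "x + i < 1 + 2 * i" using that i by auto
    moreover have "0 < 1 + 2 * i" using i by simp
    ultimately show ?thesis unfolding s_def greaterThanLessThan_iff i_def[symmetric]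
      by (simp add: divide_less_eq)
  qed
  have smono: "s n x < s n y \<longleftrightarrow> x < y" for n x y
    unfolding s_def by (subst divide_less_cancel) (use pos[of n] in \<open>simp del: of_nat_Suc\<close>)
  have sinj: "s n x = s n y \<longleftrightarrow> x = y" for n x y using smono[of n x y] smono[of n y x] by (metis linorder_neq_iff)
  have slim: "(\<lambda>n. s n x) \<longlonglongrightarrow> x" for x
  proof -
    have "(\<lambda>n. s n x) \<longlonglongrightarrow> (x + 0) / (1 + 2 * 0)"
      unfolding s_def by (intro tendsto_intros LIMSEQ_inverse_real_of_nat) simp
    then show ?thesis by simp
  qed
  have hlim: "(\<lambda>n. h (s n x)) \<longlonglongrightarrow> h x" if "x \<in> {0..1}" for x
    by (rule continuous_on_tendsto_compose[OF h slim that]) (use s01[OF that] in \<open>auto intro!: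
        always_eventually less_imp_le\<close>)
  have le: "(\<Sum>(a, b)\<in>D. norm (h (s n b) - h (s n a))) \<le> B" for n
  proof -
    define m where "m = (\<lambda>(a, b). (s n a, s n b))"
    have inj: "inj_on m D" by (auto simp: inj_on_def m_def sinj)
    have "(\<Sum>(a, b)\<in>D. norm (h (s n b) - h (s n a))) = (\<Sum>p\<in>D. (\<lambda>(a, b). norm (h b - h a)) (m p))"
      by (rule sum.cong) (auto simp: m_def)
    also have "\<dots> = (\<Sum>(a, b)\<in>m ` D. norm (h b - h a))"
      by (simp only: sum.reindex[OF inj] o_def)
    also have "\<dots> \<le> B"
    proof (rule var_boundD[OF vb])
      show "finite (m ` D)" using D by simp
      fix a b assume "(a, b) \<in> m ` D"
      then show "a \<in> {0<..<1} \<and> b \<in> {0<..<1} \<and> a \<le> b" using D(2) s01 smono sinj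
        unfolding m_def by (fastforce simp: le_less)
    next
      have "{s n a<..<s n b} \<inter> {s n c<..<s n d} = {}" if "{a<..<b} \<inter> {c<..<d} = {}" for a b c d
      proof -
        have "\<not> (max a c < min b d)" using that dense[of "max a c" "min b d"] by fastforce
        then have "\<not> (max (s n a) (s n c) < min (s n b) (s n d))"
          by (simp add: smono)
        then show ?thesis by auto
      qed
      then show "disjoint_family_on (\<lambda>(a, b). {a<..<b}) (m ` D)"
        using disj unfolding disjoint_family_on_def m_def by fastforce
    qed
    finally show ?thesis .
  qed
  have lim: "(\<lambda>n. \<Sum>(a, b)\<in>D. norm (h (s n b) - h (s n a))) \<longlonglongrightarrow> (\<Sum>(a, b)\<in>D. norm (h b - h a))"
    unfolding split_def by (intro tendsto_intros hlim) (use D(2) in auto)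
  show "(\<Sum>(a, b)\<in>D. norm (h b - h a)) \<le> B"
    by (rule LIMSEQ_le_const2[OF lim]) (use le in auto)
qed

section \<open>The normed space of Sobolev functions\<close>

text \<open>
  By \<open>var_bound_w11_var\<close> and \<open>w11_var_le\<close> this is the total variation of \<open>h\<close>, the seminorm in
  \<open>W11_norm h\<close>.
\<close>

definition w11_var :: "(real \<Rightarrow> complex) \<Rightarrow> real" where
  "w11_var h = (LINT x:{0<..<1}|lborel. norm ((SOME g. weak_deriv h g) x))"

lemma W11D:
  assumes "h \<in> W11"
  shows "continuous_on {0..1} h" "x \<notin> {0..1} \<Longrightarrow> h x = 0" "weak_deriv h (SOME g. weak_deriv h g)"
proof -
  show "continuous_on {0..1} h" "x \<notin> {0..1} \<Longrightarrow> h x = 0" using assms by (auto simp: W11_def)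
  have "\<exists>g. weak_deriv h g" using assms by (simp add: W11_def)
  then show "weak_deriv h (SOME g. weak_deriv h g)" by (rule someI_ex)
qed

lemma W11I:
  assumes "continuous_on {0..1} h" "\<And>x. x \<notin> {0..1} \<Longrightarrow> h x = 0" "weak_deriv h g"
  shows "h \<in> W11"
  using assms by (auto simp: W11_def)

lemma var_bound_w11_var: "h \<in> W11 \<Longrightarrow> var_bound {0..1} h (w11_var h)"
  unfolding w11_var_def by (rule var_bound_weak_deriv[OF W11D(1) W11D(3)])

lemma w11_var_le: "h \<in> W11 \<Longrightarrow> var_bound {0<..<1} h B \<Longrightarrow> w11_var h \<le> B"
  unfolding w11_var_def by (rule weak_deriv_norm_le_var[OF W11D(1) W11D(3) var_bound_interior[OF W11D(1)]])

lemma var_bound_subset: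
  assumes vb: "var_bound S h B" and sub: "T \<subseteq> S"
  shows "var_bound T h B"
  unfolding var_bound_def
proof (intro allI impI)
  fix D :: "(real \<times> real) set"
  assume D: "finite D" "\<forall>(a, b)\<in>D. a \<in> T \<and> b \<in> T \<and> a \<le> b"
    and disj: "disjoint_family_on (\<lambda>(a, b). {a<..<b}) D"
  show "(\<Sum>(a, b)\<in>D. norm (h b - h a)) \<le> B"
    by (rule var_boundD[OF vb D(1) _ disj]) (use D(2) sub in auto)
qed

lemma w11_var_le_closed: "h \<in> W11 \<Longrightarrow> var_bound {0..1} h B \<Longrightarrow> w11_var h \<le> B"
  by (rule w11_var_le[OF _ var_bound_subset]) auto

lemma w11_var_nonneg: "0 \<le> w11_var h"
  unfolding w11_var_def set_lebesgue_integral_def by (rule Bochner_Integration.integral_nonneg) simp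

lemma W11_norm_eq: "W11_norm h = (LINT x:{0<..<1}|lborel. norm (h x)) + w11_var h"
  by (simp add: W11_norm_def w11_var_def)

lemma norm_diff_le_w11_var:
  assumes h: "h \<in> W11" and x: "x \<in> {0..1}" and y: "y \<in> {0..1}"
  shows "norm (h x - h y) \<le> w11_var h"
proof -
  have *: "norm (h b - h a) \<le> w11_var h" if "a \<le> b" "a \<in> {0..1}" "b \<in> {0..1}" for a b
    using var_boundD[OF var_bound_w11_var[OF h], of "{(a, b)}"] that by (simp add: disjoint_family_on_def)
  show ?thesis using *[of x y] *[of y x] x y by (cases "x \<le> y") (auto simp: norm_minus_commute)
qed

lemma set_integrable_norm_W11:
  assumes h: "h \<in> W11"
  shows "set_integrable lborel {0<..<1} (\<lambda>x. norm (h x))"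
proof (rule set_integrable_subset)
  show "set_integrable lborel {0..1} (\<lambda>x. norm (h x))"
    by (rule borel_integrable_atLeastAtMost') (intro continuous_intros W11D h)
qed auto

lemma set_integrable_const_unit: "set_integrable lborel {0<..<1::real} (\<lambda>_. c::real)"
  by (simp add: set_integrable_def)

lemma set_integral_const_unit: "(LINT x:{0<..<1::real}|lborel. (c::real)) = c"
  by (simp add: set_lebesgue_integral_def)

text \<open>
  The value at \<open>x\<close> differs from any other value by at most the variation; average over the other
  point.
\<close>

lemma norm_le_W11_norm:
  assumes h: "h \<in> W11"
  shows "norm (h x) \<le> W11_norm h"
proof (cases "x \<in> {0..1}")
  case x: True
  have "norm (h x) = (LINT y:{0<..<1::real}|lborel. norm (h x))" by (simp add: set_integral_const_unit)
  also have "\<dots> \<le> (LINT y:{0<..<1}|lborel. norm (h y) + w11_var h)"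
  proof (rule set_integral_mono)
    show "set_integrable lborel {0<..<1} (\<lambda>y. norm (h y) + w11_var h)"
      by (intro set_integral_add set_integrable_norm_W11 h set_integrable_const_unit)
    fix y :: real assume "y \<in> {0<..<1}"
    then have "norm (h x - h y) \<le> w11_var h" using norm_diff_le_w11_var[OF h x, of y] by auto
    then show "norm (h x) \<le> norm (h y) + w11_var h"
      using norm_triangle_ineq2[of "h x" "h y"] by linarith
  qed (rule set_integrable_const_unit)
  also have "\<dots> = W11_norm h"
    unfolding W11_norm_eq by (subst set_integral_add) (auto intro: set_integrable_norm_W11 h
        set_integrable_const_unit simp: set_integral_const_unit)
  finally show ?thesis .
next
  case False
  have "0 \<le> (LINT x:{0<..<1}|lborel. norm (h x))"
    unfolding set_lebesgue_integral_def by (rule Bochner_Integration.integral_nonneg) simp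
  then show ?thesis using W11D(2)[OF h False] w11_var_nonneg[of h] by (simp add: W11_norm_eq)
qed

lemma W11_norm_le:
  assumes h: "h \<in> W11" and M: "\<And>x. x \<in> {0<..<1} \<Longrightarrow> norm (h x) \<le> M"
  shows "W11_norm h \<le> M + w11_var h"
proof -
  have "(LINT x:{0<..<1}|lborel. norm (h x)) \<le> (LINT x:{0<..<1::real}|lborel. M)"
    by (rule set_integral_mono) (auto intro: set_integrable_norm_W11 h set_integrable_const_unit M)
  then show ?thesis by (simp add: W11_norm_eq set_integral_const_unit)
qed

lemma w11_var_le_W11_norm: "w11_var h \<le> W11_norm h"
proof -
  have "0 \<le> (LINT x:{0<..<1}|lborel. norm (h x))"
    unfolding set_lebesgue_integral_def by (rule Bochner_Integration.integral_nonneg) simp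
  then show ?thesis by (simp add: W11_norm_eq)
qed

lemma W11_norm_nonneg: "0 \<le> W11_norm h"
  using w11_var_le_W11_norm[of h] w11_var_nonneg[of h] by linarith

lemma weak_deriv_lincomb:
  assumes h1: "continuous_on {0..1} h1" "weak_deriv h1 g1" and h2: "continuous_on {0..1} h2" "weak_deriv h2 g2"
  shows "weak_deriv (\<lambda>x. a * h1 x + b * h2 x) (\<lambda>x. a * g1 x + b * g2 x)"
proof -
  have c: "continuous_on {0..1} (\<lambda>x. a * h1 x + b * h2 x)" by (intro continuous_intros h1 h2)
  note p1 = h1(2)[unfolded weak_deriv_iff_primitive[OF h1(1)]]
  note p2 = h2(2)[unfolded weak_deriv_iff_primitive[OF h2(1)]]
  have i1: "set_integrable lborel S (\<lambda>x. a * g1 x)" if "S \<subseteq> {0<..<1}" "S \<in> sets lborel" for S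
    using set_integrable_subset[OF conjunct1[OF p1] that(2,1)] by (rule set_integrable_mult_right)
  have i2: "set_integrable lborel S (\<lambda>x. b * g2 x)" if "S \<subseteq> {0<..<1}" "S \<in> sets lborel" for S
    using set_integrable_subset[OF conjunct1[OF p2] that(2,1)] by (rule set_integrable_mult_right)
  show ?thesis
    unfolding weak_deriv_iff_primitive[OF c]
  proof (intro conjI allI impI)
    show "set_integrable lborel {0<..<1} (\<lambda>x. a * g1 x + b * g2 x)"
      by (intro set_integral_add i1 i2) auto
    fix x y :: real assume xy: "0 \<le> x \<and> x \<le> y \<and> y \<le> 1"
    then have S: "{x<..<y} \<subseteq> {0<..<1}" "{x<..<y} \<in> sets lborel" by auto
    have "(LINT t:{x<..<y}|lborel. a * g1 t + b * g2 t) = (LINT t:{x<..<y}|lborel. a * g1 t) + (LINT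
        t:{x<..<y}|lborel. b * g2 t)"
      by (intro set_integral_add i1 i2 S)
    also have "\<dots> = a * (h1 y - h1 x) + b * (h2 y - h2 x)"
      using p1 p2 xy by simp
    finally show "a * h1 y + b * h2 y - (a * h1 x + b * h2 x) = (LINT t:{x<..<y}|lborel. a * g1 t + b * g2 t)"
      by (simp add: algebra_simps)
  qed
qed

lemma W11_lincomb:
  assumes "h1 \<in> W11" "h2 \<in> W11"
  shows "(\<lambda>x. a * h1 x + b * h2 x) \<in> W11"
proof (rule W11I)
  show "continuous_on {0..1} (\<lambda>x. a * h1 x + b * h2 x)" by (intro continuous_intros W11D assms)
  show "weak_deriv (\<lambda>x. a * h1 x + b * h2 x) (\<lambda>x. a * (SOME g. weak_deriv h1 g) x + b * (SOME g. weak_deriv h2 g) x)"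
    by (intro weak_deriv_lincomb W11D assms)
  show "a * h1 x + b * h2 x = 0" if "x \<notin> {0..1}" for x
    using W11D(2)[OF assms(1) that] W11D(2)[OF assms(2) that] by simp
qed

lemma W11_add: "h1 \<in> W11 \<Longrightarrow> h2 \<in> W11 \<Longrightarrow> (\<lambda>x. h1 x + h2 x) \<in> W11"
  using W11_lincomb[of h1 h2 1 1] by simp

lemma W11_scale: "h \<in> W11 \<Longrightarrow> (\<lambda>x. c * h x) \<in> W11"
  using W11_lincomb[of h h c 0] by simp

lemma W11_diff: "h1 \<in> W11 \<Longrightarrow> h2 \<in> W11 \<Longrightarrow> (\<lambda>x. h1 x - h2 x) \<in> W11"
  using W11_lincomb[of h1 h2 1 "-1"] by simp

lemma one_W11_eq: "x \<in> {0..1} \<Longrightarrow> one_W11 x = 1" "x \<notin> {0..1} \<Longrightarrow> one_W11 x = 0"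
  by (auto simp: one_W11_def)

lemma one_W11_in: "one_W11 \<in> W11"
proof (rule W11I)
  show c: "continuous_on {0..1} one_W11"
    by (rule continuous_on_eq[of _ "\<lambda>_. 1"]) (auto simp: one_W11_def)
  show "weak_deriv one_W11 (\<lambda>_. 0)"
    unfolding weak_deriv_iff_primitive[OF c] by (auto simp: one_W11_def set_integrable_def)
qed (auto simp: one_W11_def)

lemma var_bound_cong:
  assumes "\<And>x y. x \<in> S \<Longrightarrow> y \<in> S \<Longrightarrow> norm (h x - h y) = norm (k x - k y)"
  shows "var_bound S h B \<longleftrightarrow> var_bound S k B"
proof -
  have "(\<Sum>(a, b)\<in>D. norm (h b - h a)) = (\<Sum>(a, b)\<in>D. norm (k b - k a))"
    if "\<forall>(a, b)\<in>D. a \<in> S \<and> b \<in> S \<and> a \<le> b" for D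
    by (rule sum.cong[OF refl]) (use that assms in auto)
  then show ?thesis unfolding var_bound_def by simp
qed

lemma w11_var_scale:
  assumes h: "h \<in> W11"
  shows "w11_var (\<lambda>x. c * h x) \<le> norm c * w11_var h"
proof (rule w11_var_le_closed[OF W11_scale[OF h]])
  show "var_bound {0..1} (\<lambda>x. c * h x) (norm c * w11_var h)"
    unfolding var_bound_def
  proof (intro allI impI)
    fix D :: "(real \<times> real) set"
    assume D: "finite D" "\<forall>(a, b)\<in>D. a \<in> {0..1} \<and> b \<in> {0..1} \<and> a \<le> b"
      and disj: "disjoint_family_on (\<lambda>(a, b). {a<..<b}) D"
    have "(\<Sum>(a, b)\<in>D. norm (c * h b - c * h a)) = norm c * (\<Sum>(a, b)\<in>D. norm (h b - h a))"
      by (simp add: sum_distrib_left split_def right_diff_distrib[symmetric] norm_mult)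
    also have "\<dots> \<le> norm c * w11_var h"
      by (intro mult_left_mono var_boundD[OF var_bound_w11_var[OF h]]) (use D disj in auto)
    finally show "(\<Sum>(a, b)\<in>D. norm (c * h b - c * h a)) \<le> norm c * w11_var h" .
  qed
qed

lemma W11_norm_scale:
  assumes h: "h \<in> W11"
  shows "W11_norm (\<lambda>x. c * h x) \<le> norm c * W11_norm h"
proof -
  have "(LINT x:{0<..<1}|lborel. norm (c * h x)) = norm c * (LINT x:{0<..<1}|lborel. norm (h x))"
    by (simp add: norm_mult set_lebesgue_integral_def mult.left_commute)
  then show ?thesis using w11_var_scale[OF h, of c] by (simp add: W11_norm_eq distrib_left)
qed

lemma AE_summable_of_integrals:
  fixes k :: "nat \<Rightarrow> real \<Rightarrow> complex"
  assumes k: "\<And>n. integrable lborel (k n)" and le: "\<And>n. (\<integral>x. norm (k n x) \<partial>lborel) \<le> c n" and c: "summable c"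
  shows "AE x in lborel. summable (\<lambda>n. norm (k n x))"
proof -
  have [measurable]: "k n \<in> borel_measurable lborel" for n using k by auto
  have c0: "0 \<le> c n" for n
    by (rule order_trans[OF _ le[of n]]) (rule Bochner_Integration.integral_nonneg, simp)
  have "(\<integral>\<^sup>+x. (\<Sum>n. ennreal (norm (k n x))) \<partial>lborel) = (\<Sum>n. \<integral>\<^sup>+x. ennreal (norm (k n x)) \<partial>lborel)"
    by (rule nn_integral_suminf) measurable
  also have "\<dots> \<le> (\<Sum>n. ennreal (c n))"
  proof (rule suminf_le)
    show "(\<integral>\<^sup>+x. ennreal (norm (k n x)) \<partial>lborel) \<le> ennreal (c n)" for n
      using k[of n] le[of n] by (subst nn_integral_eq_integral) (auto intro: ennreal_leI)
  qed auto
  also have "\<dots> < \<infinity>"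
    using ennreal_suminf_neq_top[OF c c0] by (simp add: less_top)
  finally have "(\<integral>\<^sup>+x. (\<Sum>n. ennreal (norm (k n x))) \<partial>lborel) \<noteq> \<infinity>" by simp
  then have "AE x in lborel. (\<Sum>n. ennreal (norm (k n x))) \<noteq> \<infinity>"
    by (intro nn_integral_PInf_AE) measurable
  then show ?thesis
    by eventually_elim (auto intro!: summable_suminf_not_top simp: top_unique)
qed

text \<open>
  Completeness, in the form of absolutely convergent series. The derivatives of the terms sum to a
  derivative of the sum, as the series may be integrated term by term. The factor 2 accounts for
  the two parts of the norm, each of which is bounded by \<open>suminf c\<close>.
\<close>

lemma W11_complete:
  fixes h :: "nat \<Rightarrow> real \<Rightarrow> complex"
  assumes h: "\<And>n. h n \<in> W11" and le: "\<And>n. W11_norm (h n) \<le> c n" and c: "summable c"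
  shows "(\<lambda>x. \<Sum>n. h n x) \<in> W11" "W11_norm (\<lambda>x. \<Sum>n. h n x) \<le> 2 * (\<Sum>n. c n)"
    "summable (\<lambda>n. h n x)"
proof -
  define H where "H = (\<lambda>x. \<Sum>n. h n x)"
  have hc: "norm (h n x) \<le> c n" for n x using norm_le_W11_norm[OF h[of n], of x] le[of n] by linarith
  have sumn: "summable (\<lambda>n. norm (h n x))" for x
    by (rule summable_comparison_test'[OF c]) (use hc in auto)
  show sum: "summable (\<lambda>n. h n x)" for x by (rule summable_norm_cancel[OF sumn])
  have cont: "continuous_on {0..1} H"
    unfolding H_def
  proof (rule uniform_limit_theorem)
    show "uniform_limit {0..1} (\<lambda>n x. \<Sum>i<n. h i x) (\<lambda>x. \<Sum>n. h n x) sequentially"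
      by (rule Weierstrass_m_test[OF _ c]) (use hc in auto)
    show "\<forall>\<^sub>F n in sequentially. continuous_on {0..1} (\<lambda>x. \<Sum>i<n. h i x)"
      by (intro always_eventually allI continuous_intros W11D h)
  qed simp
  define g where "g = (\<lambda>n. SOME g. weak_deriv (h n) g)"
  define k where "k = (\<lambda>n t. indicator {0<..<1} t *\<^sub>R g n t)"
  have wd: "weak_deriv (h n) (g n)" for n unfolding g_def by (rule W11D(3)[OF h])
  have ig: "set_integrable lborel {0<..<1} (g n)" for n using wd by (simp add: weak_deriv_def)
  have ik: "integrable lborel (k n)" for n using ig by (simp add: k_def set_integrable_def)
  have nk: "(\<integral>x. norm (k n x) \<partial>lborel) \<le> c n" for n
  proof -
    have "(\<integral>x. norm (k n x) \<partial>lborel) = w11_var (h n)"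
      by (simp add: w11_var_def set_lebesgue_integral_def k_def g_def)
    then show ?thesis using w11_var_le_W11_norm[of "h n"] le[of n] by simp
  qed
  have ae: "AE x in lborel. summable (\<lambda>n. norm (k n x))"
    by (rule AE_summable_of_integrals[OF ik nk c])
  define G where "G = (\<lambda>x. \<Sum>n. k n x)"
  have snk: "summable (\<lambda>n. \<integral>x. norm (k n x) \<partial>lborel)"
    by (rule summable_comparison_test'[OF c]) (use nk in auto)
  have iG: "integrable lborel G" unfolding G_def by (rule integrable_suminf[OF ik ae snk])
  have diff: "H y - H x = (LINT t:{x<..<y}|lborel. G t)" if xy: "0 \<le> x" "x \<le> y" "y \<le> 1" for x y
  proof -
    have ik': "integrable lborel (\<lambda>t. indicator {x<..<y} t *\<^sub>R k n t)" for n
      by (rule integrable_mult_indicator[OF _ ik]) simp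
    have ae': "AE t in lborel. summable (\<lambda>n. norm (indicator {x<..<y} t *\<^sub>R k n t))"
      using ae by eventually_elim (auto simp: indicator_def)
    have snk': "summable (\<lambda>n. \<integral>t. norm (indicator {x<..<y} t *\<^sub>R k n t) \<partial>lborel)"
    proof (rule summable_comparison_test'[OF snk])
      fix n
      have "(\<integral>t. norm (indicator {x<..<y} t *\<^sub>R k n t) \<partial>lborel) \<le> (\<integral>t. norm (k n t) \<partial>lborel)"
        by (rule integral_mono[OF integrable_norm[OF ik'] integrable_norm[OF ik]]) (auto simp: indicator_def)
      then show "norm (\<integral>t. norm (indicator {x<..<y} t *\<^sub>R k n t) \<partial>lborel) \<le> (\<integral>t. norm (k n t) \<partial>lborel)"
        by simp
    qed
    have "(LINT t:{x<..<y}|lborel. G t) = (\<integral>t. (\<Sum>n. indicator {x<..<y} t *\<^sub>R k n t) \<partial>lborel)"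
      unfolding set_lebesgue_integral_def G_def
      by (rule Bochner_Integration.integral_cong) (auto simp: indicator_def)
    also have "\<dots> = (\<Sum>n. \<integral>t. indicator {x<..<y} t *\<^sub>R k n t \<partial>lborel)"
      by (rule integral_suminf[OF ik' ae' snk'])
    also have "\<dots> = (\<Sum>n. h n y - h n x)"
    proof (rule suminf_cong)
      fix n
      have "(\<integral>t. indicator {x<..<y} t *\<^sub>R k n t \<partial>lborel) = (LINT t:{x<..<y}|lborel. g n t)"
        unfolding set_lebesgue_integral_def k_def
        by (rule Bochner_Integration.integral_cong) (use xy in \<open>auto simp: indicator_def\<close>)
      also have "\<dots> = h n y - h n x"
        using wd[of n] xy weak_deriv_iff_primitive[OF W11D(1)[OF h[of n]]] by auto
      finally show "(\<integral>t. indicator {x<..<y} t *\<^sub>R k n t \<partial>lborel) = h n y - h n x" .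
    qed
    also have "\<dots> = H y - H x" unfolding H_def by (rule suminf_diff[OF sum sum, symmetric])
    finally show ?thesis by simp
  qed
  have HW: "H \<in> W11"
  proof (rule W11I[OF cont])
    show "H x = 0" if "x \<notin> {0..1}" for x using W11D(2)[OF h that] by (simp add: H_def)
    show "weak_deriv H G"
      unfolding weak_deriv_iff_primitive[OF cont]
      using diff iG by (auto simp: set_integrable_def intro: integrable_mult_indicator)
  qed
  then show "(\<lambda>x. \<Sum>n. h n x) \<in> W11" by (simp add: H_def)
  have "w11_var H \<le> (\<Sum>n. c n)"
  proof (rule w11_var_le_closed[OF HW])
    show "var_bound {0..1} H (\<Sum>n. c n)"
      unfolding var_bound_def
    proof (intro allI impI)
      fix D :: "(real \<times> real) set"
      assume D: "finite D" "\<forall>(a, b)\<in>D. a \<in> {0..1} \<and> b \<in> {0..1} \<and> a \<le> b"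
        and disj: "disjoint_family_on (\<lambda>(a, b). {a<..<b}) D"
      have sd: "summable (\<lambda>n. norm (h n b - h n a))" for a b
        by (rule summable_comparison_test'[OF summable_add[OF sumn[of b] sumn[of a]]]) (auto intro: norm_triangle_ineq4)
      have "(\<Sum>(a, b)\<in>D. norm (H b - H a)) \<le> (\<Sum>(a, b)\<in>D. \<Sum>n. norm (h n b - h n a))"
      proof (rule sum_mono, clarify)
        fix a b
        have "H b - H a = (\<Sum>n. h n b - h n a)" unfolding H_def by (rule suminf_diff[OF sum sum])
        then show "norm (H b - H a) \<le> (\<Sum>n. norm (h n b - h n a))"
          using summable_norm[OF sd] by simp
      qed
      also have "\<dots> = (\<Sum>n. \<Sum>(a, b)\<in>D. norm (h n b - h n a))"
        unfolding split_def by (rule suminf_sum[symmetric]) (rule sd)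
      also have "\<dots> \<le> (\<Sum>n. c n)"
      proof (rule suminf_le[OF _ _ c])
        show "summable (\<lambda>n. \<Sum>(a, b)\<in>D. norm (h n b - h n a))"
          unfolding split_def by (rule summable_sum) (rule sd)
        fix n
        have "(\<Sum>(a, b)\<in>D. norm (h n b - h n a)) \<le> w11_var (h n)"
          by (rule var_boundD[OF var_bound_w11_var[OF h]]) (use D disj in auto)
        then show "(\<Sum>(a, b)\<in>D. norm (h n b - h n a)) \<le> c n"
          using w11_var_le_W11_norm[of "h n"] le[of n] by linarith
      qed
      finally show "(\<Sum>(a, b)\<in>D. norm (H b - H a)) \<le> (\<Sum>n. c n)" .
    qed
  qed
  moreover have "norm (H x) \<le> (\<Sum>n. c n)" for x
  proof -
    have "norm (H x) \<le> (\<Sum>n. norm (h n x))" unfolding H_def by (rule summable_norm[OF sumn])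
    also have "\<dots> \<le> (\<Sum>n. c n)" by (rule suminf_le[OF hc sumn c])
    finally show ?thesis .
  qed
  ultimately have "W11_norm H \<le> 2 * (\<Sum>n. c n)"
    using W11_norm_le[OF HW, of "\<Sum>n. c n"] by simp
  then show "W11_norm (\<lambda>x. \<Sum>n. h n x) \<le> 2 * (\<Sum>n. c n)" by (simp add: H_def)
qed

section \<open>Spectra of power bounded operators\<close>

lemma bounded_operator_onD:
  assumes "bounded_operator_on V nrm T"
  shows "h \<in> V \<Longrightarrow> T h \<in> V"
    "g \<in> V \<Longrightarrow> h \<in> V \<Longrightarrow> T (\<lambda>x. g x + h x) = (\<lambda>x. T g x + T h x)"
    "h \<in> V \<Longrightarrow> T (\<lambda>x. c * h x) = (\<lambda>x. c * T h x)"
  using assms by (auto simp: bounded_operator_on_def)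

lemma bounded_operator_on_lincomb:
  assumes T: "bounded_operator_on W11 nrm T" and g: "g \<in> W11" and h: "h \<in> W11"
  shows "T (\<lambda>x. a * g x + b * h x) = (\<lambda>x. a * T g x + b * T h x)"
  using bounded_operator_onD(2)[OF T W11_scale[OF g, of a] W11_scale[OF h, of b]]
  by (simp add: bounded_operator_onD(3)[OF T] g h)

lemma funpow_W11:
  assumes T: "bounded_operator_on W11 nrm T" and h: "h \<in> W11"
  shows "(T ^^ n) h \<in> W11"
  using h by (induction n) (auto intro: bounded_operator_onD(1)[OF T])

lemma funpow_lincomb:
  assumes T: "bounded_operator_on W11 nrm T" and g: "g \<in> W11" and h: "h \<in> W11"
  shows "(T ^^ n) (\<lambda>x. a * g x + b * h x) = (\<lambda>x. a * (T ^^ n) g x + b * (T ^^ n) h x)"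
proof (induction n)
  case (Suc n)
  show ?case
    using bounded_operator_on_lincomb[OF T funpow_W11[OF T g, of n] funpow_W11[OF T h, of n], of a b]
    by (simp add: Suc.IH)
qed simp

lemma W11_sum:
  assumes "\<And>n. h n \<in> W11"
  shows "(\<lambda>x. \<Sum>n<(m::nat). h n x) \<in> W11"
proof (induction m)
  case 0 show ?case using W11_lincomb[OF assms[of 0] assms[of 0], of 0 0] by simp
next
  case (Suc m) then show ?case using W11_add[OF _ assms[of m]] by simp
qed

lemma bounded_operator_on_sum:
  assumes T: "bounded_operator_on W11 nrm T" and h: "\<And>n. h n \<in> W11"
  shows "T (\<lambda>x. \<Sum>n<(m::nat). h n x) = (\<lambda>x. \<Sum>n<m. T (h n) x)"
proof (induction m)
  case 0 show ?case using bounded_operator_on_lincomb[OF T h[of 0] h[of 0], of 0 0] by simp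
next
  case (Suc m) then show ?case using bounded_operator_onD(2)[OF T W11_sum[of h m, OF h] h[of m]] by simp
qed

text \<open>
  The resolvent at \<open>z\<close> is the Neumann series of the \<open>Q\<^sup>n / z\<^sup>n\<^sup>+\<^sup>1\<close>.
\<close>

lemma spectrum_power_bounded:
  assumes Q: "bounded_operator_on W11 W11_norm Q"
    and pb: "\<And>n h. h \<in> W11 \<Longrightarrow> W11_norm ((Q ^^ n) h) \<le> C * W11_norm h"
  shows "spectrum_on W11 W11_norm Q \<subseteq> {z. norm z \<le> 1}"
proof (rule subsetI, rule ccontr)
  fix z assume z: "z \<in> spectrum_on W11 W11_norm Q" and "z \<notin> {z. norm z \<le> 1}"
  then have z1: "norm z > 1" by simp
  then have z0: "z \<noteq> 0" by auto
  define w where "w = inverse z"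
  have w1: "norm w < 1" using z1 z0 by (simp add: w_def norm_inverse inverse_less_1_iff)
  have wz: "w * z = 1" using z0 by (simp add: w_def)
  \<comment> \<open>the terms of the Neumann series, with \<open>w = 1 / z\<close>\<close>
  define t where "t = (\<lambda>n h x. w ^ Suc n * (Q ^^ n) h x)"
  define c where "c = (\<lambda>n h. norm w ^ Suc n * (C * W11_norm h))"
  define s where "s = (\<Sum>n. norm w ^ Suc n)"
  define R where "R = (\<lambda>h x. \<Sum>n. t n h x)"
  have tW: "t n h \<in> W11" if "h \<in> W11" for n h
    unfolding t_def by (rule W11_scale[OF funpow_W11[OF Q that]])
  have tn: "W11_norm (t n h) \<le> c n h" if h: "h \<in> W11" for n h
  proof -
    have "W11_norm (t n h) \<le> norm (w ^ Suc n) * W11_norm ((Q ^^ n) h)"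
      unfolding t_def by (rule W11_norm_scale[OF funpow_W11[OF Q h]])
    also have "\<dots> \<le> c n h"
      unfolding c_def norm_power by (intro mult_left_mono pb h) simp
    finally show ?thesis .
  qed
  have sg: "summable (\<lambda>n. norm w ^ Suc n)"
    using summable_mult[OF summable_geometric[of "norm w"], of "norm w"] w1 by simp
  have sc: "summable (\<lambda>n. c n h)" for h unfolding c_def by (rule summable_mult2[OF sg])
  have c_sum: "(\<Sum>n. c n h) = s * (C * W11_norm h)" for h
    unfolding c_def s_def by (rule suminf_mult2[OF sg, symmetric])
  note comp = W11_complete[of "\<lambda>n. t n h" "\<lambda>n. c n h" for h, OF tW tn sc]
  have RW: "R h \<in> W11" if "h \<in> W11" for h unfolding R_def by (rule comp(1)[OF that that])
  have tsum: "summable (\<lambda>n. t n h x)" if "h \<in> W11" for h x by (rule comp(3)[OF that that])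
  have Rb: "W11_norm (R h) \<le> (2 * (s * C)) * W11_norm h" if "h \<in> W11" for h
    using comp(2)[OF that that] by (simp add: R_def c_sum mult.assoc)
  have bR: "bounded_operator_on W11 W11_norm R"
    unfolding bounded_operator_on_def
  proof (intro conjI ballI allI exI)
    show "R \<in> W11 \<rightarrow> W11" using RW by auto
    show "R (\<lambda>x. g x + h x) = (\<lambda>x. R g x + R h x)" if "g \<in> W11" "h \<in> W11" for g h
    proof
      fix x
      have "t n (\<lambda>x. g x + h x) x = t n g x + t n h x" for n
        using funpow_lincomb[OF Q that, of n 1 1] by (simp add: t_def distrib_left)
      then show "R (\<lambda>x. g x + h x) x = R g x + R h x"
        using suminf_add[OF tsum[OF that(1)] tsum[OF that(2)]] by (simp add: R_def)
    qed
    show "R (\<lambda>x. d * h x) = (\<lambda>x. d * R h x)" if "h \<in> W11" for d h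
    proof
      fix x
      have "t n (\<lambda>x. d * h x) x = d * t n h x" for n
        using funpow_lincomb[OF Q that that, of n d 0] by (simp add: t_def mult.left_commute)
      then show "R (\<lambda>x. d * h x) x = d * R h x"
        using suminf_mult[OF tsum[OF that], of d x] by (simp add: R_def)
    qed
    show "W11_norm (R h) \<le> (2 * (s * C)) * W11_norm h" if "h \<in> W11" for h by (rule Rb[OF that])
  qed
  have lim0: "(\<lambda>n. w ^ n * (Q ^^ n) h x) \<longlonglongrightarrow> 0" if h: "h \<in> W11" for h x
  proof (rule Lim_null_comparison)
    show "\<forall>\<^sub>F n in sequentially. norm (w ^ n * (Q ^^ n) h x) \<le> norm w ^ n * (C * W11_norm h)"
    proof (intro always_eventually allI)
      fix n
      have "norm ((Q ^^ n) h x) \<le> C * W11_norm h"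
        using norm_le_W11_norm[OF funpow_W11[OF Q h, of n], of x] pb[OF h, of n] by linarith
      then show "norm (w ^ n * (Q ^^ n) h x) \<le> norm w ^ n * (C * W11_norm h)"
        by (simp add: norm_mult norm_power mult_left_mono)
    qed
    show "(\<lambda>n. norm w ^ n * (C * W11_norm h)) \<longlonglongrightarrow> 0"
      by (rule tendsto_mult_left_zero) (rule LIMSEQ_power_zero, use w1 in simp)
  qed
  have left: "R (\<lambda>x. z * h x - Q h x) = h" if h: "h \<in> W11" for h
  proof
    fix x
    have "t n (\<lambda>x. z * h x - Q h x) x = w ^ n * (Q ^^ n) h x - w ^ Suc n * (Q ^^ Suc n) h x" for n
    proof -
      have "(Q ^^ n) (\<lambda>x. z * h x - Q h x) x = z * (Q ^^ n) h x - (Q ^^ n) (Q h) x"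
        using funpow_lincomb[OF Q h bounded_operator_onD(1)[OF Q h], of n z "-1"] by simp
      then have "t n (\<lambda>x. z * h x - Q h x) x = (w * z) * w ^ n * (Q ^^ n) h x - w ^ Suc n * (Q ^^ n) (Q h) x"
        unfolding t_def by (simp only:) (simp add: algebra_simps)
      then show ?thesis by (simp add: wz funpow_Suc_right del: funpow.simps)
    qed
    then have "(\<lambda>n. t n (\<lambda>x. z * h x - Q h x) x) sums (h x - 0)"
      using telescope_sums'[OF lim0[OF h, of x]] by simp
    then show "R (\<lambda>x. z * h x - Q h x) x = h x" unfolding R_def by (simp add: sums_iff)
  qed
  have right: "(\<lambda>x. z * R h x - Q (R h) x) = h" if h: "h \<in> W11" for h
  proof
    fix x
    define S where "S = (\<lambda>m x. \<Sum>n<m. t n h x)"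
    have SW: "S m \<in> W11" for m unfolding S_def by (rule W11_sum) (rule tW[OF h])
    have QS: "Q (S m) = (\<lambda>x. \<Sum>n<m. w ^ Suc n * (Q ^^ Suc n) h x)" for m
    proof -
      have "Q (t n h) = (\<lambda>x. w ^ Suc n * (Q ^^ Suc n) h x)" for n
        unfolding t_def using bounded_operator_onD(3)[OF Q funpow_W11[OF Q h, of n]] by simp
      then show ?thesis unfolding S_def using bounded_operator_on_sum[OF Q tW[OF h]] by simp
    qed
    have tail: "norm (Q (R h) x - Q (S m) x) \<le> C * (2 * ((\<Sum>n. c n h) - (\<Sum>n<m. c n h)))" for m
    proof -
      define D where "D = (\<lambda>x. \<Sum>n. t (n + m) h x)"
      note cm = W11_complete[of "\<lambda>n. t (n + m) h" "\<lambda>n. c (n + m) h", OF tW[OF h] tn[OF h]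
          summable_ignore_initial_segment[OF sc]]
      have DW: "D \<in> W11" unfolding D_def by (rule cm(1))
      have "W11_norm D \<le> 2 * (\<Sum>n. c (n + m) h)" unfolding D_def by (rule cm(2))
      also have "(\<Sum>n. c (n + m) h) = (\<Sum>n. c n h) - (\<Sum>n<m. c n h)"
        by (rule suminf_minus_initial_segment[OF sc])
      finally have Dn: "W11_norm D \<le> 2 * ((\<Sum>n. c n h) - (\<Sum>n<m. c n h))" .
      have "R h = (\<lambda>x. D x + S m x)"
        unfolding R_def D_def S_def using suminf_split_initial_segment[OF tsum[OF h]] by simp
      then have "Q (R h) x - Q (S m) x = Q D x"
        using bounded_operator_onD(2)[OF Q DW SW[of m]] by simp
      moreover have "norm (Q D x) \<le> C * W11_norm D"
        using norm_le_W11_norm[OF bounded_operator_onD(1)[OF Q DW], of x] pb[OF DW, of 1] by simp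
      moreover have "C * W11_norm D \<le> C * (2 * ((\<Sum>n. c n h) - (\<Sum>n<m. c n h)))"
      proof (cases "C \<ge> 0")
        case True then show ?thesis by (rule mult_left_mono[OF Dn])
      next
        \<comment> \<open>for negative \<open>C\<close> the hypothesis forces all norms to vanish\<close>
        case False
        have "0 \<le> C * W11_norm D" using pb[OF DW, of 0] W11_norm_nonneg[of D] by (simp)
        then have "W11_norm D = 0" using False W11_norm_nonneg[of D]
          by (metis linorder_not_le mult_less_0_iff order_le_less)
        have "0 \<le> C * W11_norm h" using pb[OF h, of 0] W11_norm_nonneg[of h] by (simp)
        then have "W11_norm h = 0" using False W11_norm_nonneg[of h]
          by (metis linorder_not_le mult_less_0_iff order_le_less)
        then show ?thesis using \<open>W11_norm D = 0\<close> by (simp add: c_def)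
      qed
      ultimately show ?thesis by simp
    qed
    have "(\<lambda>m. Q (S m) x) \<longlonglongrightarrow> Q (R h) x"
    proof (rule LIM_zero_cancel, rule Lim_null_comparison)
      show "\<forall>\<^sub>F m in sequentially. norm (Q (S m) x - Q (R h) x) \<le> C * (2 * ((\<Sum>n. c n h) - (\<Sum>n<m. c n h)))"
        using tail by (intro always_eventually allI) (simp add: norm_minus_commute)
      have "(\<lambda>m. C * (2 * ((\<Sum>n. c n h) - (\<Sum>n<m. c n h)))) \<longlonglongrightarrow> C * (2 * ((\<Sum>n. c n h) - (\<Sum>n. c n h)))"
        by (intro tendsto_intros summable_LIMSEQ sc)
      then show "(\<lambda>m. C * (2 * ((\<Sum>n. c n h) - (\<Sum>n<m. c n h)))) \<longlonglongrightarrow> 0" by simp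
    qed
    then have "(\<lambda>n. w ^ Suc n * (Q ^^ Suc n) h x) sums Q (R h) x"
      unfolding sums_def QS .
    then have "(\<lambda>n. w ^ n * (Q ^^ n) h x) sums (Q (R h) x + h x)"
      by (subst (asm) sums_Suc_iff) simp
    moreover have "(\<lambda>n. z * t n h x) sums (z * R h x)"
      unfolding R_def by (intro sums_mult summable_sums tsum h)
    moreover have "z * t n h x = w ^ n * (Q ^^ n) h x" for n
      using wz by (simp add: t_def algebra_simps)
    ultimately have "z * R h x = Q (R h) x + h x" by (simp add: sums_iff)
    then show "z * R h x - Q (R h) x = h x" by simp
  qed
  have "z \<notin> spectrum_on W11 W11_norm Q"
    unfolding spectrum_on_def using bR left right by auto
  then show False using z by simp
qed

section \<open>Inverse branches and the variation of the transfer operator\<close>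

locale full_branch_map =
  fixes f :: "real \<Rightarrow> real" and P :: "real set set"
  assumes fb: "full_branch f P"
begin

lemma P_props: "finite P" "disjoint P" "\<And>I. I \<in> P \<Longrightarrow> \<exists>a b. a < b \<and> I = {a<..<b}"
  "(\<Union>I\<in>P. closure I) = {0..1}"
  using fb unfolding full_branch_def pw_monotone_def interval_partition_def by auto

lemma f_range: "x \<in> {0..1} \<Longrightarrow> f x \<in> {0..1}"
  using fb unfolding full_branch_def pw_monotone_def by auto

lemma branch:
  assumes "I \<in> P"
  shows "strict_mono_on I f \<or> strict_antimono_on I f" "f C1_differentiable_on I" "f ` I = {0<..<1}"
  using fb assms unfolding full_branch_def pw_monotone_def by auto

lemma P_nonempty: "P \<noteq> {}"
proof
  assume "P = {}"
  then have "{0..1::real} = {}" using P_props(4) by simp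
  then show False by simp
qed

lemma interval:
  assumes "I \<in> P"
  shows "I = {Inf I<..<Sup I}" "Inf I < Sup I" "closure I = {Inf I..Sup I}" "0 \<le> Inf I" "Sup I \<le> 1"
proof -
  obtain a b where ab: "a < b" "I = {a<..<b}" using P_props(3)[OF assms] by auto
  then show "I = {Inf I<..<Sup I}" "Inf I < Sup I" "closure I = {Inf I..Sup I}" by auto
  have "closure I \<subseteq> {0..1}" using P_props(4) assms by auto
  then show "0 \<le> Inf I" "Sup I \<le> 1" using ab by auto
qed

lemma branch_subset:
  assumes "I \<in> P"
  shows "I \<subseteq> {0<..<1}" "open I" "I \<in> sets borel"
proof -
  show "I \<subseteq> {0<..<1}" using interval[OF assms] by (auto simp: set_eq_iff)
  show o: "open I" by (subst interval(1)[OF assms]) simp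
  show "I \<in> sets borel" using o by simp
qed

lemma branch_cont: "I \<in> P \<Longrightarrow> continuous_on I f"
  by (rule C1_differentiable_imp_continuous_on[OF branch(2)])

lemma branch_inj:
  assumes "I \<in> P"
  shows "inj_on f I"
  using branch(1)[OF assms]
proof
  assume "strict_mono_on I f" then show ?thesis by (rule strict_mono_on_imp_inj_on)
next
  assume a: "strict_antimono_on I f"
  show ?thesis
  proof (rule inj_onI)
    fix x y assume xy: "x \<in> I" "y \<in> I" "f x = f y"
    show "x = y" using monotone_onD[OF a xy(1,2)] monotone_onD[OF a xy(2,1)] xy(3)
      by (metis linorder_neq_iff order_less_irrefl)
  qed
qed

definition inv_branch :: "real set \<Rightarrow> real \<Rightarrow> real" where
  "inv_branch I t = the_inv_into I f t"

lemma inv_branch: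
  assumes "I \<in> P" "t \<in> {0<..<1}"
  shows "inv_branch I t \<in> I" "f (inv_branch I t) = t"
  unfolding inv_branch_def
  using the_inv_into_into[OF branch_inj[OF assms(1)]] f_the_inv_into_f[OF branch_inj[OF assms(1)]]
      branch(3)[OF assms(1)] assms(2)
  by auto

lemma inv_branch_f: "I \<in> P \<Longrightarrow> y \<in> I \<Longrightarrow> inv_branch I (f y) = y"
  unfolding inv_branch_def by (rule the_inv_into_f_f[OF branch_inj])

lemma branch_values: "I \<in> P \<Longrightarrow> y \<in> I \<Longrightarrow> f y \<in> {0<..<1}"
  using branch(3) by blast

text \<open>
  A monotone map preserves betweenness whether it increases or decreases; this spares a case
  distinction wherever only the disjointness of image intervals is at stake.
\<close>

lemma branch_between:
  assumes I: "I \<in> P" and u: "u \<in> I" and v: "v \<in> I" and y: "min u v < y" "y < max u v"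
  shows "min (f u) (f v) < f y" "f y < max (f u) (f v)"
proof -
  have yI: "y \<in> I" using u v y interval(1)[OF I] by (metis greaterThanLessThan_iff less_max_iff_disj
      min_less_iff_disj order_less_trans)
  have mI: "min u v \<in> I" "max u v \<in> I" using u v by (auto simp: min_def max_def)
  have "(f (min u v) < f y \<and> f y < f (max u v)) \<or> (f (max u v) < f y \<and> f y < f (min u v))"
    using branch(1)[OF I]
  proof
    assume m: "strict_mono_on I f"
    show ?thesis using monotone_onD[OF m mI(1) yI y(1)] monotone_onD[OF m yI mI(2) y(2)] by simp
  next
    assume m: "strict_antimono_on I f"
    show ?thesis using monotone_onD[OF m mI(1) yI y(1)] monotone_onD[OF m yI mI(2) y(2)] by simp
  qed
  then show "min (f u) (f v) < f y" "f y < max (f u) (f v)"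
    by (cases "u \<le> v"; auto simp: min_def max_def)+
qed

lemma preimages:
  assumes "t \<in> {0<..<1}"
  shows "{y. y \<in> \<Union>P \<and> f y = t} = (\<lambda>I. inv_branch I t) ` P" "inj_on (\<lambda>I. inv_branch I t) P"
proof -
  show "{y. y \<in> \<Union>P \<and> f y = t} = (\<lambda>I. inv_branch I t) ` P"
  proof (intro equalityI subsetI)
    fix y assume "y \<in> {y. y \<in> \<Union>P \<and> f y = t}"
    then obtain I where "I \<in> P" "y \<in> I" "f y = t" by auto
    then show "y \<in> (\<lambda>I. inv_branch I t) ` P" using inv_branch_f[of I y] by (intro image_eqI[of _ _ I]) auto
  next
    fix y assume "y \<in> (\<lambda>I. inv_branch I t) ` P"
    then obtain I where "y = inv_branch I t" "I \<in> P" by (rule imageE)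
    then show "y \<in> {y. y \<in> \<Union>P \<and> f y = t}" using inv_branch[OF _ assms] by auto
  qed
  show "inj_on (\<lambda>I. inv_branch I t) P"
  proof (rule inj_onI)
    fix I J assume IJ: "I \<in> P" "J \<in> P" "inv_branch I t = inv_branch J t"
    then have "inv_branch I t \<in> I \<inter> J" using inv_branch(1)[OF IJ(1) assms] inv_branch(1)[OF IJ(2) assms] by simp
    then show "I = J" using P_props(2) IJ(1,2) by (auto simp: disjoint_def)
  qed
qed

lemma L0_interior: "t \<in> {0<..<1} \<Longrightarrow> L0 f P h t = (\<Sum>I\<in>P. h (inv_branch I t))"
  unfolding L0_def Let_def using preimages[of t] by (simp add: sum.reindex)

text \<open>
  A point in two of the intervals spanned by \<open>inv_branch I a\<close> and \<open>inv_branch I b\<close> would lie in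
  one branch and be mapped by \<open>f\<close> into two of the given disjoint intervals. So the images form a
  family for which the hypothesis on \<open>h\<close> applies.
\<close>

lemma var_bound_L0:
  assumes vb: "var_bound {0..1} h B"
  shows "var_bound {0<..<1} (L0 f P h) B"
  unfolding var_bound_def
proof (intro allI impI)
  fix D :: "(real \<times> real) set"
  assume D: "finite D" "\<forall>(a, b)\<in>D. a \<in> {0<..<1} \<and> b \<in> {0<..<1} \<and> a \<le> b"
    and disj: "disjoint_family_on (\<lambda>(a, b). {a<..<b}) D"
  define m where "m = (\<lambda>((a, b), I). (min (inv_branch I a) (inv_branch I b), max (inv_branch I a) (inv_branch I b)))"
  define v where "v = (\<lambda>(a, b). norm (h b - h a))"
  have D2: "a \<in> {0<..<1}" "b \<in> {0<..<1}" "a \<le> b" if "(a, b) \<in> D" for a b using D(2) that by auto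
  have m_in: "fst (m (p, I)) \<in> I" "snd (m (p, I)) \<in> I" "fst (m (p, I)) \<le> snd (m (p, I))"
    if "p \<in> D" "I \<in> P" for p I
    using inv_branch(1)[OF that(2)] D2[of "fst p" "snd p"] that(1) by (auto simp: m_def split_def min_def max_def)
  have m_between: "f y \<in> {a<..<b}"
    if "(a, b) \<in> D" "I \<in> P" "fst (m ((a, b), I)) < y" "y < snd (m ((a, b), I))" for a b I y
    using branch_between[OF that(2) inv_branch(1)[OF that(2) D2(1)[OF that(1)]] inv_branch(1)[OF that(2)
        D2(2)[OF that(1)]], of y]
      that(3,4) inv_branch(2)[OF that(2) D2(1)[OF that(1)]] inv_branch(2)[OF that(2) D2(2)[OF that(1)]]
          D2(3)[OF that(1)]
    by (simp add: m_def min_def max_def split: if_splits)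
  have inj: "inj_on m (D \<times> P)"
  proof (rule inj_onI)
    fix q r assume q: "q \<in> D \<times> P" and r: "r \<in> D \<times> P" and qr: "m q = m r"
    obtain a b I where q': "q = ((a, b), I)" by (metis prod.exhaust)
    obtain c d J where r': "r = ((c, d), J)" by (metis prod.exhaust)
    have 1: "(a, b) \<in> D" "I \<in> P" and 2: "(c, d) \<in> D" "J \<in> P" using q r by (auto simp: q' r')
    have eq: "m ((a, b), I) = m ((c, d), J)" using qr by (simp add: q' r')
    have "I \<inter> J \<noteq> {}" using m_in(1)[OF 1] m_in(1)[OF 2] eq by auto
    then have IJ: "I = J" using P_props(2) 1 2 by (auto simp: disjoint_def)
    have fs: "{f (fst (m ((a, b), I))), f (snd (m ((a, b), I)))} = {a, b}" if "(a, b) \<in> D" "I \<in> P" for a b I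
      using inv_branch(2)[OF that(2) D2(1)[OF that(1)]] inv_branch(2)[OF that(2) D2(2)[OF that(1)]]
      by (auto simp: m_def min_def max_def)
    have "{a, b} = {c, d}" using fs[OF 1] fs[OF 2] eq by simp
    then have "a = c \<and> b = d" using D2(3)[OF 1(1)] D2(3)[OF 2(1)] by (auto simp: doubleton_eq_iff)
    then show "q = r" using IJ by (simp add: q' r')
  qed
  have le: "(case p of (a, b) \<Rightarrow> norm (L0 f P h b - L0 f P h a)) \<le> (\<Sum>I\<in>P. v (m (p, I)))" if p: "p \<in> D" for p
  proof -
    obtain a b where pab: "p = (a, b)" by (cases p)
    have ab: "(a, b) \<in> D" using p pab by simp
    have "norm (L0 f P h b - L0 f P h a) = norm (\<Sum>I\<in>P. h (inv_branch I b) - h (inv_branch I a))"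
      unfolding L0_interior[OF D2(1)[OF ab]] L0_interior[OF D2(2)[OF ab]] sum_subtractf by (rule refl)
    also have "\<dots> \<le> (\<Sum>I\<in>P. norm (h (inv_branch I b) - h (inv_branch I a)))" by (rule norm_sum)
    also have "\<dots> = (\<Sum>I\<in>P. v (m ((a, b), I)))"
      by (rule sum.cong[OF refl]) (simp add: m_def v_def min_def max_def norm_minus_commute)
    finally show "(case p of (a, b) \<Rightarrow> norm (L0 f P h b - L0 f P h a)) \<le> (\<Sum>I\<in>P. v (m (p, I)))"
      unfolding pab by simp
  qed
  have "(\<Sum>(a, b)\<in>D. norm (L0 f P h b - L0 f P h a)) \<le> (\<Sum>p\<in>D. \<Sum>I\<in>P. v (m (p, I)))"
    by (rule sum_mono) (rule le)
  also have "\<dots> = (\<Sum>q\<in>D \<times> P. v (m q))" by (simp add: sum.cartesian_product split_def)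
  also have "\<dots> = (\<Sum>(a, b)\<in>m ` (D \<times> P). norm (h b - h a))"
    by (simp only: sum.reindex[OF inj] o_def v_def)
  also have "\<dots> \<le> B"
  proof (rule var_boundD[OF vb])
    show "finite (m ` (D \<times> P))" using D(1) P_props(1) by simp
    fix a b assume "(a, b) \<in> m ` (D \<times> P)"
    then obtain p I where pI: "p \<in> D" "I \<in> P" "(a, b) = m (p, I)" by auto
    have "fst (m (p, I)) \<in> {0<..<1}" "snd (m (p, I)) \<in> {0<..<1}"
      using m_in(1,2)[OF pI(1,2)] branch_subset(1)[OF pI(2)] by auto
    then show "a \<in> {0..1} \<and> b \<in> {0..1} \<and> a \<le> b"
      using m_in(3)[OF pI(1,2)] unfolding pI(3)[symmetric] by auto
  next
    show "disjoint_family_on (\<lambda>(a, b). {a<..<b}) (m ` (D \<times> P))"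
      unfolding disjoint_family_on_def
    proof (intro ballI impI)
      fix q r assume qr: "q \<in> m ` (D \<times> P)" "r \<in> m ` (D \<times> P)" "q \<noteq> r"
      obtain a b I where q: "(a, b) \<in> D" "I \<in> P" "q = m ((a, b), I)" using qr(1) by auto
      obtain c d J where r: "(c, d) \<in> D" "J \<in> P" "r = m ((c, d), J)" using qr(2) by auto
      show "(case q of (a, b) \<Rightarrow> {a<..<b}) \<inter> (case r of (a, b) \<Rightarrow> {a<..<b}) = {}"
      proof (rule ccontr)
        assume "(case q of (a, b) \<Rightarrow> {a<..<b}) \<inter> (case r of (a, b) \<Rightarrow> {a<..<b}) \<noteq> {}"
        then have "{fst q<..<snd q} \<inter> {fst r<..<snd r} \<noteq> {}" unfolding split_def .
        then obtain y where "y \<in> {fst q<..<snd q} \<inter> {fst r<..<snd r}" by blast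
        then have y: "fst q < y" "y < snd q" "fst r < y" "y < snd r" by simp_all
        have "y \<in> I" using interval(1)[OF q(2)] m_in(1,2)[OF q(1,2)] y(1,2) unfolding q(3)
          by (metis greaterThanLessThan_iff order_less_trans)
        moreover have "y \<in> J" using interval(1)[OF r(2)] m_in(1,2)[OF r(1,2)] y(3,4) unfolding r(3)
          by (metis greaterThanLessThan_iff order_less_trans)
        ultimately have IJ: "I = J" using P_props(2) q(2) r(2) by (auto simp: disjoint_def)
        have "f y \<in> {a<..<b} \<inter> {c<..<d}"
          using m_between[OF q(1,2)] m_between[OF r(1,2)] y unfolding q(3) r(3) by blast
        then have "(a, b) = (c, d)" using disj q(1) r(1) unfolding disjoint_family_on_def by fastforce
        then show False using qr(3) q(3) r(3) IJ by simp
      qed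
    qed
  qed
  finally show "(\<Sum>(a, b)\<in>D. norm (L0 f P h b - L0 f P h a)) \<le> B" .
qed

end

text \<open>
  Elements of \<open>W11\<close> are continuous on the closed interval, so the values at \<open>0\<close> and \<open>1\<close> follow.
  Identities for \<open>L0\<close> thus need checking only where it is a finite sum.
\<close>

lemma W11_eqI:
  assumes h: "h \<in> W11" and k: "k \<in> W11" and eq: "\<And>x. x \<in> {0<..<1} \<Longrightarrow> h x = k x"
  shows "h = k"
proof
  fix x
  show "h x = k x"
  proof (cases "x \<in> {0..1}")
    case True
    have "h x - k x = 0"
    proof (rule continuous_constant_on_closure[of "{0<..<1}" "\<lambda>x. h x - k x"])
      show "continuous_on (closure {0<..<1}) (\<lambda>x. h x - k x)"
        using continuous_on_diff[OF W11D(1)[OF h] W11D(1)[OF k]] by simp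
      show "x \<in> closure {0<..<1}" using True by simp
      show "h x - k x = 0" if "x \<in> {0<..<1}" for x using eq[OF that] by simp
    qed
    then show ?thesis by simp
  qed (use W11D(2)[OF h] W11D(2)[OF k] in auto)
qed

context full_branch_map
begin

lemma L0_lincomb:
  assumes L: "\<forall>h\<in>W11. L0 f P h \<in> W11" and h: "h \<in> W11" and k: "k \<in> W11"
  shows "L0 f P (\<lambda>x. a * h x + b * k x) = (\<lambda>x. a * L0 f P h x + b * L0 f P k x)"
proof (rule W11_eqI)
  show "L0 f P (\<lambda>x. a * h x + b * k x) \<in> W11" using L W11_lincomb[OF h k] by blast
  show "(\<lambda>x. a * L0 f P h x + b * L0 f P k x) \<in> W11" using L h k by (intro W11_lincomb) auto
qed (simp add: L0_interior sum.distrib sum_distrib_left)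

lemma L0_one:
  assumes L: "\<forall>h\<in>W11. L0 f P h \<in> W11"
  shows "L0 f P one_W11 = (\<lambda>x. of_nat (card P) * one_W11 x)"
proof (rule W11_eqI)
  show "L0 f P one_W11 \<in> W11" using L one_W11_in by blast
  show "(\<lambda>x. of_nat (card P) * one_W11 x) \<in> W11" by (rule W11_scale[OF one_W11_in])
  fix x :: real assume x: "x \<in> {0<..<1}"
  have "one_W11 (inv_branch I x) = 1" if "I \<in> P" for I
    using inv_branch(1)[OF that x] branch_subset(1)[OF that] by (intro one_W11_eq) auto
  then show "L0 f P one_W11 x = of_nat (card P) * one_W11 x"
    using x by (simp add: L0_interior one_W11_eq)
qed

lemma w11_var_L0:
  assumes L: "\<forall>h\<in>W11. L0 f P h \<in> W11" and h: "h \<in> W11"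
  shows "w11_var (L0 f P h) \<le> w11_var h"
  by (rule w11_var_le[OF _ var_bound_L0[OF var_bound_w11_var[OF h]]]) (use L h in blast)

end

section \<open>Entropy of a finite partition along an invariant measure\<close>

lemma integral_finite_range:
  fixes \<phi> :: "'b \<Rightarrow> real"
  assumes "prob_space M" and X: "X \<in> measurable M (count_space S)" and S: "finite S"
  shows "integrable M (\<lambda>x. \<phi> (X x))"
    "(\<integral>x. \<phi> (X x) \<partial>M) = (\<Sum>s\<in>S. measure M {x \<in> space M. X x = s} * \<phi> s)"
proof -
  interpret prob_space M by fact
  have m: "{x \<in> space M. X x = s} \<in> sets M" if "s \<in> S" for s
  proof -
    have "X -` {s} \<inter> space M \<in> sets M" using that by (intro measurable_sets[OF X]) simp
    moreover have "X -` {s} \<inter> space M = {x \<in> space M. X x = s}" by auto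
    ultimately show ?thesis by simp
  qed
  have XS: "X x \<in> S" if "x \<in> space M" for x using measurable_space[OF X that] by simp
  have eq: "\<phi> (X x) = (\<Sum>s\<in>S. indicator {x \<in> space M. X x = s} x * \<phi> s)" if x: "x \<in> space M" for x
  proof -
    have "(\<Sum>s\<in>S. indicator {x \<in> space M. X x = s} x * \<phi> s) = (\<Sum>s\<in>S. if X x = s then \<phi> s else 0)"
      by (rule sum.cong[OF refl]) (use x in \<open>simp add: indicator_def\<close>)
    also have "\<dots> = \<phi> (X x)" using S XS[OF x] by simp
    finally show ?thesis by simp
  qed
  have i: "integrable M (\<lambda>x. indicator {x \<in> space M. X x = s} x * \<phi> s)" if "s \<in> S" for s
    using m[OF that] by (intro integrable_mult_left) (simp add: less_top[symmetric] emeasure_finite)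
  have "integrable M (\<lambda>x. \<Sum>s\<in>S. indicator {x \<in> space M. X x = s} x * \<phi> s)"
    by (rule Bochner_Integration.integrable_sum) (rule i)
  then show "integrable M (\<lambda>x. \<phi> (X x))"
    by (subst Bochner_Integration.integrable_cong[OF refl eq]) auto
  have "(\<integral>x. \<phi> (X x) \<partial>M) = (\<integral>x. (\<Sum>s\<in>S. indicator {x \<in> space M. X x = s} x * \<phi> s) \<partial>M)"
    by (rule Bochner_Integration.integral_cong[OF refl eq])
  also have "\<dots> = (\<Sum>s\<in>S. \<integral>x. indicator {x \<in> space M. X x = s} x * \<phi> s \<partial>M)"
    by (rule Bochner_Integration.integral_sum) (rule i)
  also have "\<dots> = (\<Sum>s\<in>S. measure M {x \<in> space M. X x = s} * \<phi> s)"
  proof (rule sum.cong[OF refl])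
    fix s assume s: "s \<in> S"
    have "(\<integral>x. indicator {x \<in> space M. X x = s} x * \<phi> s \<partial>M) = (\<integral>x. indicator {x \<in> space M. X x = s} x \<partial>M) * \<phi> s"
      by (rule Bochner_Integration.integral_mult_left) (use m[OF s] in \<open>simp add: less_top[symmetric] emeasure_finite\<close>)
    also have "(\<integral>x. indicator {x \<in> space M. X x = s} x \<partial>M) = measure M {x \<in> space M. X x = s}"
      using m[OF s] by simp
    finally show "(\<integral>x. indicator {x \<in> space M. X x = s} x * \<phi> s \<partial>M) = measure M {x \<in> space M. X x = s} * \<phi> s" .
  qed
  finally show "(\<integral>x. \<phi> (X x) \<partial>M) = (\<Sum>s\<in>S. measure M {x \<in> space M. X x = s} * \<phi> s)" .
qed

text \<open>
  Comparison of \<open>p\<close> with the weights \<open>exp (- l)\<close> by \<open>ln t \<le> t - 1\<close>. Only words that occur with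
  positive probability are summed in the hypothesis, so \<open>l\<close> may be arbitrary on the others.
\<close>

lemma gibbs_inequality:
  fixes p :: "'b \<Rightarrow> real"
  assumes S: "finite S" and p0: "\<And>s. s \<in> S \<Longrightarrow> 0 \<le> p s" and p1: "(\<Sum>s\<in>S. p s) = 1"
    and l: "(\<Sum>s\<in>{s\<in>S. p s > 0}. exp (- l s)) \<le> 1"
  shows "- (\<Sum>s\<in>S. p s * ln (p s)) \<le> (\<Sum>s\<in>S. p s * l s)"
proof -
  define T where "T = {s\<in>S. p s > 0}"
  have T: "finite T" "T \<subseteq> S" using S by (auto simp: T_def)
  have z: "p s = 0" if "s \<in> S - T" for s using that p0[of s] by (auto simp: T_def)
  have rT: "(\<Sum>s\<in>S. p s * k s) = (\<Sum>s\<in>T. p s * k s)" for k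
    by (rule sum.mono_neutral_right) (use S T z in auto)
  have pT: "(\<Sum>s\<in>T. p s) = 1"
    using p1 sum.mono_neutral_right[of S T p] S T z by auto
  have "(\<Sum>s\<in>T. p s * (- l s - ln (p s))) \<le> (\<Sum>s\<in>T. exp (- l s) - p s)"
  proof (rule sum_mono)
    fix s assume "s \<in> T"
    then have ps: "p s > 0" by (simp add: T_def)
    have "- l s - ln (p s) = ln (exp (- l s) / p s)" using ps by (simp add: ln_div)
    also have "\<dots> \<le> exp (- l s) / p s - 1" by (rule ln_le_minus_one) (use ps in simp)
    finally have "p s * (- l s - ln (p s)) \<le> p s * (exp (- l s) / p s - 1)"
      by (rule mult_left_mono) (use ps in simp)
    also have "\<dots> = exp (- l s) - p s" using ps by (simp add: right_diff_distrib)
    finally show "p s * (- l s - ln (p s)) \<le> exp (- l s) - p s" .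
  qed
  also have "\<dots> \<le> 0" using l pT by (simp add: sum_subtractf T_def)
  finally have "- (\<Sum>s\<in>T. p s * ln (p s)) \<le> (\<Sum>s\<in>T. p s * l s)"
    by (simp add: right_diff_distrib sum_subtractf sum_negf)
  then show ?thesis by (simp add: rT)
qed

text \<open>
  Fekete's subadditive lemma: dividing \<open>n\<close> by \<open>m\<close> with remainder gives
  \<open>a n / n \<le> a m / m + m a 1 / n\<close>.
\<close>

lemma fekete:
  fixes a :: "nat \<Rightarrow> real"
  assumes a0: "a 0 = 0" and nn: "\<And>n. 0 \<le> a n" and sub: "\<And>n m. a (n + m) \<le> a n + a m"
  shows "convergent (\<lambda>n. a n / real n)"
proof -
  define L where "L = (INF n\<in>{1..}. a n / real n)"
  have bdd: "bdd_below ((\<lambda>n. a n / real n) ` {1..})" by (rule bdd_belowI2[of _ 0]) (simp add: nn)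
  have L_le: "L \<le> a n / real n" if "n \<ge> 1" for n
    unfolding L_def by (rule cINF_lower[OF bdd]) (use that in simp)
  have lin: "a n \<le> real n * a 1" for n
  proof (induction n)
    case (Suc n) then show ?case using sub[of n 1] by (simp add: algebra_simps)
  qed (simp add: a0)
  have mul: "a (q * m) \<le> real q * a m" for q m
  proof (induction q)
    case (Suc q) then show ?case using sub[of m "q * m"] by (simp add: algebra_simps)
  qed (simp add: a0)
  \<comment> \<open>one good ratio \<open>a m / m\<close> bounds all later ratios up to an error of order \<open>1 / n\<close>\<close>
  have up: "a n / real n \<le> a m / real m + real m * a 1 / real n" if m: "m \<ge> 1" and n: "n \<ge> 1" for m n
  proof -
    have "a n = a (n div m * m + n mod m)" by simp
    also have "\<dots> \<le> a (n div m * m) + a (n mod m)" by (rule sub)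
    also have "\<dots> \<le> real (n div m) * a m + real (n mod m) * a 1" by (intro add_mono mul lin)
    also have "\<dots> \<le> (real n / real m) * a m + real m * a 1"
    proof (intro add_mono mult_right_mono nn)
      show "real (n div m) \<le> real n / real m" by (rule of_nat_div_le_of_nat)
      show "real (n mod m) \<le> real m" using m by (simp add: less_imp_le)
    qed
    finally have "a n / real n \<le> ((real n / real m) * a m + real m * a 1) / real n"
      by (rule divide_right_mono) simp
    also have "\<dots> = a m / real m + real m * a 1 / real n" using n by (simp add: add_divide_distrib)
    finally show ?thesis .
  qed
  have "(\<lambda>n. a n / real n) \<longlonglongrightarrow> L"
  proof (rule LIMSEQ_I)
    fix e :: real assume e: "e > 0"
    have "\<exists>m\<in>{1..}. a m / real m < L + e / 2"
      using cINF_less_iff[OF _ bdd, of "L + e / 2"] e unfolding L_def by simp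
    then obtain m where m: "m \<ge> 1" "a m / real m < L + e / 2" by auto
    obtain k :: nat where k: "real m * a 1 / (e / 2) < real k" using reals_Archimedean2 by blast
    show "\<exists>no. \<forall>n\<ge>no. norm (a n / real n - L) < e"
    proof (intro exI allI impI)
      fix n assume n: "n \<ge> Suc k"
      then have n1: "n \<ge> 1" by simp
      have "real m * a 1 / (e / 2) < real n" using k n by linarith
      then have "real m * a 1 / real n < e / 2" using e n1 by (simp add: divide_less_eq mult.commute)
      then have "a n / real n < L + e" using up[OF m(1) n1] m(2) by linarith
      moreover have "L \<le> a n / real n" by (rule L_le[OF n1])
      ultimately show "norm (a n / real n - L) < e" by simp
    qed
  qed
  then show ?thesis by (rule convergentI)
qed

locale finite_partition_system = prob_space \<nu> for \<nu> :: "'a measure" +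
  fixes f :: "'a \<Rightarrow> 'a" and \<alpha> :: "'a set set"
  assumes f_meas: "f \<in> measurable \<nu> \<nu>" and f_inv: "distr \<nu> \<nu> f = \<nu>"
    and fin: "finite \<alpha>" and \<alpha>_sets: "\<alpha> \<subseteq> sets \<nu>" and part: "partition_on (space \<nu>) \<alpha>"
begin

definition atom :: "'a \<Rightarrow> 'a set" where "atom x = (THE A. A \<in> \<alpha> \<and> x \<in> A)"

lemma atom_eq: "A \<in> \<alpha> \<Longrightarrow> x \<in> A \<Longrightarrow> atom x = A"
  unfolding atom_def using part by (intro the_equality) (auto simp: partition_on_def disjoint_def)

lemma atom_in:
  assumes "x \<in> space \<nu>"
  shows "atom x \<in> \<alpha>" "x \<in> atom x"
proof -
  obtain A where "A \<in> \<alpha>" "x \<in> A" using assms part by (auto simp: partition_on_def)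
  then show "atom x \<in> \<alpha>" "x \<in> atom x" using atom_eq by auto
qed

lemma iter_meas: "(f ^^ n) \<in> measurable \<nu> \<nu>"
  by (rule measurable_compose_n[OF f_meas])

lemma iter_space: "x \<in> space \<nu> \<Longrightarrow> (f ^^ n) x \<in> space \<nu>"
  by (rule measurable_space[OF iter_meas])

lemma iter_inv: "distr \<nu> \<nu> (f ^^ n) = \<nu>"
proof (induction n)
  case 0 show ?case by (simp add: distr_id2[unfolded id_def] id_def)
next
  case (Suc n)
  have "distr \<nu> \<nu> (f ^^ Suc n) = distr (distr \<nu> \<nu> (f ^^ n)) \<nu> f"
    using distr_distr[OF f_meas iter_meas[of n]] by (simp add: comp_def)
  then show ?case using Suc f_inv by (simp only:)
qed

lemma atom_meas: "atom \<in> measurable \<nu> (count_space \<alpha>)"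
proof (subst measurable_count_space_eq2[OF fin], intro conjI ballI)
  show "atom \<in> space \<nu> \<rightarrow> \<alpha>" using atom_in by auto
  fix A assume A: "A \<in> \<alpha>"
  have "atom -` {A} \<inter> space \<nu> = A"
  proof -
    have "A \<subseteq> space \<nu>" using A \<alpha>_sets sets.sets_into_space by blast
    show ?thesis
    proof (intro equalityI subsetI)
      fix x assume "x \<in> atom -` {A} \<inter> space \<nu>"
      then show "x \<in> A" using atom_in(2)[of x] by simp
    next
      fix x assume x: "x \<in> A"
      then have "atom x = A" by (rule atom_eq[OF A])
      then show "x \<in> atom -` {A} \<inter> space \<nu>" using x \<open>A \<subseteq> space \<nu>\<close> by blast
    qed
  qed
  then show "atom -` {A} \<inter> space \<nu> \<in> sets \<nu>" using A \<alpha>_sets by auto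
qed

definition itinerary :: "nat \<Rightarrow> 'a \<Rightarrow> 'a set list" where
  "itinerary n x = map (\<lambda>i. atom ((f ^^ i) x)) [0..<n]"

text \<open>
  Words index the cylinders, including the empty ones, which contribute nothing to the entropy.
\<close>

definition words :: "nat \<Rightarrow> 'a set list set" where
  "words n = {w. set w \<subseteq> \<alpha> \<and> length w = n}"

lemma finite_words: "finite (words n)"
  unfolding words_def by (rule finite_lists_length_eq[OF fin])

lemma itinerary_words: "x \<in> space \<nu> \<Longrightarrow> itinerary n x \<in> words n"
  unfolding itinerary_def words_def using atom_in iter_space by auto

lemma cyl_sets: "{x \<in> space \<nu>. itinerary n x = w} \<in> sets \<nu>"
proof (cases "w \<in> words n")
  case True
  have "{x \<in> space \<nu>. atom ((f ^^ i) x) = w ! i} \<in> sets \<nu>" if "i < n" for i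
  proof -
    have wi: "w ! i \<in> \<alpha>" using True that by (auto simp: words_def)
    have "(atom \<circ> (f ^^ i)) \<in> measurable \<nu> (count_space \<alpha>)"
      by (rule measurable_comp[OF iter_meas atom_meas])
    from measurable_sets[OF this, of "{w ! i}"] wi
    have "(atom \<circ> (f ^^ i)) -` {w ! i} \<inter> space \<nu> \<in> sets \<nu>" by simp
    moreover have "(atom \<circ> (f ^^ i)) -` {w ! i} \<inter> space \<nu> = {x \<in> space \<nu>. atom ((f ^^ i) x) = w ! i}"
      unfolding comp_def vimage_def by blast
    ultimately show ?thesis by simp
  qed
  then have "{x \<in> space \<nu>. \<forall>i\<in>{..<n}. atom ((f ^^ i) x) = w ! i} \<in> sets \<nu>"
    by (intro sets.sets_Collect_finite_All) auto
  moreover have "{x \<in> space \<nu>. \<forall>i\<in>{..<n}. atom ((f ^^ i) x) = w ! i} = {x \<in> space \<nu>. itinerary n x = w}"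
    using True by (auto simp: itinerary_def words_def list_eq_iff_nth_eq)
  ultimately show ?thesis by simp
next
  case False
  then have "{x \<in> space \<nu>. itinerary n x = w} = {}" using itinerary_words by blast
  then show ?thesis by (simp only: sets.empty_sets)
qed

lemma itinerary_meas: "itinerary n \<in> measurable \<nu> (count_space (words n))"
proof (subst measurable_count_space_eq2[OF finite_words], intro conjI ballI)
  show "itinerary n \<in> space \<nu> \<rightarrow> words n" using itinerary_words by auto
  fix w
  have "itinerary n -` {w} \<inter> space \<nu> = {x \<in> space \<nu>. itinerary n x = w}" by auto
  then show "itinerary n -` {w} \<inter> space \<nu> \<in> sets \<nu>" using cyl_sets by simp
qed

definition cyl_prob :: "nat \<Rightarrow> 'a set list \<Rightarrow> real" where
  "cyl_prob n w = measure \<nu> {x \<in> space \<nu>. itinerary n x = w}"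

definition cyl_entropy :: "nat \<Rightarrow> real" where
  "cyl_entropy n = - (\<Sum>w\<in>words n. cyl_prob n w * ln (cyl_prob n w))"

lemma cyl_prob_nonneg: "0 \<le> cyl_prob n w" and cyl_prob_le_1: "cyl_prob n w \<le> 1"
  unfolding cyl_prob_def by (auto simp: measure_nonneg)

lemma integral_itinerary:
  fixes \<phi> :: "'a set list \<Rightarrow> real"
  shows "integrable \<nu> (\<lambda>x. \<phi> (itinerary n x))" "(\<integral>x. \<phi> (itinerary n x) \<partial>\<nu>) = (\<Sum>w\<in>words n. cyl_prob n w * \<phi> w)"
  using integral_finite_range[OF prob_space_axioms itinerary_meas finite_words, of \<phi>] unfolding cyl_prob_def by auto

lemma cyl_prob_sum: "(\<Sum>w\<in>words n. cyl_prob n w) = 1"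
  using integral_itinerary(2)[of "\<lambda>_. 1" n] prob_space by simp

lemma cyl_entropy_nonneg: "0 \<le> cyl_entropy n"
proof -
  have "(\<Sum>w\<in>words n. cyl_prob n w * ln (cyl_prob n w)) \<le> 0"
  proof (rule sum_nonpos)
    fix w
    have "ln (cyl_prob n w) \<le> 0" using cyl_prob_nonneg[of n w] cyl_prob_le_1[of n w] by (cases "cyl_prob n w = 0") auto
    then show "cyl_prob n w * ln (cyl_prob n w) \<le> 0" using cyl_prob_nonneg[of n w] by (simp add: mult_nonneg_nonpos)
  qed
  then show ?thesis by (simp add: cyl_entropy_def)
qed

text \<open>
  Every upper bound for the entropy below comes from a suitable choice of the code length \<open>l\<close>.
\<close>

lemma cyl_entropy_gibbs:
  assumes "(\<Sum>w\<in>{w\<in>words n. cyl_prob n w > 0}. exp (- l w)) \<le> 1"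
  shows "cyl_entropy n \<le> (\<integral>x. l (itinerary n x) \<partial>\<nu>)"
  unfolding cyl_entropy_def integral_itinerary(2)
  by (rule gibbs_inequality[OF finite_words cyl_prob_nonneg cyl_prob_sum assms])

lemma cyl_entropy_eq_integral: "cyl_entropy n = (\<integral>x. - ln (cyl_prob n (itinerary n x)) \<partial>\<nu>)"
  using integral_itinerary(2)[of "\<lambda>w. - ln (cyl_prob n w)" n] by (simp add: cyl_entropy_def sum_negf)

lemma cyl_entropy_0: "cyl_entropy 0 = 0"
proof -
  have "words 0 = {[]}" by (auto simp: words_def)
  moreover have "cyl_prob 0 [] = 1" using cyl_prob_sum[of 0] by (simp add: \<open>words 0 = {[]}\<close>)
  ultimately show ?thesis by (simp add: cyl_entropy_def)
qed

lemma integral_iter: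
  assumes "\<psi> \<in> borel_measurable \<nu>"
  shows "(\<integral>x. \<psi> ((f ^^ n) x) \<partial>\<nu>) = (\<integral>x. (\<psi> x :: real) \<partial>\<nu>)"
proof -
  have "(\<integral>x. \<psi> x \<partial>distr \<nu> \<nu> (f ^^ n)) = (\<integral>x. \<psi> ((f ^^ n) x) \<partial>\<nu>)"
    by (rule integral_distr[OF iter_meas assms])
  then show ?thesis by (simp add: iter_inv)
qed

lemma measure_iter:
  assumes "A \<in> sets \<nu>"
  shows "measure \<nu> ((f ^^ n) -` A \<inter> space \<nu>) = measure \<nu> A"
proof -
  have "measure (distr \<nu> \<nu> (f ^^ n)) A = measure \<nu> ((f ^^ n) -` A \<inter> space \<nu>)"
    by (rule measure_distr[OF iter_meas assms])
  then show ?thesis by (simp add: iter_inv)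
qed

lemma itinerary_add: "itinerary (n + m) x = itinerary n x @ itinerary m ((f ^^ n) x)"
proof -
  have "[0..<n + m] = [0..<n] @ map (\<lambda>i. i + n) [0..<m]"
    using upt_add_eq_append[of 0 n m] map_add_upt[of n m] by (simp add: add.commute)
  then show ?thesis by (simp add: itinerary_def funpow_add)
qed

lemma words_add_sum:
  fixes a b :: "'a set list \<Rightarrow> real"
  shows "(\<Sum>w\<in>words (n + m). a (take n w) * b (drop n w)) = (\<Sum>w\<in>words n. a w) * (\<Sum>w\<in>words m. b w)"
proof -
  have "(\<Sum>w\<in>words (n + m). a (take n w) * b (drop n w)) = (\<Sum>(u, v)\<in>words n \<times> words m. a u * b v)"
    by (rule sum.reindex_bij_witness[of _ "\<lambda>(u, v). u @ v" "\<lambda>w. (take n w, drop n w)"])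
       (auto simp: words_def dest: in_set_takeD in_set_dropD)
  then show ?thesis by (simp add: sum_product sum.cartesian_product)
qed

text \<open>
  Gibbs inequality with the product of the two marginal distributions; invariance of the measure
  identifies the second marginal.
\<close>

lemma cyl_entropy_subadditive: "cyl_entropy (n + m) \<le> cyl_entropy n + cyl_entropy m"
proof -
  \<comment> \<open>the code length of a word for independent blocks of lengths \<open>n\<close> and \<open>m\<close>\<close>
  define l where "l = (\<lambda>w. - ln (cyl_prob n (take n w)) - ln (cyl_prob m (drop n w)))"
  have pos: "cyl_prob n (take n w) > 0 \<and> cyl_prob m (drop n w) > 0" if w: "cyl_prob (n + m) w > 0" for w
  proof -
    have tk: "itinerary n x = take n w \<and> itinerary m ((f ^^ n) x) = drop n w" if "itinerary (n + m) x = w" for x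
      using that[unfolded itinerary_add] by (auto simp: itinerary_def)
    have "cyl_prob (n + m) w \<le> cyl_prob n (take n w)"
      unfolding cyl_prob_def by (rule finite_measure_mono[OF _ cyl_sets]) (use tk in auto)
    moreover have "cyl_prob (n + m) w \<le> measure \<nu> ((f ^^ n) -` {x \<in> space \<nu>. itinerary m x = drop n w} \<inter> space \<nu>)"
      unfolding cyl_prob_def
      by (rule finite_measure_mono[OF _ measurable_sets[OF iter_meas cyl_sets]]) (use tk iter_space in auto)
    ultimately show ?thesis using w measure_iter[OF cyl_sets, of n m "drop n w"] by (simp add: cyl_prob_def)
  qed
  have "cyl_entropy (n + m) \<le> (\<integral>x. l (itinerary (n + m) x) \<partial>\<nu>)"
  proof (rule cyl_entropy_gibbs)
    have "(\<Sum>w\<in>{w \<in> words (n + m). 0 < cyl_prob (n + m) w}. exp (- l w)) =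
        (\<Sum>w\<in>{w \<in> words (n + m). 0 < cyl_prob (n + m) w}. cyl_prob n (take n w) * cyl_prob m (drop n w))"
      by (rule sum.cong[OF refl]) (use pos in \<open>auto simp: l_def exp_add\<close>)
    also have "\<dots> \<le> (\<Sum>w\<in>words (n + m). cyl_prob n (take n w) * cyl_prob m (drop n w))"
      by (rule sum_mono2[OF finite_words]) (auto simp: cyl_prob_nonneg)
    also have "\<dots> = 1" by (simp add: words_add_sum cyl_prob_sum)
    finally show "(\<Sum>w\<in>{w \<in> words (n + m). 0 < cyl_prob (n + m) w}. exp (- l w)) \<le> 1" .
  qed
  also have "(\<integral>x. l (itinerary (n + m) x) \<partial>\<nu>) = (\<integral>x. - ln (cyl_prob n (itinerary n x)) + - ln (cyl_prob m
      (itinerary m ((f ^^ n) x))) \<partial>\<nu>)"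
  proof (rule Bochner_Integration.integral_cong[OF refl])
    fix x
    have "length (itinerary n x) = n" by (simp add: itinerary_def)
    then show "l (itinerary (n + m) x) = - ln (cyl_prob n (itinerary n x)) + - ln (cyl_prob m (itinerary m
        ((f ^^ n) x)))"
      by (simp add: l_def itinerary_add)
  qed
  also have "\<dots> = (\<integral>x. - ln (cyl_prob n (itinerary n x)) \<partial>\<nu>) + (\<integral>x. - ln (cyl_prob m (itinerary m ((f ^^ n) x))) \<partial>\<nu>)"
  proof (rule Bochner_Integration.integral_add)
    show "integrable \<nu> (\<lambda>x. - ln (cyl_prob n (itinerary n x)))" by (rule integral_itinerary(1))
    have "integrable (distr \<nu> \<nu> (f ^^ n)) (\<lambda>x. - ln (cyl_prob m (itinerary m x)))"
      unfolding iter_inv by (rule integral_itinerary(1))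
    then show "integrable \<nu> (\<lambda>x. - ln (cyl_prob m (itinerary m ((f ^^ n) x))))"
      by (rule integrable_distr[OF iter_meas])
  qed
  also have "(\<integral>x. - ln (cyl_prob m (itinerary m ((f ^^ n) x))) \<partial>\<nu>) = (\<integral>x. - ln (cyl_prob m (itinerary m x)) \<partial>\<nu>)"
    by (rule integral_iter) (rule borel_measurable_integrable[OF integral_itinerary(1)])
  finally show ?thesis by (simp add: cyl_entropy_eq_integral)
qed

text \<open>
  The case \<open>n = 0\<close> is excluded because the refinement of the empty family is \<open>{UNIV}\<close>.
\<close>

lemma dyn_refinement_eq:
  assumes n: "n \<ge> 1"
  shows "dyn_refinement \<nu> f \<alpha> n = (\<lambda>w. {x \<in> space \<nu>. itinerary n x = w}) ` words n - {{}}"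
proof -
  define pb where "pb = (\<lambda>k. pullback_partition \<nu> f \<alpha> k)"
  have pb_iff: "R \<in> pb k \<longleftrightarrow> (\<exists>A\<in>\<alpha>. R = (f ^^ k) -` A \<inter> space \<nu>) \<and> R \<noteq> {}" for R k
    unfolding pb_def pullback_partition_def by auto
  have pb_at: "R = (f ^^ k) -` atom ((f ^^ k) x) \<inter> space \<nu>" if R: "R \<in> pb k" and x: "x \<in> R" for R k x
  proof -
    obtain A where A: "A \<in> \<alpha>" "R = (f ^^ k) -` A \<inter> space \<nu>" using R pb_iff by blast
    then have "atom ((f ^^ k) x) = A" using x by (intro atom_eq) auto
    then show ?thesis using A by simp
  qed
  have pb_in: "(f ^^ k) -` atom ((f ^^ k) x) \<inter> space \<nu> \<in> pb k" if x: "x \<in> space \<nu>" for k x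
    using atom_in[OF iter_space[OF x, of k]] x unfolding pb_iff by blast
  have cyl: "{y \<in> space \<nu>. itinerary n y = itinerary n x} = (\<Inter>k<n. (f ^^ k) -` atom ((f ^^ k) x) \<inter> space \<nu>)"
    if x: "x \<in> space \<nu>" for x
  proof (intro equalityI subsetI)
    fix y assume y: "y \<in> {y \<in> space \<nu>. itinerary n y = itinerary n x}"
    then have e: "atom ((f ^^ k) y) = atom ((f ^^ k) x)" if "k < n" for k
      using that by (auto simp: itinerary_def)
    have ys: "y \<in> space \<nu>" using y by simp
    have "y \<in> (f ^^ k) -` atom ((f ^^ k) x) \<inter> space \<nu>" if "k < n" for k
      using atom_in(2)[OF iter_space[OF ys], of k] ys unfolding e[OF that] by simp
    then show "y \<in> (\<Inter>k<n. (f ^^ k) -` atom ((f ^^ k) x) \<inter> space \<nu>)"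
      by blast
  next
    fix y assume y: "y \<in> (\<Inter>k<n. (f ^^ k) -` atom ((f ^^ k) x) \<inter> space \<nu>)"
    have yk: "y \<in> (f ^^ k) -` atom ((f ^^ k) x) \<inter> space \<nu>" if "k < n" for k
      using y that unfolding INT_iff lessThan_iff by blast
    have ys: "y \<in> space \<nu>" using yk[of 0] n by simp
    have "atom ((f ^^ k) y) = atom ((f ^^ k) x)" if "k < n" for k
      by (rule atom_eq[OF atom_in(1)[OF iter_space[OF x]]]) (use yk[OF that] in simp)
    then show "y \<in> {y \<in> space \<nu>. itinerary n y = itinerary n x}" using ys by (auto simp: itinerary_def)
  qed
  have "X \<in> common_refinement (pb ` {..<n}) \<longleftrightarrow> (\<exists>x\<in>space \<nu>. X = {y \<in> space \<nu>. itinerary n y = itinerary n x})" for X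
  proof
    assume X: "X \<in> common_refinement (pb ` {..<n})"
    then obtain F where F: "F \<in> (\<Pi> R\<in>pb ` {..<n}. R)" "X = \<Inter> (F ` pb ` {..<n})" and "X \<noteq> {}"
      unfolding common_refinement by blast
    then obtain x where x: "x \<in> X" by blast
    have Fk: "F (pb k) \<in> pb k" if "k < n" for k using F(1) that by auto
    have xF: "x \<in> F (pb k)" if "k < n" for k using x F(2) that by auto
    have e: "F (pb k) = (f ^^ k) -` atom ((f ^^ k) x) \<inter> space \<nu>" if "k < n" for k
      by (rule pb_at[OF Fk[OF that] xF[OF that]])
    have xs: "x \<in> space \<nu>" using e[of 0] xF[of 0] n by auto
    have "X = (\<Inter>k<n. F (pb k))" unfolding F(2) by simp
    also have "\<dots> = (\<Inter>k<n. (f ^^ k) -` atom ((f ^^ k) x) \<inter> space \<nu>)"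
      by (rule INF_cong[OF refl]) (use e in simp)
    finally have "X = {y \<in> space \<nu>. itinerary n y = itinerary n x}" unfolding cyl[OF xs] .
    then show "\<exists>x\<in>space \<nu>. X = {y \<in> space \<nu>. itinerary n y = itinerary n x}" using xs by blast
  next
    assume "\<exists>x\<in>space \<nu>. X = {y \<in> space \<nu>. itinerary n y = itinerary n x}"
    then obtain x where x: "x \<in> space \<nu>" "X = {y \<in> space \<nu>. itinerary n y = itinerary n x}" by blast
    define F where "F = (\<lambda>R. SOME A. A \<in> R \<and> x \<in> A)"
    have "F (pb k) \<in> pb k \<and> x \<in> F (pb k)" for k
      unfolding F_def by (rule someI_ex) (use pb_in[OF x(1), of k] atom_in(2)[OF iter_space[OF x(1)], of k]
          x(1) in blast)
    then have F1: "F (pb k) \<in> pb k" and F2: "x \<in> F (pb k)" for k by auto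
    have "X = (\<Inter>k<n. F (pb k))"
      unfolding x(2) cyl[OF x(1)] by (rule INF_cong[OF refl]) (rule pb_at[OF F1 F2, symmetric])
    then have "X = \<Inter> (F ` pb ` {..<n})" by simp
    moreover have "x \<in> X" using x by simp
    ultimately show "X \<in> common_refinement (pb ` {..<n})"
      unfolding common_refinement using F1 by blast
  qed
  then have dyn: "X \<in> dyn_refinement \<nu> f \<alpha> n \<longleftrightarrow> (\<exists>x\<in>space \<nu>. X = {y \<in> space \<nu>. itinerary n y = itinerary n x})" for X
    unfolding dyn_refinement_def pb_def[symmetric] .
  show ?thesis
  proof (intro set_eqI iffI)
    fix X assume "X \<in> dyn_refinement \<nu> f \<alpha> n"
    then obtain x where x: "x \<in> space \<nu>" "X = {y \<in> space \<nu>. itinerary n y = itinerary n x}" using dyn by blast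
    then have "X \<noteq> {}" by blast
    then show "X \<in> (\<lambda>w. {x \<in> space \<nu>. itinerary n x = w}) ` words n - {{}}"
      using itinerary_words[OF x(1), of n] x(2) by blast
  next
    fix X assume "X \<in> (\<lambda>w. {x \<in> space \<nu>. itinerary n x = w}) ` words n - {{}}"
    then obtain w x where w: "X = {x \<in> space \<nu>. itinerary n x = w}" and x: "x \<in> X" by blast
    then have "w = itinerary n x" "x \<in> space \<nu>" by simp_all
    then show "X \<in> dyn_refinement \<nu> f \<alpha> n" using w dyn by blast
  qed
qed

lemma partition_entropy_eq:
  assumes n: "n \<ge> 1"
  shows "partition_entropy \<nu> (dyn_refinement \<nu> f \<alpha> n) = cyl_entropy n"
proof -
  define cyl where "cyl = (\<lambda>w. {x \<in> space \<nu>. itinerary n x = w})"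
  define T where "T = {w \<in> words n. cyl w \<noteq> {}}"
  have "inj_on cyl T" unfolding T_def by (rule inj_onI) (auto simp: cyl_def)
  moreover have "dyn_refinement \<nu> f \<alpha> n = cyl ` T"
    unfolding dyn_refinement_eq[OF n] T_def cyl_def by auto
  ultimately have "partition_entropy \<nu> (dyn_refinement \<nu> f \<alpha> n) = - (\<Sum>w\<in>T. cyl_prob n w * ln (cyl_prob n w))"
    by (simp add: partition_entropy_def sum.reindex cyl_prob_def cyl_def)
  also have "(\<Sum>w\<in>T. cyl_prob n w * ln (cyl_prob n w)) = (\<Sum>w\<in>words n. cyl_prob n w * ln (cyl_prob n w))"
  proof (rule sum.mono_neutral_left[OF finite_words])
    show "\<forall>w\<in>words n - T. cyl_prob n w * ln (cyl_prob n w) = 0"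
    proof
      fix w assume "w \<in> words n - T"
      then have "cyl w = {}" by (simp add: T_def)
      then have "cyl_prob n w = 0" unfolding cyl_prob_def cyl_def by (simp only: measure_empty)
      then show "cyl_prob n w * ln (cyl_prob n w) = 0" by simp
    qed
  qed (auto simp: T_def)
  finally show ?thesis by (simp add: cyl_entropy_def)
qed

text \<open>
  The limit in the definition of the entropy exists, so it can be estimated through any bound on
  the single terms.
\<close>

lemma entropy_LIMSEQ: "(\<lambda>n. cyl_entropy n / real n) \<longlonglongrightarrow> entropy_wrt_partition \<nu> f \<alpha>"
proof -
  have c: "convergent (\<lambda>n. cyl_entropy n / real n)"
    by (rule fekete[OF cyl_entropy_0 cyl_entropy_nonneg cyl_entropy_subadditive])
  have ev: "\<forall>\<^sub>F n in sequentially. cyl_entropy n / real n = partition_entropy \<nu> (dyn_refinement \<nu> f \<alpha> n) / real n"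
    using partition_entropy_eq by (auto intro!: eventually_sequentiallyI[of 1])
  obtain L where L: "(\<lambda>n. cyl_entropy n / real n) \<longlonglongrightarrow> L" using c by (auto simp: convergent_def)
  then have "(\<lambda>n. partition_entropy \<nu> (dyn_refinement \<nu> f \<alpha> n) / real n) \<longlonglongrightarrow> L"
    using tendsto_cong[OF ev] by simp
  then show ?thesis unfolding entropy_wrt_partition_def using L by (simp add: limI)
qed

text \<open>
  A channel that transmits a letter correctly with probability \<open>1 - \<delta>\<close>; the chance of error is
  spread over all letters, so the weights sum to at most 1.
\<close>

definition kernel :: "real \<Rightarrow> 'a set \<Rightarrow> 'a set \<Rightarrow> real" where
  "kernel \<delta> A B = (if A = B then 1 - \<delta> else \<delta> / real (card \<alpha>))"

definition kernel_list :: "real \<Rightarrow> 'a set list \<Rightarrow> 'a set list \<Rightarrow> real" where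
  "kernel_list \<delta> s w = prod_list (map2 (kernel \<delta>) s w)"

lemma card_\<alpha>_pos: "0 < card \<alpha>"
proof -
  have "\<alpha> \<noteq> {}" using part not_empty by (auto simp: partition_on_def)
  then show ?thesis using fin by (simp add: card_gt_0_iff)
qed

lemma kernel_pos: "0 < \<delta> \<Longrightarrow> \<delta> < 1 \<Longrightarrow> 0 < kernel \<delta> A B"
  using card_\<alpha>_pos by (simp add: kernel_def)

lemma kernel_sum:
  assumes d: "0 < \<delta>" "\<delta> < 1"
  shows "(\<Sum>B\<in>\<alpha>. kernel \<delta> A B) \<le> 1"
proof -
  have "(\<Sum>B\<in>\<alpha>. kernel \<delta> A B) \<le> (\<Sum>B\<in>\<alpha>. (if A = B then 1 - \<delta> else 0) + \<delta> / real (card \<alpha>))"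
    by (rule sum_mono) (use d in \<open>simp add: kernel_def\<close>)
  also have "\<dots> = (if A \<in> \<alpha> then 1 - \<delta> else 0) + \<delta>"
  proof -
    have "\<alpha> \<noteq> {}" using card_\<alpha>_pos by auto
    then show ?thesis using fin by (simp add: sum.distrib)
  qed
  also have "\<dots> \<le> 1" using d by simp
  finally show ?thesis .
qed

lemma kernel_list_pos:
  assumes d: "0 < \<delta>" "\<delta> < 1"
  shows "0 < kernel_list \<delta> s w"
proof (induction s arbitrary: w)
  case Nil show ?case by (simp add: kernel_list_def)
next
  case (Cons A s)
  show ?case
  proof (cases w)
    case Nil then show ?thesis by (simp add: kernel_list_def)
  next
    case (Cons B v)
    then show ?thesis using Cons.IH[of v] kernel_pos[OF d, of A B] by (simp add: kernel_list_def)
  qed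
qed

lemma kernel_list_sum:
  assumes d: "0 < \<delta>" "\<delta> < 1"
  shows "(\<Sum>w\<in>words (length s). kernel_list \<delta> s w) \<le> 1"
proof (induction s)
  case Nil
  have "words 0 = {[]}" by (auto simp: words_def)
  then show ?case by (simp add: kernel_list_def)
next
  case (Cons A s)
  have "(\<Sum>w\<in>words (length (A # s)). kernel_list \<delta> (A # s) w) = (\<Sum>(B, v)\<in>\<alpha> \<times> words (length s). kernel \<delta> A B *
      kernel_list \<delta> s v)"
    by (rule sum.reindex_bij_witness[of _ "\<lambda>(B, v). B # v" "\<lambda>w. (hd w, tl w)"])
       (auto simp: words_def kernel_list_def length_Suc_conv)
  also have "\<dots> = (\<Sum>B\<in>\<alpha>. kernel \<delta> A B) * (\<Sum>v\<in>words (length s). kernel_list \<delta> s v)"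
    by (simp add: sum_product sum.cartesian_product)
  also have "\<dots> \<le> 1 * 1"
    by (intro mult_mono kernel_sum[OF d] Cons.IH sum_nonneg) (auto intro: less_imp_le kernel_list_pos[OF d])
  finally show ?case by simp
qed

text \<open>
  The weights \<open>q\<close> pass a uniformly chosen \<open>v\<close>-itinerary through the noisy channel. The code length
  of a word is then at most \<open>ln (card S)\<close> plus a cost per letter: \<open>- ln (1 - \<delta>)\<close>, and
  \<open>- ln (\<delta> / card \<alpha>)\<close> at the times when \<open>v\<close> misreads the atom. By invariance the expected number
  of the latter is at most \<open>n\<close> times the measure of \<open>D\<close>.
\<close>

lemma cyl_entropy_le_itineraries:
  fixes n :: nat and v :: "'a \<Rightarrow> 'a set" and \<delta> :: real
  assumes d: "0 < \<delta>" "\<delta> < 1"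
    and v: "\<And>x. x \<in> space \<nu> \<Longrightarrow> v x \<in> \<alpha>"
    and dis: "D \<in> sets \<nu>" and D: "{x \<in> space \<nu>. v x \<noteq> atom x} \<subseteq> D"
  defines "S \<equiv> (\<lambda>x. map (\<lambda>i. v ((f ^^ i) x)) [0..<n]) ` space \<nu>"
  shows "cyl_entropy n \<le> ln (real (card S)) +
    real n * (- ln (1 - \<delta>) - measure \<nu> D * ln (\<delta> / real (card \<alpha>)))"
proof -
  have Sw: "S \<subseteq> words n" unfolding S_def words_def using v iter_space by auto
  then have finS: "finite S" by (rule finite_subset[OF _ finite_words])
  have cS: "0 < card S" using finS not_empty by (simp add: S_def card_gt_0_iff)
  define q where "q = (\<lambda>w. (\<Sum>s\<in>S. kernel_list \<delta> s w) / real (card S))"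
  define l where "l = (\<lambda>w. - ln (q w))"
  have qpos: "q w > 0" for w
    unfolding q_def using cS finS kernel_list_pos[OF d] by (intro divide_pos_pos sum_pos) auto
  define b where "b = - ln (\<delta> / real (card \<alpha>))"
  have b0: "0 \<le> b"
  proof -
    have "0 < \<delta> / real (card \<alpha>)" "\<delta> / real (card \<alpha>) \<le> 1"
      using d card_\<alpha>_pos by (auto simp: divide_le_eq)
    then show ?thesis by (simp add: b_def)
  qed
  \<comment> \<open>the cost of one letter, an upper bound for \<open>- ln\<close> of the channel weight\<close>
  define g where "g = (\<lambda>x. - ln (1 - \<delta>) + indicator D x * b)"
  have i1: "integrable \<nu> (\<lambda>x. indicator D x * b)"
    using dis by (intro integrable_mult_left) (simp add: less_top[symmetric] emeasure_finite)
  then have g_int: "integrable \<nu> g"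
    unfolding g_def by (intro Bochner_Integration.integrable_add integrable_const)
  have g_iter: "integrable \<nu> (\<lambda>x. g ((f ^^ i) x))" for i
  proof -
    have "integrable (distr \<nu> \<nu> (f ^^ i)) g" unfolding iter_inv by (rule g_int)
    then show ?thesis by (rule integrable_distr[OF iter_meas])
  qed
  have g_mean: "(\<integral>x. g ((f ^^ i) x) \<partial>\<nu>) = - ln (1 - \<delta>) + measure \<nu> D * b" for i
  proof -
    have "(\<integral>x. g ((f ^^ i) x) \<partial>\<nu>) = (\<integral>x. g x \<partial>\<nu>)"
      by (rule integral_iter[OF borel_measurable_integrable[OF g_int]])
    also have "\<dots> = (\<integral>x. - ln (1 - \<delta>) \<partial>\<nu>) + (\<integral>x. indicator D x * b \<partial>\<nu>)"
      unfolding g_def by (rule Bochner_Integration.integral_add[OF integrable_const i1])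
    also have "(\<integral>x. indicator D x * b \<partial>\<nu>) = measure \<nu> D * b" using dis by simp
    finally show ?thesis by (simp add: prob_space)
  qed
  have "cyl_entropy n \<le> (\<integral>x. l (itinerary n x) \<partial>\<nu>)"
  proof (rule cyl_entropy_gibbs)
    have "(\<Sum>w\<in>{w \<in> words n. 0 < cyl_prob n w}. exp (- l w)) = (\<Sum>w\<in>{w \<in> words n. 0 < cyl_prob n w}. q w)"
      by (simp add: l_def qpos)
    also have "\<dots> \<le> (\<Sum>w\<in>words n. q w)"
      by (rule sum_mono2[OF finite_words]) (auto simp: qpos less_imp_le)
    also have "\<dots> = (\<Sum>s\<in>S. \<Sum>w\<in>words n. kernel_list \<delta> s w) / real (card S)"
      unfolding q_def sum_divide_distrib[symmetric] by (subst sum.swap) (rule refl)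
    also have "\<dots> \<le> (\<Sum>s\<in>S. 1) / real (card S)"
    proof (intro divide_right_mono sum_mono)
      fix s assume "s \<in> S"
      then have "length s = n" using Sw by (auto simp: words_def)
      then show "(\<Sum>w\<in>words n. kernel_list \<delta> s w) \<le> 1" using kernel_list_sum[OF d, of s] by simp
    qed simp
    also have "\<dots> = 1" using cS by simp
    finally show "(\<Sum>w\<in>{w \<in> words n. 0 < cyl_prob n w}. exp (- l w)) \<le> 1" .
  qed
  also have "\<dots> \<le> (\<integral>x. ln (real (card S)) + (\<Sum>i<n. g ((f ^^ i) x)) \<partial>\<nu>)"
  proof (rule integral_mono)
    show "integrable \<nu> (\<lambda>x. l (itinerary n x))" by (rule integral_itinerary(1))
    show "integrable \<nu> (\<lambda>x. ln (real (card S)) + (\<Sum>i<n. g ((f ^^ i) x)))"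
      by (intro Bochner_Integration.integrable_add Bochner_Integration.integrable_sum integrable_const g_iter)
    fix x assume x: "x \<in> space \<nu>"
    define s where "s = map (\<lambda>i. v ((f ^^ i) x)) [0..<n]"
    have sS: "s \<in> S" using x unfolding s_def S_def by auto
    define K where "K = (\<lambda>i. kernel \<delta> (v ((f ^^ i) x)) (atom ((f ^^ i) x)))"
    have K0: "K i \<noteq> 0" for i
      using kernel_pos[OF d, of "v ((f ^^ i) x)" "atom ((f ^^ i) x)"] by (simp add: K_def)
    have "map2 (kernel \<delta>) s (itinerary n x) = map K [0..<n]"
      by (simp add: s_def itinerary_def list_eq_iff_nth_eq K_def)
    then have K: "kernel_list \<delta> s (itinerary n x) = (\<Prod>i<n. K i)"
      by (simp add: kernel_list_def prod.distinct_set_conv_list[symmetric] atLeast0LessThan)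
    have "kernel_list \<delta> s (itinerary n x) \<le> (\<Sum>s\<in>S. kernel_list \<delta> s (itinerary n x))"
      by (rule member_le_sum[OF sS _ finS]) (auto intro: less_imp_le kernel_list_pos[OF d])
    then have "kernel_list \<delta> s (itinerary n x) / real (card S) \<le> q (itinerary n x)"
      unfolding q_def by (rule divide_right_mono) simp
    then have "ln (kernel_list \<delta> s (itinerary n x) / real (card S)) \<le> ln (q (itinerary n x))"
      using qpos kernel_list_pos[OF d] cS by (subst ln_le_cancel_iff) auto
    moreover have "ln (kernel_list \<delta> s (itinerary n x) / real (card S)) = ln (kernel_list \<delta> s (itinerary n
        x)) - ln (real (card S))"
      using kernel_list_pos[OF d, of s "itinerary n x"] cS by (simp add: ln_div)
    moreover have "ln (kernel_list \<delta> s (itinerary n x)) = (\<Sum>i<n. ln (K i))"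
      unfolding K by (rule ln_prod) (use K0 in auto)
    moreover have "- ln (K i) \<le> g ((f ^^ i) x)" for i
    proof (cases "v ((f ^^ i) x) = atom ((f ^^ i) x)")
      case True then show ?thesis using b0 by (simp add: K_def g_def kernel_def indicator_def)
    next
      case False
      have "ln (1 - \<delta>) \<le> 0" using d by simp
      moreover have "(f ^^ i) x \<in> D" using False iter_space[OF x, of i] D by blast
      ultimately show ?thesis using False by (simp add: K_def g_def b_def kernel_def)
    qed
    then have "(\<Sum>i<n. - ln (K i)) \<le> (\<Sum>i<n. g ((f ^^ i) x))" by (rule sum_mono)
    ultimately show "l (itinerary n x) \<le> ln (real (card S)) + (\<Sum>i<n. g ((f ^^ i) x))"
      unfolding l_def sum_negf by linarith
  qed
  also have "\<dots> = (\<integral>x. ln (real (card S)) \<partial>\<nu>) + (\<integral>x. (\<Sum>i<n. g ((f ^^ i) x)) \<partial>\<nu>)"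
    by (intro Bochner_Integration.integral_add Bochner_Integration.integrable_sum integrable_const g_iter)
  also have "\<dots> = ln (real (card S)) + (\<Sum>i<n. - ln (1 - \<delta>) + measure \<nu> D * b)"
    by (simp only: Bochner_Integration.integral_sum[OF g_iter] g_mean lebesgue_integral_const prob_space
        real_scaleR_def mult_1)
  also have "\<dots> = ln (real (card S)) + real n * (- ln (1 - \<delta>) - measure \<nu> D * ln (\<delta> / real (card \<alpha>)))"
    by (simp add: b_def algebra_simps)
  finally show ?thesis .
qed

end

section \<open>Entropy of full branch maps is at most the logarithm of the number of branches\<close>

text \<open>
  \<open>B\<close> is a union of points of \<open>E\<close> and of components of the complement of \<open>E\<close>.
\<close>

definition cut_saturated :: "real set \<Rightarrow> real set \<Rightarrow> bool" where
  "cut_saturated E B \<longleftrightarrow> (\<forall>x y. x \<le> y \<longrightarrow> E \<inter> {x..y} = {} \<longrightarrow> (x \<in> B \<longleftrightarrow> y \<in> B))"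

lemma cut_saturated_mono: "cut_saturated E B \<Longrightarrow> E \<subseteq> F \<Longrightarrow> cut_saturated F B"
  unfolding cut_saturated_def by blast

lemma cut_saturated_UN:
  assumes "\<And>i. i \<in> J \<Longrightarrow> cut_saturated E (B i)"
  shows "cut_saturated E (\<Union>i\<in>J. B i)"
  using assms unfolding cut_saturated_def by blast

text \<open>
  Sets that can be approximated by finite unions of intervals form a sigma algebra.
\<close>

lemma borel_approx_saturated:
  fixes M :: "real measure"
  assumes M: "finite_measure M" and sM: "sets M = sets borel" and A: "A \<in> sets borel" and e: "0 < (e::real)"
  shows "\<exists>E B. finite E \<and> cut_saturated E B \<and> B \<in> sets borel \<and> measure M (sym_diff A B) < e"
proof -
  interpret finite_measure M by fact
  have "A \<in> sigma_sets UNIV (range (\<lambda>a::real. {..a}))"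
    using A unfolding borel_eq_atMost by simp
  then have "A \<in> sets borel \<and> (\<forall>e>0. \<exists>E B. finite E \<and> cut_saturated E B \<and> B \<in> sets borel \<and> measure M
      (sym_diff A B) < e)"
  proof (induction rule: sigma_sets.induct)
    case (Basic A)
    then obtain a where a: "A = {..a}" by blast
    have "cut_saturated {a} A" unfolding cut_saturated_def a by auto
    then show ?case using a by (intro conjI allI impI exI[of _ "{a}"] exI[of _ A]) auto
  next
    case Empty
    have "cut_saturated {} {}" unfolding cut_saturated_def by simp
    then show ?case by (intro conjI allI impI exI[of _ "{}"]) auto
  next
    case (Compl A)
    show ?case
    proof (intro conjI allI impI)
      show "UNIV - A \<in> sets borel" using Compl by auto
      fix e :: real assume "0 < e"
      then obtain E B where EB: "finite E" "cut_saturated E B" "B \<in> sets borel" "measure M (sym_diff A B) < e"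
        using Compl.IH by blast
      have "((UNIV - A) - (UNIV - B)) \<union> ((UNIV - B) - (UNIV - A)) = sym_diff A B" by blast
      moreover have "cut_saturated E (UNIV - B)" using EB(2) unfolding cut_saturated_def by simp
      moreover have "UNIV - B \<in> sets borel" using EB(3) by auto
      ultimately show "\<exists>E B. finite E \<and> cut_saturated E B \<and> B \<in> sets borel \<and> measure M (((UNIV - A) - B) \<union>
          (B - (UNIV - A))) < e"
        using EB(1,4) by (intro exI[of _ E] exI[of _ "UNIV - B"]) simp
    qed
  next
    case (Union A)
    have Ab: "A i \<in> sets borel" for i using Union.IH by blast
    show ?case
    proof (intro conjI allI impI)
      show U: "\<Union> (range A) \<in> sets borel" using Ab by blast
      fix e :: real assume e: "0 < e"
      have AM: "A i \<in> sets M" for i using Ab sM by simp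
      define C where "C = (\<lambda>n. \<Union>i<n. A i)"
      have CM: "C n \<in> sets M" for n unfolding C_def using AM by auto
      have "incseq C" unfolding C_def incseq_def by (auto intro: less_le_trans)
      then have "(\<lambda>n. measure M (C n)) \<longlonglongrightarrow> measure M (\<Union>n. C n)"
        using CM by (intro finite_Lim_measure_incseq) auto
      moreover have "(\<Union>n. C n) = \<Union> (range A)" unfolding C_def by auto
      ultimately have "(\<lambda>n. measure M (C n)) \<longlonglongrightarrow> measure M (\<Union> (range A))" by simp
      then have "\<forall>\<^sub>F n in sequentially. measure M (\<Union> (range A)) - e / 2 < measure M (C n)"
        using e by (intro order_tendstoD(1)) auto
      then obtain n where n: "measure M (\<Union> (range A)) - e / 2 < measure M (C n)"
        by (auto simp: eventually_sequentially)
      have CU: "C n \<subseteq> \<Union> (range A)" unfolding C_def by auto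
      have UM: "\<Union> (range A) \<in> sets M" using U sM by simp
      have d: "measure M (\<Union> (range A) - C n) < e / 2"
        using n finite_measure_Diff[OF UM CM CU] by simp
      \<comment> \<open>half of \<open>e\<close> is spent on the tail of the union, the rest is shared by its first \<open>n\<close> members\<close>
      define r where "r = e / (2 * real (Suc n))"
      have r: "r > 0" using e by (simp add: r_def)
      have "\<forall>i. \<exists>E B. finite E \<and> cut_saturated E B \<and> B \<in> sets borel \<and> measure M ((A i - B) \<union> (B - A i)) < r"
        using Union.IH r by blast
      then obtain E B where EB: "\<And>i. finite (E i)" "\<And>i. cut_saturated (E i) (B i)" "\<And>i. B i \<in> sets borel"
        "\<And>i. measure M (sym_diff (A i) (B i)) < r" by metis
      define E' where "E' = (\<Union>i<n. E i)"
      define B' where "B' = (\<Union>i<n. B i)"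
      have BM: "B i \<in> sets M" for i using EB(3) sM by simp
      have "cut_saturated E' B'" unfolding B'_def
        by (rule cut_saturated_UN, rule cut_saturated_mono[OF EB(2)]) (auto simp: E'_def)
      moreover have "finite E'" using EB(1) by (simp add: E'_def)
      moreover have "B' \<in> sets borel" using EB(3) unfolding B'_def by auto
      moreover have "measure M ((\<Union> (range A) - B') \<union> (B' - \<Union> (range A))) < e"
      proof -
        define W where "W = (\<lambda>i. sym_diff (A i) (B i))"
        have W: "W i \<in> sets M" for i unfolding W_def by (intro sets.Un sets.Diff AM BM)
        have UW: "(\<Union>i<n. W i) \<in> sets M" by (rule sets.finite_UN) (auto simp: W)
        have DC: "\<Union> (range A) - C n \<in> sets M" by (intro sets.Diff UM CM)
        have "(\<Union> (range A) - B') \<union> (B' - \<Union> (range A)) \<subseteq> (\<Union> (range A) - C n) \<union> (\<Union>i<n. W i)"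
          unfolding B'_def C_def W_def by blast
        then have "measure M ((\<Union> (range A) - B') \<union> (B' - \<Union> (range A))) \<le> measure M ((\<Union> (range A) - C n) \<union> (\<Union>i<n. W i))"
          by (rule finite_measure_mono[OF _ sets.Un[OF DC UW]])
        also have "\<dots> \<le> measure M (\<Union> (range A) - C n) + measure M (\<Union>i<n. W i)"
          by (rule measure_Un_le[OF DC UW])
        also have "measure M (\<Union>i<n. W i) \<le> (\<Sum>i<n. measure M (W i))"
          by (rule finite_measure_subadditive_finite) (use W in blast)+
        also have "\<dots> \<le> (\<Sum>i<n. r)" unfolding W_def by (intro sum_mono less_imp_le EB(4))
        also have "\<dots> \<le> e / 2"
        proof -
          have "real n * e \<le> real (Suc n) * e" using e by (intro mult_right_mono) auto
          then show ?thesis unfolding r_def by (simp add: divide_simps del: of_nat_Suc) (simp add: mult.commute)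
        qed
        finally show ?thesis using d by linarith
      qed
      ultimately show "\<exists>E B. finite E \<and> cut_saturated E B \<and> B \<in> sets borel \<and> measure M ((\<Union> (range A) - B) \<union>
          (B - \<Union> (range A))) < e"
        by blast
    qed
  qed
  then show ?thesis using e by blast
qed

text \<open>
  Points of \<open>E\<close> count twice once they are passed, so the code also separates a point of \<open>E\<close> from
  both of its sides.
\<close>

definition cut_code :: "real set \<Rightarrow> real \<Rightarrow> nat" where
  "cut_code E x = card {e \<in> E. e < x} + card {e \<in> E. e \<le> x}"

lemma cut_code_le: "finite E \<Longrightarrow> cut_code E x \<le> 2 * card E"
  unfolding cut_code_def using card_mono[of E "{e \<in> E. e < x}"] card_mono[of E "{e \<in> E. e \<le> x}"] by auto

lemma cut_code_eqD:
  assumes E: "finite E" and xy: "x < y" and eq: "cut_code E x = cut_code E y"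
  shows "E \<inter> {x..y} = {}"
proof -
  have s1: "{e \<in> E. e < x} \<subseteq> {e \<in> E. e < y}" and s2: "{e \<in> E. e \<le> x} \<subseteq> {e \<in> E. e \<le> y}" using xy by auto
  have f: "finite {e \<in> E. e < y}" "finite {e \<in> E. e \<le> y}" using E by auto
  have "card {e \<in> E. e < x} = card {e \<in> E. e < y}" "card {e \<in> E. e \<le> x} = card {e \<in> E. e \<le> y}"
    using card_mono[OF f(1) s1] card_mono[OF f(2) s2] eq unfolding cut_code_def by linarith+
  then have "{e \<in> E. e < x} = {e \<in> E. e < y}" "{e \<in> E. e \<le> x} = {e \<in> E. e \<le> y}"
    using card_subset_eq[OF f(1) s1] card_subset_eq[OF f(2) s2] by auto
  then have a: "e < x \<longleftrightarrow> e < y" and b: "e \<le> x \<longleftrightarrow> e \<le> y" if "e \<in> E" for e using that by blast+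
  show ?thesis
  proof (rule ccontr)
    assume "E \<inter> {x..y} \<noteq> {}"
    then obtain e where "e \<in> E" "x \<le> e" "e \<le> y" by auto
    then show False using a[of e] b[of e] xy by linarith
  qed
qed

lemma card_image_factor:
  assumes fin: "finite (c ` X)" and fac: "\<And>x y. x \<in> X \<Longrightarrow> y \<in> X \<Longrightarrow> c x = c y \<Longrightarrow> g x = g y"
  shows "card (g ` X) \<le> card (c ` X)"
proof -
  define s where "s = (\<lambda>k. SOME x. x \<in> X \<and> c x = k)"
  have s: "s (c x) \<in> X \<and> c (s (c x)) = c x" if "x \<in> X" for x
    unfolding s_def by (rule someI[of _ x]) (use that in simp)
  have "g ` X \<subseteq> (\<lambda>k. g (s k)) ` (c ` X)"
  proof
    fix z assume "z \<in> g ` X"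
    then obtain x where x: "z = g x" "x \<in> X" by (rule imageE)
    have "g x = g (s (c x))" using s[OF x(2)] x(2) by (intro fac) auto
    then show "z \<in> (\<lambda>k. g (s k)) ` (c ` X)" using x by blast
  qed
  then have "card (g ` X) \<le> card ((\<lambda>k. g (s k)) ` (c ` X))" by (intro card_mono finite_imageI fin)
  also have "\<dots> \<le> card (c ` X)" by (rule card_image_le[OF fin])
  finally show ?thesis .
qed

context full_branch_map
begin

definition cuts :: "real set" where "cuts = {0..1} - \<Union>P"

lemma finite_cuts: "finite cuts"
proof -
  have "cuts \<subseteq> (\<Union>I\<in>P. {Inf I, Sup I})"
  proof
    fix x assume x: "x \<in> cuts"
    then have "x \<in> (\<Union>I\<in>P. closure I)" "x \<notin> \<Union>P" using P_props(4) by (auto simp: cuts_def)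
    then obtain I where I: "I \<in> P" "x \<in> closure I" "x \<notin> I" by auto
    have "x \<in> {Inf I..Sup I}" using I(2) interval(3)[OF I(1)] by simp
    moreover have "x \<notin> {Inf I<..<Sup I}" using I(3) interval(1)[OF I(1)] by simp
    ultimately have "x \<in> {Inf I, Sup I}" by auto
    then show "x \<in> (\<Union>I\<in>P. {Inf I, Sup I})" using I(1) by blast
  qed
  then show ?thesis using P_props(1) by (auto intro: finite_subset)
qed

lemma cont_Union: "continuous_on (\<Union>P) f"
  by (rule continuous_on_open_UN[of P "\<lambda>I. I", simplified]) (use branch_subset(2) branch_cont in auto)

lemma finite_preimage:
  assumes S: "finite S"
  shows "finite {x \<in> {0..1}. f x \<in> S}" "card {x \<in> {0..1}. f x \<in> S} \<le> card P * card S + card cuts"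
proof -
  define T where "T = (\<lambda>(I, s). inv_branch I s) ` (P \<times> S)"
  have T: "finite T" "card T \<le> card P * card S"
    using card_image_le[of "P \<times> S" "\<lambda>(I, s). inv_branch I s"] P_props(1) S unfolding T_def
    by (auto simp: card_cartesian_product)
  have sub: "{x \<in> {0..1}. f x \<in> S} \<subseteq> T \<union> cuts"
  proof
    fix x assume x: "x \<in> {x \<in> {0..1}. f x \<in> S}"
    show "x \<in> T \<union> cuts"
    proof (cases "x \<in> \<Union>P")
      case True
      then obtain I where I: "I \<in> P" "x \<in> I" by blast
      have "x = (\<lambda>(I, s). inv_branch I s) (I, f x)" using inv_branch_f[OF I] by simp
      moreover have "(I, f x) \<in> P \<times> S" using I x by simp
      ultimately have "x \<in> T" unfolding T_def by (rule image_eqI)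
      then show ?thesis by simp
    next
      case False then show ?thesis using x by (simp add: cuts_def)
    qed
  qed
  show "finite {x \<in> {0..1}. f x \<in> S}" by (rule finite_subset[OF sub]) (simp add: T finite_cuts)
  have "card {x \<in> {0..1}. f x \<in> S} \<le> card (T \<union> cuts)" by (rule card_mono[OF _ sub]) (simp add: T finite_cuts)
  also have "\<dots> \<le> card T + card cuts" by (rule card_Un_le)
  finally show "card {x \<in> {0..1}. f x \<in> S} \<le> card P * card S + card cuts" using T(2) by linarith
qed

lemma iter_range: "x \<in> {0..1} \<Longrightarrow> (f ^^ n) x \<in> {0..1}"
  by (induction n) (use f_range in auto)

text \<open>
  A point has at most \<open>N\<close> preimages in the branches; the remaining preimages lie in \<open>cuts\<close>. The
  factor \<open>Suc n\<close> absorbs these, as \<open>cuts \<subseteq> E\<close>.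
\<close>

lemma iter_preimage:
  assumes E: "finite E" "cuts \<subseteq> E" "E \<subseteq> {0..1}"
  shows "finite {x \<in> {0..1}. (f ^^ n) x \<in> E} \<and> card {x \<in> {0..1}. (f ^^ n) x \<in> E} \<le> card P ^ n * (card E * Suc n)"
proof (induction n)
  case 0
  have "{x \<in> {0..1}. (f ^^ 0) x \<in> E} = E" using E(3) by auto
  then show ?case using E(1) by simp
next
  case (Suc n)
  define S where "S = {x \<in> {0..1}. (f ^^ n) x \<in> E}"
  have IH: "finite S" "card S \<le> card P ^ n * (card E * Suc n)" using Suc by (auto simp: S_def)
  have eq: "{x \<in> {0..1}. (f ^^ Suc n) x \<in> E} = {x \<in> {0..1}. f x \<in> S}"
    using f_range by (auto simp: S_def funpow_Suc_right simp del: funpow.simps)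
  have P1: "1 \<le> card P" using P_props(1) P_nonempty by (simp add: Suc_le_eq card_gt_0_iff)
  have "card cuts \<le> card E" by (rule card_mono[OF E(1,2)])
  also have "\<dots> \<le> card P ^ Suc n * card E" using P1 by simp
  finally have c: "card cuts \<le> card P ^ Suc n * card E" .
  have "card {x \<in> {0..1}. f x \<in> S} \<le> card P * card S + card cuts" by (rule finite_preimage(2)[OF IH(1)])
  also have "\<dots> \<le> card P * (card P ^ n * (card E * Suc n)) + card P ^ Suc n * card E"
    by (intro add_mono mult_le_mono2 IH(2) c)
  also have "\<dots> = card P ^ Suc n * (card E * Suc (Suc n))" by (simp add: algebra_simps)
  finally show ?case using finite_preimage(1)[OF IH(1)] unfolding eq by blast
qed

definition all_cuts :: "real set \<Rightarrow> nat \<Rightarrow> real set" where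
  "all_cuts E n = (\<Union>i<n. {x \<in> {0..1}. (f ^^ i) x \<in> E})"

lemma all_cuts_card:
  assumes E: "finite E" "cuts \<subseteq> E" "E \<subseteq> {0..1}"
  shows "finite (all_cuts E n)" "card (all_cuts E n) \<le> n * (card P ^ n * (card E * n))"
proof -
  show "finite (all_cuts E n)" unfolding all_cuts_def using iter_preimage[OF E] by simp
  have P1: "1 \<le> card P" using P_props(1) P_nonempty by (simp add: Suc_le_eq card_gt_0_iff)
  have "card (all_cuts E n) \<le> (\<Sum>i<n. card {x \<in> {0..1}. (f ^^ i) x \<in> E})"
    unfolding all_cuts_def by (rule card_UN_le) simp
  also have "\<dots> \<le> (\<Sum>i<n. card P ^ n * (card E * n))"
  proof (rule sum_mono)
    fix i assume i: "i \<in> {..<n}"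
    have "card {x \<in> {0..1}. (f ^^ i) x \<in> E} \<le> card P ^ i * (card E * Suc i)" using iter_preimage[OF E] by blast
    also have "\<dots> \<le> card P ^ n * (card E * n)"
      using i P1 by (intro mult_le_mono power_increasing) auto
    finally show "card {x \<in> {0..1}. (f ^^ i) x \<in> E} \<le> card P ^ n * (card E * n)" .
  qed
  also have "\<dots> = n * (card P ^ n * (card E * n))" by simp
  finally show "card (all_cuts E n) \<le> n * (card P ^ n * (card E * n))" .
qed

text \<open>
  As long as an interval stays away from \<open>E \<supseteq> cuts\<close>, its images lie in the branches, where \<open>f\<close> is
  continuous.
\<close>

lemma no_cut_iter:
  assumes E: "cuts \<subseteq> E" and x: "0 \<le> x" and y: "y \<le> 1"
    and no: "all_cuts E n \<inter> {x..y} = {}" and i: "i < n"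
  shows "continuous_on {x..y} (f ^^ i)" "(f ^^ i) ` {x..y} \<inter> E = {}"
proof -
  have img: "(f ^^ i) ` {x..y} \<inter> E = {}" if "i < n" for i
  proof (rule ccontr)
    assume "(f ^^ i) ` {x..y} \<inter> E \<noteq> {}"
    then obtain z where "z \<in> {x..y}" "(f ^^ i) z \<in> E" by blast
    moreover from this have "z \<in> {0..1}" using x y by simp
    ultimately have "z \<in> all_cuts E n \<inter> {x..y}" using that unfolding all_cuts_def by blast
    then show False using no by simp
  qed
  then show "(f ^^ i) ` {x..y} \<inter> E = {}" using i by blast
  have "continuous_on {x..y} (f ^^ i)" if "i < n" for i
    using that
  proof (induction i)
    case 0 show ?case by (simp add: id_def)
  next
    case (Suc i)
    have "(f ^^ i) ` {x..y} \<subseteq> \<Union>P"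
    proof
      fix w assume w: "w \<in> (f ^^ i) ` {x..y}"
      then obtain z where z: "w = (f ^^ i) z" "z \<in> {x..y}" by (rule imageE)
      have "w \<in> {0..1}" unfolding z(1) by (rule iter_range) (use z(2) x y in simp)
      moreover have "w \<notin> cuts" using img[of i] w Suc.prems E by auto
      ultimately show "w \<in> \<Union>P" by (simp add: cuts_def)
    qed
    then have "continuous_on ((f ^^ i) ` {x..y}) f" by (rule continuous_on_subset[OF cont_Union])
    then have "continuous_on {x..y} (f \<circ> (f ^^ i))" using Suc by (intro continuous_on_compose) auto
    then show ?case by simp
  qed
  then show "continuous_on {x..y} (f ^^ i)" using i by blast
qed

text \<open>
  Points with equal codes bound an interval whose images up to time \<open>n\<close> are intervals without
  points of \<open>E\<close>. Hence there are no more \<open>E\<close>-itineraries than codes.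
\<close>

lemma saturated_iter:
  assumes E: "cuts \<subseteq> E" "E \<subseteq> {0..1}" and fin: "finite (all_cuts E n)"
    and x: "x \<in> {0..1}" and y: "y \<in> {0..1}" and i: "i < n"
    and code: "cut_code (all_cuts E n) x = cut_code (all_cuts E n) y"
    and sat: "cut_saturated E B"
  shows "(f ^^ i) x \<in> B \<longleftrightarrow> (f ^^ i) y \<in> B"
proof -
  have *: "(f ^^ i) x \<in> B \<longleftrightarrow> (f ^^ i) y \<in> B"
    if xy: "x < y" and x: "x \<in> {0..1}" and y: "y \<in> {0..1}" and code: "cut_code (all_cuts E n) x = cut_code
        (all_cuts E n) y" for x y
  proof -
    have no: "all_cuts E n \<inter> {x..y} = {}" by (rule cut_code_eqD[OF fin xy code])
    have c: "continuous_on {x..y} (f ^^ i)" "(f ^^ i) ` {x..y} \<inter> E = {}"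
      using no_cut_iter[OF E(1) _ _ no i] x y xy by auto
    have conn: "connected ((f ^^ i) ` {x..y})" by (rule connected_continuous_image[OF c(1)]) simp
    have xin: "(f ^^ i) x \<in> (f ^^ i) ` {x..y}" and yin: "(f ^^ i) y \<in> (f ^^ i) ` {x..y}" using xy by auto
    have s1: "{(f ^^ i) x..(f ^^ i) y} \<subseteq> (f ^^ i) ` {x..y}" by (rule connected_contains_Icc[OF conn xin yin])
    have s2: "{(f ^^ i) y..(f ^^ i) x} \<subseteq> (f ^^ i) ` {x..y}" by (rule connected_contains_Icc[OF conn yin xin])
    show ?thesis
    proof (cases "(f ^^ i) x \<le> (f ^^ i) y")
      case True
      have "E \<inter> {(f ^^ i) x..(f ^^ i) y} = {}" using s1 c(2) by blast
      then show ?thesis using sat True unfolding cut_saturated_def by blast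
    next
      case False
      have "E \<inter> {(f ^^ i) y..(f ^^ i) x} = {}" using s2 c(2) by blast
      moreover have "(f ^^ i) y \<le> (f ^^ i) x" using False by simp
      ultimately show ?thesis using sat unfolding cut_saturated_def by blast
    qed
  qed
  show ?thesis
  proof (cases x y rule: linorder_cases)
    case less then show ?thesis by (rule *[OF _ x y code])
  next
    case equal then show ?thesis by simp
  next
    case greater then show ?thesis by (rule *[OF _ y x code[symmetric], symmetric])
  qed
qed

text \<open>
  Replace the atoms of \<open>\<alpha>\<close> by saturated sets \<open>B A\<close>, read off from these a guess \<open>v\<close> for the atom,
  and count the \<open>v\<close>-itineraries by cut codes.
\<close>

lemma entropy_le_ln_card:
  assumes inv: "invariant_prob f \<nu>" and \<alpha>: "finite \<alpha>" "\<alpha> \<subseteq> sets \<nu>" "partition_on (space \<nu>) \<alpha>"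
  shows "entropy_wrt_partition \<nu> f \<alpha> \<le> ln (real (card P))"
proof -
  interpret finite_partition_system \<nu> f \<alpha>
    by (intro finite_partition_system.intro finite_partition_system_axioms.intro \<alpha>)
       (use inv in \<open>simp_all only: invariant_prob_def\<close>)
  have s\<nu>: "sets \<nu> = sets (restrict_space borel {0..1})" using inv by (simp add: invariant_prob_def)
  have sp: "space \<nu> = {0..1}" using sets_eq_imp_space_eq[OF s\<nu>] by (simp add: space_restrict_space)
  have sb: "A \<in> sets \<nu> \<longleftrightarrow> A \<in> sets borel \<and> A \<subseteq> {0..1}" for A
    unfolding s\<nu> by (subst sets_restrict_space_iff) auto
  have idm: "(\<lambda>x. x) \<in> measurable \<nu> borel"
    using sb sp by (intro measurableI) auto
  define M where "M = distr \<nu> borel (\<lambda>x. x)"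
  have fM: "finite_measure M" unfolding M_def by (rule finite_measure_distr[OF idm])
  have mM: "measure M A = measure \<nu> (A \<inter> {0..1})" if "A \<in> sets borel" for A
    unfolding M_def using measure_distr[OF idm that] by (simp add: sp vimage_def Int_def)
  define N where "N = real (card P)"
  have P1: "1 \<le> card P" using P_props(1) P_nonempty by (simp add: Suc_le_eq card_gt_0_iff)
  have N1: "1 \<le> N" using P1 by (simp add: N_def)
  define k where "k = real (card \<alpha>)"
  have k1: "1 \<le> k" using card_\<alpha>_pos by (simp add: k_def)
  have "entropy_wrt_partition \<nu> f \<alpha> \<le> ln N + 2 * \<epsilon>" if \<epsilon>: "0 < \<epsilon>" for \<epsilon>
  proof -
    \<comment> \<open>makes the cost of a correct letter \<open>\<epsilon>\<close>\<close>
    define \<delta> where "\<delta> = 1 - exp (- \<epsilon>)"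
    have d: "0 < \<delta>" "\<delta> < 1" using \<epsilon> by (auto simp: \<delta>_def)
    have l1: "- ln (1 - \<delta>) = \<epsilon>" by (simp add: \<delta>_def)
    define b where "b = - ln (\<delta> / k)"
    have "ln (\<delta> / k) \<le> ln 1" by (subst ln_le_cancel_iff) (use d k1 in \<open>auto simp: divide_le_eq\<close>)
    then have b0: "0 \<le> b" by (simp add: b_def)
    \<comment> \<open>misread letters cost \<open>b\<close> each and have probability at most \<open>k * r\<close>, altogether at most \<open>\<epsilon>\<close>\<close>
    define r where "r = \<epsilon> / (k * (b + 1))"
    have r: "0 < r" using \<epsilon> k1 b0 by (simp add: r_def)
    have "\<forall>A\<in>\<alpha>. \<exists>E B. finite E \<and> cut_saturated E B \<and> B \<in> sets borel \<and> measure M (sym_diff A B) < r"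
      using borel_approx_saturated[OF fM _ _ r] \<alpha>(2) sb by (auto simp: M_def)
    then obtain E B where EB: "\<And>A. A \<in> \<alpha> \<Longrightarrow> finite (E A)" "\<And>A. A \<in> \<alpha> \<Longrightarrow> cut_saturated (E A) (B A)"
      "\<And>A. A \<in> \<alpha> \<Longrightarrow> B A \<in> sets borel" "\<And>A. A \<in> \<alpha> \<Longrightarrow> measure M (sym_diff A (B A)) < r" by metis
    define E' where "E' = ((\<Union>A\<in>\<alpha>. E A) \<inter> {0..1}) \<union> cuts"
    have E': "finite E'" "cuts \<subseteq> E'" "E' \<subseteq> {0..1}"
      using EB(1) \<alpha>(1) finite_cuts by (auto simp: E'_def cuts_def)
    have sat: "cut_saturated E' (B A \<inter> {0..1})" if A: "A \<in> \<alpha>" for A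
      unfolding cut_saturated_def
    proof (intro allI impI)
      fix x y :: real assume xy: "x \<le> y" "E' \<inter> {x..y} = {}"
      have c01: "0 \<in> cuts" "1 \<in> cuts"
      proof -
        have "\<Union>P \<subseteq> {0<..<1}" using branch_subset(1) by (rule Union_least)
        then show "0 \<in> cuts" "1 \<in> cuts" unfolding cuts_def by auto
      qed
      show "(x \<in> B A \<inter> {0..1}) = (y \<in> B A \<inter> {0..1})"
      proof (cases "x \<in> {0..1} \<and> y \<in> {0..1}")
        case True
        then have "{x..y} \<subseteq> {0..1}" by auto
        then have "E A \<inter> {x..y} = {}" using xy(2) A unfolding E'_def by blast
        then show ?thesis using EB(2)[OF A] xy(1) True unfolding cut_saturated_def by blast
      next
        case False
        have "x \<notin> {0..1} \<and> y \<notin> {0..1}"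
        proof -
          have "0 \<notin> {x..y}" "1 \<notin> {x..y}" using c01 xy(2) E'(2) by blast+
          then show ?thesis using xy(1) False by auto
        qed
        then show ?thesis by blast
      qed
    qed
    have "\<alpha> \<noteq> {}" using card_\<alpha>_pos by auto
    then obtain A0 where A0: "A0 \<in> \<alpha>" by blast
    define T where "T = (\<lambda>x. {A \<in> \<alpha>. x \<in> B A \<inter> {0..1}})"
    \<comment> \<open>where the sets \<open>B A\<close> overlap or leave a gap the guess is arbitrary\<close>
    define v where "v = (\<lambda>x. if T x = {} then A0 else (SOME A. A \<in> T x))"
    have v\<alpha>: "v x \<in> \<alpha>" for x
    proof (cases "T x = {}")
      case False
      then have "v x \<in> T x" by (simp add: v_def some_in_eq)
      then show ?thesis unfolding T_def by blast
    qed (simp add: v_def A0)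
    define D where "D = (\<Union>A\<in>\<alpha>. (sym_diff A (B A)) \<inter> {0..1})"
    have Asb: "A \<in> sets borel" if "A \<in> \<alpha>" for A using that \<alpha>(2) sb by blast
    have Ds: "(sym_diff A (B A)) \<inter> {0..1} \<in> sets \<nu>" if "A \<in> \<alpha>" for A
      unfolding sb using Asb[OF that] EB(3)[OF that] by auto
    have DS: "D \<in> sets \<nu>" unfolding D_def by (rule sets.finite_UN[OF \<alpha>(1) Ds])
    have sub: "{x \<in> space \<nu>. v x \<noteq> atom x} \<subseteq> D"
    proof (rule subsetI, rule ccontr)
      fix x assume x: "x \<in> {x \<in> space \<nu>. v x \<noteq> atom x}" and nD: "x \<notin> D"
      have x01: "x \<in> {0..1}" using x sp by simp
      have iff: "x \<in> A \<longleftrightarrow> x \<in> B A" if "A \<in> \<alpha>" for A using nD that x01 unfolding D_def by blast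
      have lx: "atom x \<in> \<alpha>" "x \<in> atom x" using atom_in[of x] x by auto
      have "T x = {atom x}"
      proof (intro equalityI subsetI)
        fix A assume "A \<in> T x"
        then have "A \<in> \<alpha>" "x \<in> A" using iff by (auto simp: T_def)
        then have "atom x = A" by (rule atom_eq)
        then show "A \<in> {atom x}" by simp
      qed (use lx iff x01 in \<open>auto simp: T_def\<close>)
      then have "v x = atom x" by (simp add: v_def)
      then show False using x by simp
    qed
    have \<eta>: "measure \<nu> D \<le> k * r"
    proof -
      have "measure \<nu> D \<le> (\<Sum>A\<in>\<alpha>. measure \<nu> ((sym_diff A (B A)) \<inter> {0..1}))"
        unfolding D_def using Ds \<alpha>(1) by (intro finite_measure_subadditive_finite) auto
      also have "\<dots> \<le> (\<Sum>A\<in>\<alpha>. r)"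
      proof (rule sum_mono)
        fix A assume A: "A \<in> \<alpha>"
        have "measure M (sym_diff A (B A)) = measure \<nu> ((sym_diff A (B A)) \<inter> {0..1})"
          by (rule mM) (use Asb[OF A] EB(3)[OF A] in auto)
        then show "measure \<nu> ((sym_diff A (B A)) \<inter> {0..1}) \<le> r" using EB(4)[OF A] by simp
      qed
      finally show ?thesis by (simp add: k_def)
    qed
    have \<kappa>: "- ln (1 - \<delta>) - measure \<nu> D * ln (\<delta> / k) \<le> 2 * \<epsilon>"
    proof -
      have "measure \<nu> D * b \<le> (k * r) * b" by (rule mult_right_mono[OF \<eta> b0])
      also have "\<dots> = \<epsilon> * (b / (b + 1))" using k1 b0 by (simp add: r_def)
      also have "\<dots> \<le> \<epsilon> * 1" using b0 \<epsilon> by (intro mult_left_mono) (auto simp: divide_le_eq)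
      finally show ?thesis using l1 by (simp add: b_def)
    qed
    define m where "m = real (card E')"
    have bound: "cyl_entropy n / real n \<le> (ln (2 * m + 1) + 2 * ln (real n)) / real n + ln N + 2 * \<epsilon>" if n:
        "1 \<le> n" for n
    proof -
      define S where "S = (\<lambda>x. map (\<lambda>i. v ((f ^^ i) x)) [0..<n]) ` space \<nu>"
      have fA: "finite (all_cuts E' n)" by (rule all_cuts_card(1)[OF E'])
      have cimg: "cut_code (all_cuts E' n) ` {0..1} \<subseteq> {..2 * card (all_cuts E' n)}"
        using cut_code_le[OF fA] by auto
      have "card S \<le> card (cut_code (all_cuts E' n) ` {0..1})"
        unfolding S_def sp
      proof (rule card_image_factor)
        show "finite (cut_code (all_cuts E' n) ` {0..1})" by (rule finite_subset[OF cimg]) simp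
        fix x y :: real assume xy: "x \<in> {0..1}" "y \<in> {0..1}" "cut_code (all_cuts E' n) x = cut_code (all_cuts E' n) y"
        have "v ((f ^^ i) x) = v ((f ^^ i) y)" if "i < n" for i
        proof -
          have "T ((f ^^ i) x) = T ((f ^^ i) y)"
            unfolding T_def using saturated_iter[OF E'(2,3) fA xy(1,2) that xy(3) sat] by blast
          then show ?thesis by (simp add: v_def)
        qed
        then show "map (\<lambda>i. v ((f ^^ i) x)) [0..<n] = map (\<lambda>i. v ((f ^^ i) y)) [0..<n]" by simp
      qed
      also have "\<dots> \<le> card {..2 * card (all_cuts E' n)}" by (rule card_mono[OF _ cimg]) simp
      also have "\<dots> \<le> 2 * (n * (card P ^ n * (card E' * n))) + 1" using all_cuts_card(2)[OF E', of n] by simp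
      also have "\<dots> \<le> (2 * card E' + 1) * (n ^ 2 * card P ^ n)"
        using n P1 by (simp add: power2_eq_square algebra_simps)
      finally have cS: "real (card S) \<le> (2 * m + 1) * (real n ^ 2 * N ^ n)"
        unfolding m_def N_def by (metis (mono_tags, lifting) of_nat_1 of_nat_add of_nat_le_iff of_nat_mult
            of_nat_numeral of_nat_power)
      have "space \<nu> \<noteq> {}" using not_empty .
      moreover have "finite S"
        using v\<alpha> unfolding S_def by (intro finite_subset[OF _ finite_words[of n]]) (auto simp: words_def)
      ultimately have "0 < card S" by (simp add: S_def card_gt_0_iff)
      then have "ln (real (card S)) \<le> ln ((2 * m + 1) * (real n ^ 2 * N ^ n))"
        using cS by (subst ln_le_cancel_iff) auto
      also have "\<dots> = ln (2 * m + 1) + (2 * ln (real n) + real n * ln N)"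
      proof -
        have "m \<ge> 0" by (simp add: m_def)
        then show ?thesis using n N1 by (simp add: ln_mult ln_realpow)
      qed
      finally have lS: "ln (real (card S)) \<le> ln (2 * m + 1) + (2 * ln (real n) + real n * ln N)" .
      have "cyl_entropy n \<le> ln (real (card S)) + real n * (- ln (1 - \<delta>) - measure \<nu> D * ln (\<delta> / real (card \<alpha>)))"
        unfolding S_def by (rule cyl_entropy_le_itineraries[OF d v\<alpha> DS sub])
      also have "\<dots> \<le> ln (2 * m + 1) + (2 * ln (real n) + real n * ln N) + real n * (2 * \<epsilon>)"
        using lS \<kappa> by (intro add_mono mult_left_mono) (auto simp: k_def)
      finally have "cyl_entropy n / real n \<le> (ln (2 * m + 1) + (2 * ln (real n) + real n * ln N) + real n *
          (2 * \<epsilon>)) / real n"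
        by (rule divide_right_mono) simp
      also have "\<dots> = (ln (2 * m + 1) + 2 * ln (real n)) / real n + ln N + 2 * \<epsilon>"
        using n by (simp add: field_simps)
      finally show ?thesis .
    qed
    have lim: "(\<lambda>n. (ln (2 * m + 1) + 2 * ln (real n)) / real n + ln N + 2 * \<epsilon>) \<longlonglongrightarrow> 0 + ln N + 2 * \<epsilon>"
    proof (intro tendsto_add tendsto_const)
      have "(\<lambda>n. ln (2 * m + 1) / real n + 2 * (ln (real n) / real n)) \<longlonglongrightarrow> 0 + 2 * 0"
        by (intro tendsto_add tendsto_mult tendsto_const lim_const_over_n lim_ln_over_n)
      then show "(\<lambda>n. (ln (2 * m + 1) + 2 * ln (real n)) / real n) \<longlonglongrightarrow> 0"
        by (simp add: add_divide_distrib)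
    qed
    have "entropy_wrt_partition \<nu> f \<alpha> \<le> 0 + ln N + 2 * \<epsilon>"
      by (rule LIMSEQ_le[OF entropy_LIMSEQ lim]) (use bound in auto)
    then show ?thesis by simp
  qed
  then have "entropy_wrt_partition \<nu> f \<alpha> \<le> ln N + e" if "0 < e" for e
    using that by (metis add_divide_distrib field_sum_of_halves half_gt_zero mult_2)
  then show ?thesis unfolding N_def by (rule field_le_epsilon)
qed

end

section \<open>The balanced measure\<close>

text \<open>
  Continued with slope 1 to both sides instead of being clamped, \<open>\<phi>\<close> becomes a monotone map onto
  the line, and such maps are continuous.
\<close>

lemma clamp_mono_continuous:
  fixes \<phi> :: "real \<Rightarrow> real"
  assumes ab: "a < b" and lo: "\<And>x. x \<le> a \<Longrightarrow> \<phi> x = 0" and hi: "\<And>x. b \<le> x \<Longrightarrow> \<phi> x = 1"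
    and mono: "\<And>x y. a < x \<Longrightarrow> x \<le> y \<Longrightarrow> y < b \<Longrightarrow> \<phi> x \<le> \<phi> y"
    and onto: "\<phi> ` {a<..<b} = {0<..<1}"
  shows "continuous_on UNIV \<phi>" "x \<le> y \<Longrightarrow> \<phi> x \<le> \<phi> y" "\<phi> x \<in> {0..1}"
proof -
  define \<psi> where "\<psi> = (\<lambda>x. if x \<le> a then x - a else if b \<le> x then x - b + 1 else \<phi> x)"
  have in01: "\<phi> x \<in> {0<..<1}" if "a < x" "x < b" for x using onto that by auto
  have m: "\<psi> x \<le> \<psi> y" if xy: "x \<le> y" for x y
  proof -
    consider "x \<le> a" "y \<le> a" | "x \<le> a" "a < y" "y < b" | "x \<le> a" "b \<le> y" | "a < x" "y < b" | "a < x" "x < b"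
        "b \<le> y" | "b \<le> x"
      using xy by linarith
    then show ?thesis
    proof cases
      case 2 then show ?thesis using in01[of y] by (simp add: \<psi>_def)
    next
      case 4 then show ?thesis using mono[of x y] xy by (simp add: \<psi>_def)
    next
      case 5 then show ?thesis using in01[of x] by (simp add: \<psi>_def)
    qed (use xy ab in \<open>simp_all add: \<psi>_def\<close>)
  qed
  have surj: "range \<psi> = UNIV"
  proof -
    have "\<exists>x. \<psi> x = t" for t
    proof -
      consider "t \<le> 0" | "0 < t" "t < 1" | "1 \<le> t" by linarith
      then show ?thesis
      proof cases
        case 1 then show ?thesis by (intro exI[of _ "t + a"]) (simp add: \<psi>_def)
      next
        case 2
        then have "t \<in> \<phi> ` {a<..<b}" using onto by simp
        then obtain x where "t = \<phi> x" "x \<in> {a<..<b}" by (rule imageE)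
        then show ?thesis by (intro exI[of _ x]) (simp add: \<psi>_def)
      next
        case 3 then show ?thesis using ab by (intro exI[of _ "t + b - 1"]) (simp add: \<psi>_def)
      qed
    qed
    then show ?thesis by (metis surjI surj_def UNIV_eq_I rangeI)
  qed
  have c\<psi>: "continuous_on UNIV \<psi>"
    by (rule continuous_onI_mono) (use surj m in auto)
  have eq: "\<phi> = (\<lambda>x. max 0 (min 1 (\<psi> x)))"
  proof
    fix x
    consider "x \<le> a" | "a < x" "x < b" | "b \<le> x" by linarith
    then show "\<phi> x = max 0 (min 1 (\<psi> x))"
    proof cases
      case 1 then show ?thesis by (simp add: \<psi>_def lo)
    next
      case 2 then show ?thesis using in01[of x] by (simp add: \<psi>_def)
    next
      case 3 then show ?thesis using ab by (simp add: \<psi>_def hi)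
    qed
  qed
  show "continuous_on UNIV \<phi>" unfolding eq by (intro continuous_intros c\<psi>)
  show "x \<le> y \<Longrightarrow> \<phi> x \<le> \<phi> y" unfolding eq using m[of x y] by (auto simp: max_def min_def)
  show "\<phi> x \<in> {0..1}" unfolding eq by (simp add: max_def min_def)
qed

text \<open>
  The continuous distribution functions of probability measures on the unit interval.
\<close>

definition unit_cdf :: "(real \<Rightarrow> real) \<Rightarrow> bool" where
  "unit_cdf F \<longleftrightarrow> continuous_on UNIV F \<and> mono F \<and> (\<forall>x\<le>0. F x = 0) \<and> (\<forall>x\<ge>1. F x = 1)"

context full_branch_map
begin

lemma mem_branch: "I \<in> P \<Longrightarrow> x \<in> I \<longleftrightarrow> Inf I < x \<and> x < Sup I"
  using interval(1)[of I] by (metis greaterThanLessThan_iff)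

definition increasing :: "real set \<Rightarrow> bool" where "increasing I \<longleftrightarrow> strict_mono_on I f"

text \<open>
  The branch over \<open>I\<close>, reflected if it decreases, as a nondecreasing map of the line onto the
  closed unit interval.
\<close>

definition branch_coord :: "real set \<Rightarrow> real \<Rightarrow> real" where
  "branch_coord I x = (if x \<le> Inf I then 0 else if Sup I \<le> x then 1 else if increasing I then f x else 1 - f x)"

lemma branch_coord_props:
  assumes I: "I \<in> P"
  shows "continuous_on UNIV (branch_coord I)" "x \<le> y \<Longrightarrow> branch_coord I x \<le> branch_coord I y" "branch_coord I x \<in> {0..1}"
proof -
  note iv = interval[OF I]
  have P: "branch_coord I x = (if increasing I then f x else 1 - f x)" if "Inf I < x" "x < Sup I" for x
    using that by (simp add: branch_coord_def)
  have fI: "f ` {Inf I<..<Sup I} = {0<..<1}"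
    by (simp only: iv(1)[symmetric] branch(3)[OF I])
  have onto: "branch_coord I ` {Inf I<..<Sup I} = {0<..<1}"
  proof (cases "increasing I")
    case True
    have "branch_coord I ` {Inf I<..<Sup I} = f ` {Inf I<..<Sup I}"
      by (rule image_cong[OF refl]) (use True P in auto)
    then show ?thesis using fI by simp
  next
    case False
    have "branch_coord I ` {Inf I<..<Sup I} = (\<lambda>x. 1 - x) ` f ` {Inf I<..<Sup I}"
      unfolding image_image by (rule image_cong[OF refl]) (use False P in auto)
    also note fI
    also have "(\<lambda>x. 1 - x) ` {0<..<1::real} = {0<..<1}"
    proof (intro equalityI subsetI)
      fix x :: real assume "x \<in> {0<..<1}"
      then show "x \<in> (\<lambda>x. 1 - x) ` {0<..<1}" by (intro image_eqI[of _ _ "1 - x"]) auto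
    qed auto
    finally show ?thesis .
  qed
  have m: "branch_coord I x \<le> branch_coord I y" if "Inf I < x" "x \<le> y" "y < Sup I" for x y
  proof (cases "x = y")
    case False
    then have xy: "x < y" "x \<in> I" "y \<in> I" using that mem_branch[OF I] by auto
    show ?thesis
    proof (cases "increasing I")
      case True
      then show ?thesis using monotone_onD[of I "(<)" "(<)" f x y] xy P[of x] P[of y] that by (simp add: increasing_def)
    next
      case False
      then have "strict_antimono_on I f" using branch(1)[OF I] by (simp add: increasing_def)
      then show ?thesis using monotone_onD[of I "(<)" "(>)" f x y] xy P[of x] P[of y] that False by simp
    qed
  qed simp
  have lo: "branch_coord I x = 0" if "x \<le> Inf I" for x using that by (simp add: branch_coord_def)
  have hi: "branch_coord I x = 1" if "Sup I \<le> x" for x using that iv(2) by (simp add: branch_coord_def)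
  note C = clamp_mono_continuous[OF iv(2) lo hi m onto]
  show "continuous_on UNIV (branch_coord I)" by (rule C(1))
  show "x \<le> y \<Longrightarrow> branch_coord I x \<le> branch_coord I y" by (rule C(2))
  show "branch_coord I x \<in> {0..1}" by (rule C(3))
qed

lemma branch_coord_ends:
  assumes I: "I \<in> P"
  shows "x \<le> 0 \<Longrightarrow> branch_coord I x = 0" "1 \<le> x \<Longrightarrow> branch_coord I x = 1"
  using interval(2,4,5)[OF I] by (auto simp: branch_coord_def)

lemma branch_coord_off: "I \<in> P \<Longrightarrow> x \<notin> I \<Longrightarrow> branch_coord I x = 0 \<or> branch_coord I x = 1"
  by (auto simp: branch_coord_def mem_branch)

text \<open>
  If \<open>F\<close> is the distribution function of a measure without atoms and \<open>f\<close> decreases on \<open>I\<close>, this is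
  the distribution function of the reflected measure.
\<close>

definition orient :: "real set \<Rightarrow> (real \<Rightarrow> real) \<Rightarrow> real \<Rightarrow> real" where
  "orient I F u = (if increasing I then F u else 1 - F (1 - u))"

text \<open>
  On distribution functions this is the action \<open>\<mu> \<mapsto> (1/N) \<Sum>I (inv_branch I)\<^sub>* \<mu>\<close>.
\<close>

definition cdf_transfer :: "(real \<Rightarrow> real) \<Rightarrow> real \<Rightarrow> real" where
  "cdf_transfer F x = (\<Sum>I\<in>P. orient I F (branch_coord I x)) / real (card P)"

lemma card_P_pos: "0 < card P"
  using P_props(1) P_nonempty by (simp add: card_gt_0_iff)

lemma orient_ends: "unit_cdf F \<Longrightarrow> orient I F 0 = 0" "unit_cdf F \<Longrightarrow> orient I F 1 = 1"
  by (simp_all add: orient_def unit_cdf_def)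

lemma unit_cdf_transfer:
  assumes F: "unit_cdf F"
  shows "unit_cdf (cdf_transfer F)"
  unfolding unit_cdf_def
proof (intro conjI allI impI)
  have c: "continuous_on UNIV F" and m: "mono F" using F by (auto simp: unit_cdf_def)
  show "continuous_on UNIV (cdf_transfer F)"
    unfolding cdf_transfer_def
  proof (intro continuous_on_divide continuous_on_sum continuous_on_const ballI)
    fix I assume I: "I \<in> P"
    have c1: "continuous_on UNIV (\<lambda>x. F (branch_coord I x))"
      by (rule continuous_on_compose2[OF c branch_coord_props(1)[OF I]]) simp
    have c2: "continuous_on UNIV (\<lambda>x. F (1 - branch_coord I x))"
      by (rule continuous_on_compose2[OF c]) (auto intro!: continuous_intros branch_coord_props(1)[OF I])
    show "continuous_on UNIV (\<lambda>x. orient I F (branch_coord I x))"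
      unfolding orient_def by (cases "increasing I") (auto intro!: continuous_intros c1 c2)
  qed (use card_P_pos in simp)
  show "mono (cdf_transfer F)"
  proof (rule monoI)
    fix x y :: real assume xy: "x \<le> y"
    have "orient I F (branch_coord I x) \<le> orient I F (branch_coord I y)" if I: "I \<in> P" for I
      using branch_coord_props(2)[OF I xy] monoD[OF m, of "branch_coord I x" "branch_coord I y"] monoD[OF m,
          of "1 - branch_coord I y" "1 - branch_coord I x"]
      by (simp add: orient_def)
    then show "cdf_transfer F x \<le> cdf_transfer F y"
      unfolding cdf_transfer_def by (intro divide_right_mono sum_mono) auto
  qed
  show "cdf_transfer F x = 0" if "x \<le> 0" for x
    unfolding cdf_transfer_def using branch_coord_ends(1)[OF _ that] orient_ends(1)[OF F] by simp
  show "cdf_transfer F x = 1" if "1 \<le> x" for x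
    unfolding cdf_transfer_def using branch_coord_ends(2)[OF _ that] orient_ends(2)[OF F] card_P_pos by simp
qed

text \<open>
  For given \<open>x\<close> all summands but the one whose branch contains \<open>x\<close> are evaluated at \<open>0\<close> or \<open>1\<close>,
  where \<open>F\<close> and \<open>G\<close> agree.
\<close>

lemma cdf_transfer_contraction:
  assumes F: "unit_cdf F" and G: "unit_cdf G" and d: "\<And>x. \<bar>F x - G x\<bar> \<le> d"
  shows "\<bar>cdf_transfer F x - cdf_transfer G x\<bar> \<le> d / real (card P)"
proof -
  have d0: "0 \<le> d" using d[of 0] by simp
  have "\<bar>\<Sum>I\<in>P. orient I F (branch_coord I x) - orient I G (branch_coord I x)\<bar> \<le> (\<Sum>I\<in>P. \<bar>orient I F
      (branch_coord I x) - orient I G (branch_coord I x)\<bar>)"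
    by (rule sum_abs)
  also have "\<dots> \<le> (\<Sum>I\<in>P. if x \<in> I then d else 0)"
  proof (rule sum_mono)
    fix I assume I: "I \<in> P"
    show "\<bar>orient I F (branch_coord I x) - orient I G (branch_coord I x)\<bar> \<le> (if x \<in> I then d else 0)"
    proof (cases "x \<in> I")
      case True
      then show ?thesis using d[of "branch_coord I x"] d[of "1 - branch_coord I x"] by (simp add: orient_def
          abs_minus_commute)
    next
      case False
      then show ?thesis using branch_coord_off[OF I False] orient_ends[OF F] orient_ends[OF G] by auto
    qed
  qed
  also have "\<dots> \<le> d"
  proof (cases "\<exists>J\<in>P. x \<in> J")
    case True
    then obtain J where J: "J \<in> P" "x \<in> J" by blast
    have "(\<Sum>I\<in>P. if x \<in> I then d else 0) = (\<Sum>I\<in>P. if I = J then d else 0)"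
      by (rule sum.cong[OF refl]) (use J P_props(2) in \<open>auto simp: disjoint_def\<close>)
    then show ?thesis using J P_props(1) by simp
  next
    case False
    then have "(\<Sum>I\<in>P. if x \<in> I then d else 0) = 0" by (intro sum.neutral) auto
    then show ?thesis using d0 by simp
  qed
  finally have "\<bar>\<Sum>I\<in>P. orient I F (branch_coord I x) - orient I G (branch_coord I x)\<bar> \<le> d" .
  moreover have "cdf_transfer F x - cdf_transfer G x = (\<Sum>I\<in>P. orient I F (branch_coord I x) - orient I G
      (branch_coord I x)) / real (card P)"
    by (simp add: cdf_transfer_def sum_subtractf diff_divide_distrib)
  ultimately show ?thesis using card_P_pos by (simp add: divide_right_mono)
qed

lemma cdf_transfer_fixed_point:
  assumes N: "2 \<le> card P"
  shows "\<exists>F. unit_cdf F \<and> cdf_transfer F = F"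
proof -
  define q where "q = 1 / real (card P)"
  have q: "0 \<le> q" "q < 1" using N by (auto simp: q_def)
  define u where "u = (\<lambda>x::real. max 0 (min 1 x))"
  define A where "A = (\<lambda>n. (cdf_transfer ^^ n) u)"
  have u: "unit_cdf u" unfolding unit_cdf_def u_def by (auto intro!: continuous_intros monoI)
  have A_cdf: "unit_cdf (A n)" for n
    unfolding A_def by (induction n) (auto intro: u unit_cdf_transfer)
  have A01: "0 \<le> A n x" "A n x \<le> 1" for n x
  proof -
    have m: "mono (A n)" "A n 0 = 0" "A n 1 = 1" "\<forall>x\<le>0. A n x = 0" "\<forall>x\<ge>1. A n x = 1" using A_cdf[of n] by
        (auto simp: unit_cdf_def)
    show "0 \<le> A n x" using monoD[OF m(1), of 0 x] m(2,4) by (cases "0 \<le> x") auto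
    show "A n x \<le> 1" using monoD[OF m(1), of x 1] m(3,5) by (cases "x \<le> 1") auto
  qed
  have step: "\<bar>A (Suc n) x - A n x\<bar> \<le> q ^ n" for n x
  proof (induction n arbitrary: x)
    case 0 show ?case using A01[of "Suc 0" x] A01[of 0 x] by (simp add: abs_le_iff)
  next
    case (Suc n)
    have "\<bar>cdf_transfer (A (Suc n)) x - cdf_transfer (A n) x\<bar> \<le> q ^ n / real (card P)"
      by (rule cdf_transfer_contraction[OF A_cdf A_cdf Suc.IH])
    then show ?case by (simp add: A_def q_def)
  qed
  define F where "F = (\<lambda>x. \<Sum>n. A (Suc n) x - A n x)"
  \<comment> \<open>\<open>F\<close> sums the increments of the iterates, so the limit itself is \<open>F + u\<close>\<close>
  define G where "G = (\<lambda>x. F x + u x)"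
  have sq: "summable (\<lambda>n. q ^ n)" using q by (intro summable_geometric) simp
  have unif: "uniform_limit UNIV (\<lambda>n x. \<Sum>i<n. A (Suc i) x - A i x) F sequentially"
    unfolding F_def by (rule Weierstrass_m_test[OF _ sq]) (use step in auto)
  have tele: "(\<Sum>i<n. A (Suc i) x - A i x) = A n x - u x" for n x
    by (induction n) (auto simp: A_def)
  have cF: "continuous_on UNIV F"
  proof (rule uniform_limit_theorem[OF _ unif])
    have "continuous_on UNIV (\<lambda>x. A n x - u x)" for n
      using A_cdf[of n] u by (intro continuous_intros) (auto simp: unit_cdf_def)
    then show "\<forall>\<^sub>F n in sequentially. continuous_on UNIV (\<lambda>x. \<Sum>i<n. A (Suc i) x - A i x)"
      unfolding tele by simp
  qed simp
  have lim: "(\<lambda>n. A n x) \<longlonglongrightarrow> G x" for x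
  proof -
    have "(\<lambda>n. \<Sum>i<n. A (Suc i) x - A i x) \<longlonglongrightarrow> F x" by (rule tendsto_uniform_limitI[OF unif]) simp
    then have "(\<lambda>n. A n x - u x + u x) \<longlonglongrightarrow> F x + u x" unfolding tele by (intro tendsto_add tendsto_const)
    then show ?thesis by (simp add: G_def)
  qed
  have G: "unit_cdf G"
    unfolding unit_cdf_def
  proof (intro conjI allI impI)
    show "continuous_on UNIV G" unfolding G_def using cF u by (intro continuous_intros) (auto simp: unit_cdf_def)
    show "mono G"
    proof (rule monoI)
      fix x y :: real assume "x \<le> y"
      then have "A n x \<le> A n y" for n using A_cdf[of n] by (auto simp: unit_cdf_def mono_def)
      then show "G x \<le> G y" by (intro LIMSEQ_le[OF lim lim]) auto
    qed
    show "G x = 0" if "x \<le> 0" for x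
    proof (rule LIMSEQ_unique[OF lim])
      have "A n x = 0" for n using A_cdf[of n] that by (auto simp: unit_cdf_def)
      then show "(\<lambda>n. A n x) \<longlonglongrightarrow> 0" by simp
    qed
    show "G x = 1" if "1 \<le> x" for x
    proof (rule LIMSEQ_unique[OF lim])
      have "A n x = 1" for n using A_cdf[of n] that by (auto simp: unit_cdf_def)
      then show "(\<lambda>n. A n x) \<longlonglongrightarrow> 1" by simp
    qed
  qed
  have "cdf_transfer G x = G x" for x
  proof (rule LIMSEQ_unique)
    show "(\<lambda>n. A (Suc n) x) \<longlonglongrightarrow> G x" by (rule LIMSEQ_Suc[OF lim])
    have o: "(\<lambda>n. orient I (A n) v) \<longlonglongrightarrow> orient I G v" for I v
      unfolding orient_def by (cases "increasing I") (auto intro!: tendsto_intros lim)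
    have "(\<lambda>n. cdf_transfer (A n) x) \<longlonglongrightarrow> cdf_transfer G x"
      unfolding cdf_transfer_def by (intro tendsto_divide tendsto_sum o tendsto_const) (use card_P_pos in simp)
    then show "(\<lambda>n. A (Suc n) x) \<longlonglongrightarrow> cdf_transfer G x" by (simp add: A_def)
  qed
  then show ?thesis using G by blast
qed

text \<open>
  Within the closure of \<open>I\<close> only the summand of \<open>I\<close> varies.
\<close>

lemma fixed_point_increment:
  assumes F: "unit_cdf F" "cdf_transfer F = F" and I: "I \<in> P" and x: "Inf I \<le> x" "x \<le> y" "y \<le> Sup I"
  shows "F y - F x = (orient I F (branch_coord I y) - orient I F (branch_coord I x)) / real (card P)"
proof -
  have same: "branch_coord J y = branch_coord J x" if J: "J \<in> P" "J \<noteq> I" for J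
  proof -
    have dis: "{Inf J<..<Sup J} \<inter> {Inf I<..<Sup I} = {}"
    proof -
      have "J \<inter> I = {}" using P_props(2) J I unfolding disjoint_def by blast
      then show ?thesis by (simp only: interval(1)[OF J(1), symmetric] interval(1)[OF I, symmetric])
    qed
    have "Sup J \<le> Inf I \<or> Sup I \<le> Inf J"
    proof (rule ccontr)
      assume "\<not> (Sup J \<le> Inf I \<or> Sup I \<le> Inf J)"
      then have "max (Inf I) (Inf J) < min (Sup I) (Sup J)" using interval(2)[OF J(1)] interval(2)[OF I] by auto
      then obtain z where "max (Inf I) (Inf J) < z" "z < min (Sup I) (Sup J)" using dense by blast
      then show False using dis by auto
    qed
    then show ?thesis using x interval(2)[OF J(1)] by (auto simp: branch_coord_def)
  qed
  have "F y - F x = cdf_transfer F y - cdf_transfer F x" by (simp add: F(2))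
  also have "\<dots> = (\<Sum>J\<in>P. orient J F (branch_coord J y) - orient J F (branch_coord J x)) / real (card P)"
    by (simp add: cdf_transfer_def sum_subtractf diff_divide_distrib)
  also have "(\<Sum>J\<in>P. orient J F (branch_coord J y) - orient J F (branch_coord J x)) = (\<Sum>J\<in>{I}. orient J F
      (branch_coord J y) - orient J F (branch_coord J x))"
    by (rule sum.mono_neutral_right) (use P_props(1) I same in auto)
  finally show ?thesis by simp
qed

lemma branch_preimage_borel:
  assumes I: "I \<in> P" and B: "B \<in> sets borel"
  shows "I \<inter> f -` B \<in> sets borel"
proof -
  have "f \<in> borel_measurable (restrict_space borel I)"
    by (rule borel_measurable_continuous_on_restrict[OF branch_cont[OF I]])
  from measurable_sets[OF this B] have "f -` B \<inter> I \<in> sets (restrict_space borel I)"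
    by (simp add: space_restrict_space)
  then have "f -` B \<inter> I \<in> sets borel"
    using branch_subset(3)[OF I] by (subst (asm) sets_restrict_space_iff) auto
  then show ?thesis by (simp add: Int_commute)
qed

lemma branch_preimage_atMost:
  assumes I: "I \<in> P" and t: "t \<in> {0<..<1}"
  shows "increasing I \<Longrightarrow> I \<inter> f -` {..t} = {Inf I<..inv_branch I t}"
    "\<not> increasing I \<Longrightarrow> I \<inter> f -` {..t} = {inv_branch I t..<Sup I}"
proof -
  define y where "y = inv_branch I t"
  have y: "y \<in> I" "f y = t" using inv_branch[OF I t] by (auto simp: y_def)
  have Ii: "x \<in> I \<longleftrightarrow> Inf I < x \<and> x < Sup I" for x by (rule mem_branch[OF I])
  show "I \<inter> f -` {..t} = {Inf I<..inv_branch I t}" if inc: "increasing I"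
  proof -
    have e: "f x \<le> t \<longleftrightarrow> x \<le> y" if x: "x \<in> I" for x
    proof -
      have "x < y \<Longrightarrow> f x < f y" "y < x \<Longrightarrow> f y < f x"
        using monotone_onD[OF inc[unfolded increasing_def] x y(1)] monotone_onD[OF inc[unfolded
            increasing_def] y(1) x] by auto
      then show ?thesis using y(2) by (cases x y rule: linorder_cases) auto
    qed
    show ?thesis unfolding y_def[symmetric]
    proof (intro equalityI subsetI)
      fix x assume x: "x \<in> I \<inter> f -` {..t}"
      then have xI: "x \<in> I" by simp
      then show "x \<in> {Inf I<..y}" using e[OF xI] Ii[of x] x by simp
    next
      fix x assume x: "x \<in> {Inf I<..y}"
      have xI: "x \<in> I" unfolding Ii[of x] using x y(1)[unfolded Ii[of y]] by simp
      then show "x \<in> I \<inter> f -` {..t}" using e[OF xI] x by simp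
    qed
  qed
  show "I \<inter> f -` {..t} = {inv_branch I t..<Sup I}" if inc: "\<not> increasing I"
  proof -
    have a: "strict_antimono_on I f" using inc branch(1)[OF I] unfolding increasing_def by blast
    have e: "f x \<le> t \<longleftrightarrow> y \<le> x" if x: "x \<in> I" for x
    proof -
      have "x < y \<Longrightarrow> f x > f y" "y < x \<Longrightarrow> f y > f x"
        using monotone_onD[OF a x y(1)] monotone_onD[OF a y(1) x] by auto
      then show ?thesis using y(2) by (cases x y rule: linorder_cases) auto
    qed
    show ?thesis unfolding y_def[symmetric]
    proof (intro equalityI subsetI)
      fix x assume x: "x \<in> I \<inter> f -` {..t}"
      then have xI: "x \<in> I" by simp
      then show "x \<in> {y..<Sup I}" using e[OF xI] Ii[of x] x by simp
    next
      fix x assume x: "x \<in> {y..<Sup I}"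
      have xI: "x \<in> I" unfolding Ii[of x] using x y(1)[unfolded Ii[of y]] by simp
      then show "x \<in> I \<inter> f -` {..t}" using e[OF xI] x by simp
    qed
  qed
qed

text \<open>
  The self-similarity that makes \<open>\<mu>\<close> the average of its images under the inverse branches.
\<close>

definition balanced :: "real measure \<Rightarrow> bool" where
  "balanced \<mu> \<longleftrightarrow> prob_space \<mu> \<and> sets \<mu> = sets (restrict_space borel {0..1}) \<and>
     (\<forall>I\<in>P. \<forall>B\<in>sets \<mu>. measure \<mu> (I \<inter> f -` B) = measure \<mu> B / real (card P))"

text \<open>
  The measure whose distribution function is the fixed point. Its continuity makes end points
  negligible, so the balance condition need only be checked on the half lines \<open>{..t}\<close>, which
  generate the Borel sets.
\<close>

lemma balanced_exists:
  assumes N: "2 \<le> card P"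
  shows "\<exists>\<mu>. balanced \<mu>"
proof -
  obtain F where F: "unit_cdf F" "cdf_transfer F = F" using cdf_transfer_fixed_point[OF N] by blast
  have Fc: "continuous_on UNIV F" and Fm: "\<And>x y. x \<le> y \<Longrightarrow> F x \<le> F y"
    and F0: "\<And>x. x \<le> 0 \<Longrightarrow> F x = 0" and F1: "\<And>x. 1 \<le> x \<Longrightarrow> F x = 1"
    using F(1) by (auto simp: unit_cdf_def mono_def)
  have rc: "continuous (at_right a) F" for a
    using Fc by (meson UNIV_I continuous_at_imp_continuous_within continuous_on_eq_continuous_at open_UNIV)
  define M where "M = interval_measure F"
  have sM: "sets M = sets borel" "space M = UNIV" by (simp_all add: M_def)
  have bot: "(F \<longlongrightarrow> 0) at_bot"
    by (rule tendsto_eventually, rule eventually_mono[OF eventually_le_at_bot[of 0]]) (rule F0)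
  have top: "(F \<longlongrightarrow> 1) at_top"
    by (rule tendsto_eventually, rule eventually_mono[OF eventually_ge_at_top[of 1]]) (rule F1)
  interpret M: real_distribution M
    unfolding M_def by (rule real_distribution_interval_measure[OF Fm rc bot top])
  have Ioc: "measure M {a<..b} = F b - F a" if "a \<le> b" for a b
    unfolding M_def by (rule measure_interval_measure_Ioc[OF that Fm rc])
  have single: "measure M {a} = 0" for a
  proof -
    have "emeasure M {a..a} = F a - F a" unfolding M_def by (rule emeasure_interval_measure_Icc[OF _ Fm Fc]) simp
    then show ?thesis by (simp add: measure_def)
  qed
  have Icc: "measure M {a..b} = F b - F a" if "a \<le> b" for a b
  proof -
    have "measure M ({a} \<union> {a<..b}) = measure M {a} + measure M {a<..b}"
      by (rule M.finite_measure_Union) (auto simp: sM)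
    moreover have "{a..b} = {a} \<union> {a<..b}" using that by auto
    ultimately have "measure M {a..b} = measure M {a} + measure M {a<..b}" by (simp only:)
    then show ?thesis using single Ioc[OF that] by simp
  qed
  have Ico: "measure M {a..<b} = F b - F a" if "a \<le> b" for a b
  proof (cases "a = b")
    case False
    have "measure M ({b} \<union> {a..<b}) = measure M {b} + measure M {a..<b}"
      by (rule M.finite_measure_Union) (auto simp: sM)
    moreover have "{a..b} = {b} \<union> {a..<b}" using that by auto
    ultimately have "measure M {a..b} = measure M {b} + measure M {a..<b}" by (simp only:)
    then show ?thesis using single Icc[OF that] by simp
  qed simp
  have Ioo: "measure M {a<..<b} = F b - F a" if "a < b" for a b
  proof -
    have "measure M ({a} \<union> {a<..<b}) = measure M {a} + measure M {a<..<b}"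
      by (rule M.finite_measure_Union) (auto simp: sM)
    moreover have "{a..<b} = {a} \<union> {a<..<b}" using that by auto
    ultimately have "measure M {a..<b} = measure M {a} + measure M {a<..<b}" by (simp only:)
    then show ?thesis using single Ico[of a b] that by simp
  qed
  have Iic: "measure M {..t} = F t" for t
  proof -
    have "measure M {..t} = cdf M t" by (simp add: cdf_def)
    also have "\<dots> = F t"
      unfolding M_def by (subst cdf_interval_measure[OF Fm rc bot]) simp_all
    finally show ?thesis .
  qed
  have unit: "measure M {0..1} = 1" using Icc[of 0 1] F0[of 0] F1[of 1] by simp
  define n where "n = real (card P)"
  have MI: "measure M I = 1 / n" if I: "I \<in> P" for I
  proof -
    have "branch_coord I (Inf I) = 0" "branch_coord I (Sup I) = 1" using interval(2)[OF I] by (auto simp: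
        branch_coord_def)
    then have "F (Sup I) - F (Inf I) = 1 / n"
      using fixed_point_increment[OF F I, of "Inf I" "Sup I"] interval(2)[OF I] orient_ends[OF F(1), of I]
          by (simp add: n_def)
    moreover have "measure M I = F (Sup I) - F (Inf I)"
      using Ioo[OF interval(2)[OF I]] by (simp only: interval(1)[OF I, symmetric])
    ultimately show ?thesis by simp
  qed
  have pre: "I \<inter> f -` B \<in> sets M" if "I \<in> P" "B \<in> sets borel" for I B
    using branch_preimage_borel[OF that] sM by simp
  have star: "measure M (I \<inter> f -` B) = measure M B / n" if I: "I \<in> P" and B: "B \<in> sets borel" for I B
  proof -
    have Bs: "B \<in> sigma_sets UNIV (range (\<lambda>a::real. {..a}))" using B unfolding borel_eq_atMost by simp
    have IS: "Int_stable (range (\<lambda>a::real. {..a}))"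
      by (auto simp: Int_stable_def)
    have G: "range (\<lambda>a::real. {..a}) \<subseteq> Pow UNIV" by simp
    have "B \<in> sets borel \<and> measure M (I \<inter> f -` B) = measure M B / n"
      using IS G Bs
    proof (induction rule: sigma_sets_induct_disjoint)
      case (basic B)
      then obtain t where t: "B = {..t}" by blast
      have "measure M (I \<inter> f -` {..t}) = F t / n"
      proof -
        consider "t \<le> 0" | "1 \<le> t" | "t \<in> {0<..<1}" by fastforce
        then show ?thesis
        proof cases
          case 1
          have "I \<inter> f -` {..t} = {}" using branch_values[OF I] 1 by fastforce
          then show ?thesis using F0[OF 1] by simp
        next
          case 2
          have "I \<inter> f -` {..t} = I" using branch_values[OF I] 2 by fastforce
          then show ?thesis using F1[OF 2] MI[OF I] by simp
        next
          case 3
          define y where "y = inv_branch I t"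
          have y: "y \<in> I" "f y = t" using inv_branch[OF I 3] by (auto simp: y_def)
          have yi: "Inf I < y" "y < Sup I" using y(1) mem_branch[OF I] by auto
          have p0: "branch_coord I (Inf I) = 0" "branch_coord I (Sup I) = 1" using interval(2)[OF I] by
              (auto simp: branch_coord_def)
          show ?thesis
          proof (cases "increasing I")
            case True
            have "measure M (I \<inter> f -` {..t}) = F y - F (Inf I)"
              unfolding branch_preimage_atMost(1)[OF I 3 True] y_def[symmetric] using Ioc yi by simp
            also have "\<dots> = (orient I F (branch_coord I y) - orient I F (branch_coord I (Inf I))) / n"
              unfolding n_def by (rule fixed_point_increment[OF F I]) (use yi in auto)
            also have "\<dots> = F t / n"
              using p0 orient_ends[OF F(1), of I] yi y(2) True by (simp add: branch_coord_def orient_def)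
            finally show ?thesis .
          next
            case False
            have "measure M (I \<inter> f -` {..t}) = F (Sup I) - F y"
              unfolding branch_preimage_atMost(2)[OF I 3 False] y_def[symmetric] using Ico yi by simp
            also have "\<dots> = (orient I F (branch_coord I (Sup I)) - orient I F (branch_coord I y)) / n"
              unfolding n_def by (rule fixed_point_increment[OF F I]) (use yi in auto)
            also have "\<dots> = F t / n"
              using p0 orient_ends[OF F(1), of I] yi y(2) False by (simp add: branch_coord_def orient_def)
            finally show ?thesis .
          qed
        qed
      qed
      then show ?case using t Iic by simp
    next
      case empty
      then show ?case by simp
    next
      case (compl B)
      have "I \<inter> f -` (UNIV - B) = I - (I \<inter> f -` B)" by blast
      then have "measure M (I \<inter> f -` (UNIV - B)) = measure M I - measure M (I \<inter> f -` B)"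
        using M.finite_measure_Diff[of I "I \<inter> f -` B"] pre[OF I, of B] branch_subset(3)[OF I] compl sM by simp
      moreover have "measure M (UNIV - B) = 1 - measure M B"
        using M.prob_compl[of B] compl sM by simp
      ultimately show ?case using compl MI[OF I] by (auto simp: diff_divide_distrib)
    next
      case (union A)
      have Ab: "A i \<in> sets borel" "A i \<in> sets M" for i using union sM by auto
      have "(\<lambda>i. measure M (A i)) sums measure M (\<Union>i. A i)"
        by (rule M.finite_measure_UNION) (use Ab union in auto)
      then have s1: "(\<lambda>i. measure M (A i) / n) sums (measure M (\<Union>i. A i) / n)" by (rule sums_divide)
      have "(\<lambda>i. measure M (I \<inter> f -` A i)) sums measure M (\<Union>i. I \<inter> f -` A i)"
      proof (rule M.finite_measure_UNION)
        show "range (\<lambda>i. I \<inter> f -` A i) \<subseteq> M.events" using pre[OF I Ab(1)] by auto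
        show "disjoint_family (\<lambda>i. I \<inter> f -` A i)" using union unfolding disjoint_family_on_def by blast
      qed
      moreover have "(\<Union>i. I \<inter> f -` A i) = I \<inter> f -` (\<Union>i. A i)" by blast
      ultimately have s2: "(\<lambda>i. measure M (A i) / n) sums measure M (I \<inter> f -` (\<Union>i. A i))" using union by simp
      show ?case using sums_unique2[OF s1 s2] Ab by auto
    qed
    then show ?thesis by simp
  qed
  define \<mu> where "\<mu> = restrict_space M {0..1}"
  have s\<mu>: "sets \<mu> = sets (restrict_space borel {0..1})" unfolding \<mu>_def by (rule sets_restrict_space_cong[OF sM(1)])
  have sb: "A \<in> sets \<mu> \<longleftrightarrow> A \<in> sets borel \<and> A \<subseteq> {0..1}" for A
    unfolding s\<mu> by (subst sets_restrict_space_iff) auto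
  have m\<mu>: "measure \<mu> A = measure M A" if "A \<subseteq> {0..1}" for A
    unfolding \<mu>_def by (rule measure_restrict_space[OF _ that]) (simp add: sM)
  have "balanced \<mu>"
    unfolding balanced_def
  proof (intro conjI ballI)
    show "prob_space \<mu>"
    proof (rule prob_spaceI)
      have "emeasure \<mu> (space \<mu>) = emeasure M {0..1}"
        unfolding \<mu>_def by (subst emeasure_restrict_space) (auto simp: sM space_restrict_space)
      also have "\<dots> = 1" using unit by (simp add: M.emeasure_eq_measure)
      finally show "emeasure \<mu> (space \<mu>) = 1" .
    qed
    show "sets \<mu> = sets (restrict_space borel {0..1})" by (rule s\<mu>)
    fix I B assume I: "I \<in> P" and "B \<in> sets \<mu>"
    then have B: "B \<in> sets borel" "B \<subseteq> {0..1}" using sb by auto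
    have "I \<inter> f -` B \<subseteq> {0..1}" using branch_subset(1)[OF I] by force
    then show "measure \<mu> (I \<inter> f -` B) = measure \<mu> B / real (card P)"
      using star[OF I B(1)] B(2) by (simp add: m\<mu> n_def)
  qed
  then show ?thesis by blast
qed

end

section \<open>Maximal entropy, duality and the spectral decomposition\<close>

context full_branch_map
begin

lemma unit_sets_iff: "A \<in> sets (restrict_space borel {0..1::real}) \<longleftrightarrow> A \<in> sets borel \<and> A \<subseteq> {0..1}"
  by (subst sets_restrict_space_iff) auto

lemma cuts_borel: "cuts \<in> sets borel"
  using finite_cuts by (rule finite_imp_closed[THEN borel_closed])

lemma zero_one_cuts: "0 \<in> cuts" "1 \<in> cuts"
proof -
  have "\<Union>P \<subseteq> {0<..<1}" using branch_subset(1) by (rule Union_least)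
  then show "0 \<in> cuts" "1 \<in> cuts" unfolding cuts_def by auto
qed

lemma preimage_split:
  "f -` B \<inter> {0..1} = (\<Union>I\<in>P. I \<inter> f -` B) \<union> (cuts \<inter> f -` B)"
proof -
  have "\<Union>P \<subseteq> {0..1}" using branch_subset(1) by force
  then show ?thesis unfolding cuts_def by blast
qed

lemma f_measurable:
  assumes s: "sets \<nu> = sets (restrict_space borel {0..1})"
  shows "f \<in> measurable \<nu> \<nu>"
proof (rule measurableI)
  have sp: "space \<nu> = {0..1}" using sets_eq_imp_space_eq[OF s] by (simp add: space_restrict_space)
  show "f x \<in> space \<nu>" if "x \<in> space \<nu>" for x using f_range that sp by simp
  fix B assume "B \<in> sets \<nu>"
  then have B: "B \<in> sets borel" using s unit_sets_iff by blast
  have "finite (cuts \<inter> f -` B)" using finite_cuts by blast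
  then have "cuts \<inter> f -` B \<in> sets borel" by (rule finite_imp_closed[THEN borel_closed])
  moreover have "(\<Union>I\<in>P. I \<inter> f -` B) \<in> sets borel"
    by (rule sets.finite_UN[OF P_props(1)]) (rule branch_preimage_borel[OF _ B])
  ultimately have "f -` B \<inter> {0..1} \<in> sets borel" unfolding preimage_split by (rule sets.Un[rotated])
  then show "f -` B \<inter> space \<nu> \<in> sets \<nu>" unfolding s sp unit_sets_iff by simp
qed

lemma ks_entropy_le:
  assumes "invariant_prob f \<nu>"
  shows "ks_entropy \<nu> f \<le> ereal (ln (real (card P)))"
  unfolding ks_entropy_def
proof (rule SUP_least)
  fix \<alpha> assume "\<alpha> \<in> {\<alpha>. finite \<alpha> \<and> \<alpha> \<subseteq> sets \<nu> \<and> partition_on (space \<nu>) \<alpha>}"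
  then show "ereal (entropy_wrt_partition \<nu> f \<alpha>) \<le> ereal (ln (real (card P)))"
    using entropy_le_ln_card[OF assms] by simp
qed

text \<open>
  Since \<open>ln N\<close> bounds the entropy of all invariant measures, one partition with entropy at least
  \<open>ln N\<close> suffices.
\<close>

lemma max_entropy_measureI:
  assumes inv: "invariant_prob f \<mu>" and \<alpha>: "finite \<alpha>" "\<alpha> \<subseteq> sets \<mu>" "partition_on (space \<mu>) \<alpha>"
    and ent: "ln (real (card P)) \<le> entropy_wrt_partition \<mu> f \<alpha>"
  shows "max_entropy_measure f \<mu>"
proof -
  have "ereal (ln (real (card P))) \<le> ereal (entropy_wrt_partition \<mu> f \<alpha>)" using ent by simp
  also have "\<dots> \<le> ks_entropy \<mu> f"
    unfolding ks_entropy_def by (rule SUP_upper) (use \<alpha> in simp)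
  finally have low: "ereal (ln (real (card P))) \<le> ks_entropy \<mu> f" .
  have "ks_entropy \<mu> f = (SUP \<nu> \<in> {\<nu>. invariant_prob f \<nu>}. ks_entropy \<nu> f)"
  proof (rule antisym)
    show "ks_entropy \<mu> f \<le> (SUP \<nu> \<in> {\<nu>. invariant_prob f \<nu>}. ks_entropy \<nu> f)"
      by (rule SUP_upper) (use inv in simp)
    have "(SUP \<nu> \<in> {\<nu>. invariant_prob f \<nu>}. ks_entropy \<nu> f) \<le> ereal (ln (real (card P)))"
      by (rule SUP_least) (use ks_entropy_le in simp)
    then show "(SUP \<nu> \<in> {\<nu>. invariant_prob f \<nu>}. ks_entropy \<nu> f) \<le> ks_entropy \<mu> f"
      using low by (rule order_trans)
  qed
  then show ?thesis using inv by (simp add: max_entropy_measure_def)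
qed

end

locale balanced_measure = full_branch_map +
  fixes \<mu> :: "real measure"
  assumes bal: "balanced \<mu>"
begin

lemma \<mu>_sets: "sets \<mu> = sets (restrict_space borel {0..1})"
  using bal by (simp only: balanced_def)

lemma \<mu>_space: "space \<mu> = {0..1}"
  using sets_eq_imp_space_eq[OF \<mu>_sets] by (simp add: space_restrict_space)

lemma \<mu>_sets_iff: "A \<in> sets \<mu> \<longleftrightarrow> A \<in> sets borel \<and> A \<subseteq> {0..1}"
  unfolding \<mu>_sets by (rule unit_sets_iff)

sublocale prob_space \<mu>
  using bal by (simp only: balanced_def)

lemma measure_branch_preimage: "I \<in> P \<Longrightarrow> B \<in> sets \<mu> \<Longrightarrow> measure \<mu> (I \<inter> f -` B) = measure \<mu> B / real (card P)"
  using bal by (simp only: balanced_def)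

lemma branch_sets: "I \<in> P \<Longrightarrow> I \<in> sets \<mu>"
  using branch_subset[of I] by (auto simp: \<mu>_sets_iff)

lemma branch_preimage_sets: "I \<in> P \<Longrightarrow> B \<in> sets \<mu> \<Longrightarrow> I \<inter> f -` B \<in> sets \<mu>"
  using branch_preimage_borel[of I B] branch_subset(1)[of I] by (auto simp: \<mu>_sets_iff)

lemma cuts_sets: "cuts \<in> sets \<mu>"
  using cuts_borel by (auto simp: \<mu>_sets_iff cuts_def)

lemma measure_branch: "I \<in> P \<Longrightarrow> measure \<mu> I = 1 / real (card P)"
proof -
  assume I: "I \<in> P"
  have "I \<inter> f -` {0..1} = I" using branch_values[OF I] by force
  then show ?thesis using measure_branch_preimage[OF I sets.top] prob_space by (simp add: \<mu>_space)
qed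

lemma disjoint_branches: "disjoint_family_on (\<lambda>I. I \<inter> A I) P"
  using P_props(2) unfolding disjoint_family_on_def disjoint_def by blast

lemma measure_cuts: "measure \<mu> cuts = 0"
proof -
  have "measure \<mu> (\<Union>I\<in>P. I) = (\<Sum>I\<in>P. measure \<mu> I)"
    using P_props(1) branch_sets disjoint_branches[of "\<lambda>_. UNIV"]
    by (intro finite_measure_finite_Union) auto
  also have "\<dots> = 1" using measure_branch card_P_pos by simp
  finally have U: "measure \<mu> (\<Union>P) = 1" by simp
  have UP: "\<Union>P \<in> sets \<mu>" using P_props(1) branch_sets by (intro sets.finite_Union) auto
  have "cuts = space \<mu> - \<Union>P" by (simp add: cuts_def \<mu>_space)
  then show ?thesis using prob_compl[OF UP] U by simp
qed

lemma AE_not_cut: "AE x in \<mu>. x \<notin> cuts"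
proof -
  have "cuts \<in> null_sets \<mu>" using cuts_sets measure_cuts by (simp add: null_sets_def emeasure_eq_measure)
  then show ?thesis by (rule AE_not_in)
qed

lemma balanced_invariant: "invariant_prob f \<mu>"
  unfolding invariant_prob_def
proof (intro conjI)
  show "prob_space \<mu>" by (rule prob_space_axioms)
  show "sets \<mu> = sets (restrict_space borel {0..1})" by (rule \<mu>_sets)
  show fm: "f \<in> measurable \<mu> \<mu>" by (rule f_measurable[OF \<mu>_sets])
  show "distr \<mu> \<mu> f = \<mu>"
  proof (rule measure_eqI)
    fix B assume "B \<in> sets (distr \<mu> \<mu> f)"
    then have B: "B \<in> sets \<mu>" by simp
    have c: "cuts \<inter> f -` B \<in> sets \<mu>"
    proof -
      have "finite (cuts \<inter> f -` B)" using finite_cuts by blast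
      then have "cuts \<inter> f -` B \<in> sets borel" by (rule finite_imp_closed[THEN borel_closed])
      then show ?thesis by (auto simp: \<mu>_sets_iff cuts_def)
    qed
    have c0: "measure \<mu> (cuts \<inter> f -` B) = 0"
      using finite_measure_mono[of "cuts \<inter> f -` B" cuts] cuts_sets measure_cuts measure_nonneg[of \<mu> "cuts \<inter>
          f -` B"] by simp
    have U: "(\<Union>I\<in>P. I \<inter> f -` B) \<in> sets \<mu>"
      by (rule sets.finite_UN[OF P_props(1)]) (rule branch_preimage_sets[OF _ B])
    have "measure \<mu> (f -` B \<inter> {0..1}) = measure \<mu> (\<Union>I\<in>P. I \<inter> f -` B) + measure \<mu> (cuts \<inter> f -` B)"
      unfolding preimage_split by (rule finite_measure_Union[OF U c]) (auto simp: cuts_def)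
    also have "measure \<mu> (\<Union>I\<in>P. I \<inter> f -` B) = (\<Sum>I\<in>P. measure \<mu> (I \<inter> f -` B))"
      by (rule finite_measure_finite_Union[OF P_props(1) _ disjoint_branches]) (use branch_preimage_sets[OF
          _ B] in blast)
    also have "\<dots> = measure \<mu> B" using measure_branch_preimage[OF _ B] card_P_pos by simp
    finally have "measure \<mu> (f -` B \<inter> space \<mu>) = measure \<mu> B" using c0 by (simp add: \<mu>_space)
    then show "emeasure (distr \<mu> \<mu> f) B = emeasure \<mu> B"
      by (simp add: emeasure_distr[OF fm B] emeasure_eq_measure)
  qed simp
qed

text \<open>
  By the balance condition a word of \<open>n\<close> branches has probability \<open>N\<^sup>-\<^sup>n\<close>. These words have total
  mass 1, so the words that contain \<open>cuts\<close> have mass 0 and the entropy at time \<open>n\<close> is exactly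
  \<open>n ln N\<close>.
\<close>

lemma entropy_branch_partition:
  shows "finite (insert cuts P)" "insert cuts P \<subseteq> sets \<mu>" "partition_on (space \<mu>) (insert cuts P)"
    "entropy_wrt_partition \<mu> f (insert cuts P) = ln (real (card P))"
proof -
  show fin: "finite (insert cuts P)" using P_props(1) by simp
  show sub: "insert cuts P \<subseteq> sets \<mu>" using cuts_sets branch_sets by blast
  have UP: "\<Union>P \<subseteq> {0..1}" using branch_subset(1) by force
  show part: "partition_on (space \<mu>) (insert cuts P)"
  proof (rule partition_onI)
    show "\<Union> (insert cuts P) = space \<mu>" using UP by (auto simp: cuts_def \<mu>_space)
    show "{} \<notin> insert cuts P"
      using zero_one_cuts(1) inv_branch(1)[of "{}" "1/2"] by auto
    show "disjnt A B" if "A \<in> insert cuts P" "B \<in> insert cuts P" "A \<noteq> B" for A B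
    proof -
      have "A \<inter> B = {}" using that P_props(2) unfolding disjoint_def cuts_def by blast
      then show ?thesis by (simp add: disjnt_def)
    qed
  qed
  interpret S: finite_partition_system \<mu> f "insert cuts P"
    by (intro finite_partition_system.intro finite_partition_system_axioms.intro fin sub part prob_space_axioms)
       (use balanced_invariant in \<open>simp_all only: invariant_prob_def\<close>)
  define n where "n = real (card P)"
  have n0: "n > 0" using card_P_pos by (simp add: n_def)
  have pr_Cons: "S.cyl_prob (Suc k) (I # w) = S.cyl_prob k w / n" if I: "I \<in> P" for k I w
  proof -
    have s: "{x \<in> space \<mu>. S.itinerary k x = w} \<in> sets \<mu>" by (rule S.cyl_sets)
    have it: "S.itinerary (Suc k) x = S.atom x # S.itinerary k (f x)" for x
      using S.itinerary_add[of 1 k x] by (simp add: S.itinerary_def)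
    have "{x \<in> space \<mu>. S.itinerary (Suc k) x = I # w} = I \<inter> f -` {x \<in> space \<mu>. S.itinerary k x = w}"
    proof (intro equalityI subsetI)
      fix x assume x: "x \<in> {x \<in> space \<mu>. S.itinerary (Suc k) x = I # w}"
      then have "S.atom x = I" "S.itinerary k (f x) = w" by (simp_all add: it)
      moreover have "x \<in> S.atom x" using x S.atom_in(2) by blast
      moreover have "f x \<in> space \<mu>" using x f_range by (simp add: \<mu>_space)
      ultimately show "x \<in> I \<inter> f -` {x \<in> space \<mu>. S.itinerary k x = w}" by simp
    next
      fix x assume x: "x \<in> I \<inter> f -` {x \<in> space \<mu>. S.itinerary k x = w}"
      have "S.atom x = I" by (rule S.atom_eq) (use I x in auto)
      moreover have "x \<in> space \<mu>" using x I UP by (auto simp: \<mu>_space)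
      ultimately show "x \<in> {x \<in> space \<mu>. S.itinerary (Suc k) x = I # w}" using x by (simp add: it)
    qed
    then show ?thesis unfolding S.cyl_prob_def n_def using measure_branch_preimage[OF I s] by simp
  qed
  define W where "W = (\<lambda>k::nat. {w. set w \<subseteq> P \<and> length w = k})"
  have Wsub: "W k \<subseteq> S.words k" for k unfolding W_def S.words_def by auto
  have Wcard: "real (card (W k)) = n ^ k" for k
    unfolding W_def n_def by (simp add: card_lists_length_eq[OF P_props(1)])
  have pr_W: "S.cyl_prob k w = (1 / n) ^ k" if "w \<in> W k" for k w
    using that
  proof (induction k arbitrary: w)
    case 0
    then have "w = []" by (simp add: W_def)
    moreover have "S.words 0 = {[]}" by (auto simp: S.words_def)
    ultimately show ?case using S.cyl_prob_sum[of 0] by simp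
  next
    case (Suc k)
    then obtain I v where w: "w = I # v" "I \<in> P" "v \<in> W k" by (cases w) (auto simp: W_def)
    then show ?case using pr_Cons[OF w(2), of k v] Suc.IH[OF w(3)] by simp
  qed
  have ent: "S.cyl_entropy k = real k * ln n" for k
  proof -
    have sW: "(\<Sum>w\<in>W k. S.cyl_prob k w) = 1"
      using pr_W[of _ k] Wcard[of k] n0 by (simp add: power_one_over)
    have "(\<Sum>w\<in>S.words k - W k. S.cyl_prob k w) = 0"
      using sum_diff[OF S.finite_words Wsub, of "S.cyl_prob k"] sW S.cyl_prob_sum[of k] by simp
    then have z: "S.cyl_prob k w = 0" if "w \<in> S.words k - W k" for w
      using that sum_nonneg_eq_0_iff[of "S.words k - W k" "S.cyl_prob k"] S.finite_words[of k] S.cyl_prob_nonneg by auto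
    have "(\<Sum>w\<in>S.words k. S.cyl_prob k w * ln (S.cyl_prob k w)) = (\<Sum>w\<in>W k. S.cyl_prob k w * ln (S.cyl_prob k w))"
      by (rule sum.mono_neutral_right[OF S.finite_words Wsub]) (use z in simp)
    also have "\<dots> = (\<Sum>w\<in>W k. S.cyl_prob k w * (- real k * ln n))"
    proof (rule sum.cong[OF refl])
      fix w assume "w \<in> W k"
      then have "ln (S.cyl_prob k w) = - real k * ln n"
        using pr_W n0 by (simp add: ln_realpow ln_div)
      then show "S.cyl_prob k w * ln (S.cyl_prob k w) = S.cyl_prob k w * (- real k * ln n)" by simp
    qed
    also have "\<dots> = - real k * ln n" unfolding sum_distrib_right[symmetric] sW by simp
    finally show ?thesis by (simp add: S.cyl_entropy_def)
  qed
  have "(\<lambda>k. S.cyl_entropy k / real k) \<longlonglongrightarrow> ln n"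
  proof (rule tendsto_eventually)
    show "\<forall>\<^sub>F k in sequentially. S.cyl_entropy k / real k = ln n"
      unfolding ent by (rule eventually_sequentiallyI[of 1]) simp
  qed
  then show "entropy_wrt_partition \<mu> f (insert cuts P) = ln (real (card P))"
    using LIMSEQ_unique[OF S.entropy_LIMSEQ] by (simp add: n_def)
qed

lemma balanced_max_entropy: "max_entropy_measure f \<mu>"
  by (rule max_entropy_measureI[OF balanced_invariant entropy_branch_partition(1-3)])
     (simp add: entropy_branch_partition(4))

text \<open>
  The balance condition says that \<open>\<mu>\<close>, normalised on the branch \<open>I\<close>, is mapped to \<open>\<mu>\<close> by \<open>f\<close>.
\<close>

lemma integral_branch:
  fixes k :: "real \<Rightarrow> complex"
  assumes I: "I \<in> P" and k: "k \<in> borel_measurable \<mu>"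
  shows "(\<integral>x. k x \<partial>\<mu>) = of_nat (card P) * (\<integral>x. indicator I x *\<^sub>R k (f x) \<partial>\<mu>)"
proof -
  define n where "n = real (card P)"
  have n0: "n > 0" using card_P_pos by (simp add: n_def)
  have fm: "f \<in> measurable \<mu> \<mu>" by (rule f_measurable[OF \<mu>_sets])
  have Im: "I \<in> sets \<mu>" by (rule branch_sets[OF I])
  \<comment> \<open>\<open>\<mu>\<close> restricted to the branch and normalised\<close>
  define M where "M = density \<mu> (\<lambda>x. ennreal (n * indicator I x))"
  have fM: "f \<in> measurable M \<mu>" using fm by (simp add: M_def)
  have "distr M \<mu> f = \<mu>"
  proof (rule measure_eqI)
    fix B assume "B \<in> sets (distr M \<mu> f)"
    then have B: "B \<in> sets \<mu>" by simp
    have fB: "f -` B \<inter> space \<mu> \<in> sets \<mu>" by (rule measurable_sets[OF fm B])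
    have IB: "I \<inter> f -` B \<in> sets \<mu>" by (rule branch_preimage_sets[OF I B])
    have "emeasure (distr M \<mu> f) B = emeasure M (f -` B \<inter> space \<mu>)"
      using emeasure_distr[OF fM B] by (simp add: M_def)
    also have "\<dots> = (\<integral>\<^sup>+x. ennreal (n * indicator I x) * indicator (f -` B \<inter> space \<mu>) x \<partial>\<mu>)"
      unfolding M_def by (rule emeasure_density) (use Im fB in auto)
    also have "\<dots> = (\<integral>\<^sup>+x. ennreal n * indicator (I \<inter> f -` B) x \<partial>\<mu>)"
      by (rule nn_integral_cong) (auto simp: indicator_def)
    also have "\<dots> = ennreal n * emeasure \<mu> (I \<inter> f -` B)" by (rule nn_integral_cmult_indicator[OF IB])
    also have "\<dots> = emeasure \<mu> B"
      using measure_branch_preimage[OF I B] n0 by (simp add: emeasure_eq_measure n_def[symmetric]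
          ennreal_mult[symmetric])
    finally show "emeasure (distr M \<mu> f) B = emeasure \<mu> B" .
  qed (simp)
  then have "(\<integral>x. k x \<partial>\<mu>) = (\<integral>x. k x \<partial>distr M \<mu> f)" by simp
  also have "\<dots> = (\<integral>x. k (f x) \<partial>M)" by (rule integral_distr[OF fM k])
  also have "\<dots> = (\<integral>x. (n * indicator I x) *\<^sub>R k (f x) \<partial>\<mu>)"
    unfolding M_def
    by (rule integral_density) (use Im n0 measurable_compose[OF fm k] in auto)
  also have "\<dots> = (\<integral>x. n *\<^sub>R (indicator I x *\<^sub>R k (f x)) \<partial>\<mu>)" by simp
  also have "\<dots> = n *\<^sub>R (\<integral>x. indicator I x *\<^sub>R k (f x) \<partial>\<mu>)" by (rule integral_scaleR_right)
  finally show ?thesis by (simp add: n_def scaleR_conv_of_real)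
qed

end

lemma W11_integrable:
  assumes M: "prob_space M" and s: "sets M = sets (restrict_space borel {0..1})" and h: "h \<in> W11"
  shows "h \<in> borel_measurable M" "integrable M h"
proof -
  interpret prob_space M by fact
  have "h \<in> borel_measurable (restrict_space borel {0..1})"
    by (rule borel_measurable_continuous_on_restrict[OF W11D(1)[OF h]])
  then show m: "h \<in> borel_measurable M" using measurable_cong_sets[OF s refl] by blast
  show "integrable M h"
    by (rule integrable_const_bound[OF _ m]) (rule AE_I2, rule norm_le_W11_norm[OF h])
qed

lemma integral_one_W11:
  assumes M: "prob_space M" and s: "sets M = sets (restrict_space borel {0..1})"
  shows "(\<integral>x. one_W11 x \<partial>M) = 1"
proof -
  interpret prob_space M by fact
  have sp: "space M = {0..1}" using sets_eq_imp_space_eq[OF s] by (simp add: space_restrict_space)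
  have "(\<integral>x. one_W11 x \<partial>M) = (\<integral>x. 1 \<partial>M)"
    by (rule Bochner_Integration.integral_cong[OF refl]) (use one_W11_eq(1) in \<open>simp add: sp\<close>)
  then show ?thesis by (simp add: prob_space)
qed

text \<open>
  The value at \<open>x\<close> is the mean of the differences \<open>h x - h y\<close>.
\<close>

lemma norm_le_var_of_mean_zero:
  assumes M: "prob_space M" and s: "sets M = sets (restrict_space borel {0..1})" and h: "h \<in> W11"
    and z: "(\<integral>x. h x \<partial>M) = 0" and x: "x \<in> {0..1}"
  shows "norm (h x) \<le> w11_var h"
proof -
  interpret prob_space M by fact
  have sp: "space M = {0..1}" using sets_eq_imp_space_eq[OF s] by (simp add: space_restrict_space)
  have i: "integrable M h" by (rule W11_integrable(2)[OF M s h])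
  have mean: "(\<integral>y. h x - h y \<partial>M) = h x"
    using z by (subst Bochner_Integration.integral_diff[OF _ i]) (auto simp: prob_space)
  have "norm (h x) \<le> (\<integral>y. norm (h x - h y) \<partial>M)"
    using integral_norm_bound[of M "\<lambda>y. h x - h y"] unfolding mean .
  also have "\<dots> \<le> (\<integral>y. w11_var h \<partial>M)"
  proof (rule integral_mono)
    show "integrable M (\<lambda>y. norm (h x - h y))" by (intro integrable_norm Bochner_Integration.integrable_diff i) simp
    show "norm (h x - h y) \<le> w11_var h" if "y \<in> space M" for y
      using norm_diff_le_w11_var[OF h x] that sp by simp
  qed simp
  also have "\<dots> = w11_var h" by (simp add: prob_space)
  finally show ?thesis .
qed

context full_branch_map
begin

lemma inv_branch_cont:
  assumes I: "I \<in> P"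
  shows "continuous_on {0<..<1} (inv_branch I)"
  using continuous_on_inverse_open[OF branch_subset(2)[OF I] branch_cont[OF I] _ inv_branch_f[OF I]]
  by (simp add: branch(3)[OF I])

text \<open>
  Covers both the balanced measure and the unit mass at a fixed point: they share the duality with
  \<open>L0\<close>.
\<close>

lemma spectral_decomposition:
  assumes L: "\<forall>h\<in>W11. L0 f P h \<in> W11"
    and ps: "prob_space \<mu>" and s: "sets \<mu> = sets (restrict_space borel {0..1})"
    and dual: "\<And>h. h \<in> W11 \<Longrightarrow> (\<integral>x. L0 f P h x \<partial>\<mu>) = of_nat (card P) * (\<integral>x. h x \<partial>\<mu>)"
  shows "\<exists>Q. bounded_operator_on W11 W11_norm Q \<and>
           (\<forall>h\<in>W11. L0 f P h = (\<lambda>x. of_nat (card P) * (\<integral>y. h y \<partial>\<mu>) * one_W11 x + Q h x)) \<and>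
           Q one_W11 = (\<lambda>x. 0) \<and> (\<forall>h\<in>W11. (\<integral>y. Q h y \<partial>\<mu>) = 0) \<and>
           spectrum_on W11 W11_norm Q \<subseteq> {z. norm z \<le> 1}"
proof -
  define Nc where "Nc = (of_nat (card P) :: complex)"
  define m where "m = (\<lambda>h :: real \<Rightarrow> complex. \<integral>y. h y \<partial>\<mu>)"
  define Q where "Q = (\<lambda>h x. L0 f P h x - Nc * m h * one_W11 x)"
  have LW: "L0 f P h \<in> W11" if "h \<in> W11" for h using L that by blast
  have int: "integrable \<mu> h" if "h \<in> W11" for h by (rule W11_integrable(2)[OF ps s that])
  have m1: "m one_W11 = 1" unfolding m_def by (rule integral_one_W11[OF ps s])
  have m_lin: "m (\<lambda>x. a * g x + b * h x) = a * m g + b * m h" if "g \<in> W11" "h \<in> W11" for a b g h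
    unfolding m_def using int[OF that(1)] int[OF that(2)] by simp
  have QW: "Q h \<in> W11" if "h \<in> W11" for h
    unfolding Q_def by (rule W11_diff[OF LW[OF that] W11_scale[OF one_W11_in]])
  have Qlin: "Q (\<lambda>x. a * g x + b * h x) = (\<lambda>x. a * Q g x + b * Q h x)" if "g \<in> W11" "h \<in> W11" for a b g h
    unfolding Q_def L0_lincomb[OF L that] m_lin[OF that] by (simp add: algebra_simps)
  have mQ: "m (Q h) = 0" if "h \<in> W11" for h
  proof -
    have "Q h = (\<lambda>x. 1 * L0 f P h x + (- Nc * m h) * one_W11 x)" by (simp add: Q_def)
    then have "m (Q h) = m (L0 f P h) - Nc * m h * m one_W11"
      using m_lin[OF LW[OF that] one_W11_in, of 1 "- Nc * m h"] by simp
    then show ?thesis using dual[OF that] m1 by (simp add: m_def Nc_def)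
  qed
  have var: "w11_var (Q h) \<le> w11_var h" if h: "h \<in> W11" for h
  proof (rule order_trans[OF _ w11_var_L0[OF L h]])
    show "w11_var (Q h) \<le> w11_var (L0 f P h)"
    proof (rule w11_var_le_closed[OF QW[OF h]])
      have "var_bound {0..1} (Q h) (w11_var (L0 f P h)) \<longleftrightarrow> var_bound {0..1} (L0 f P h) (w11_var (L0 f P h))"
        by (rule var_bound_cong) (simp add: Q_def one_W11_eq(1))
      then show "var_bound {0..1} (Q h) (w11_var (L0 f P h))" using var_bound_w11_var[OF LW[OF h]] by blast
    qed
  qed
  have nQ: "W11_norm (Q h) \<le> 2 * w11_var (Q h)" if h: "h \<in> W11" for h
  proof -
    have "norm (Q h x) \<le> w11_var (Q h)" if "x \<in> {0<..<1}" for x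
      by (rule norm_le_var_of_mean_zero[OF ps s QW[OF h]]) (use mQ[OF h] that in \<open>auto simp: m_def\<close>)
    then show ?thesis using W11_norm_le[OF QW[OF h], of "w11_var (Q h)"] by simp
  qed
  have bQ: "bounded_operator_on W11 W11_norm Q"
    unfolding bounded_operator_on_def
  proof (intro conjI ballI allI exI)
    show "Q \<in> W11 \<rightarrow> W11" using QW by auto
    show "Q (\<lambda>x. g x + h x) = (\<lambda>x. Q g x + Q h x)" if "g \<in> W11" "h \<in> W11" for g h
      using Qlin[OF that, of 1 1] by simp
    show "Q (\<lambda>x. c * h x) = (\<lambda>x. c * Q h x)" if "h \<in> W11" for c h
      using Qlin[OF that that, of c 0] by simp
    show "W11_norm (Q h) \<le> 2 * W11_norm h" if "h \<in> W11" for h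
      using nQ[OF that] var[OF that] w11_var_le_W11_norm[of h] by linarith
  qed
  have pvar: "w11_var ((Q ^^ n) h) \<le> w11_var h" if h: "h \<in> W11" for n h
  proof (induction n)
    case (Suc n)
    show ?case using var[OF funpow_W11[OF bQ h, of n]] Suc by simp
  qed simp
  have pb: "W11_norm ((Q ^^ n) h) \<le> 2 * W11_norm h" if h: "h \<in> W11" for n h
  proof (cases n)
    case 0 then show ?thesis using W11_norm_nonneg[of h] by simp
  next
    case (Suc k)
    have "W11_norm ((Q ^^ n) h) \<le> 2 * w11_var ((Q ^^ n) h)"
      using nQ[OF funpow_W11[OF bQ h, of k]] Suc by simp
    also have "\<dots> \<le> 2 * w11_var h" using pvar[OF h, of n] by simp
    also have "\<dots> \<le> 2 * W11_norm h" using w11_var_le_W11_norm[of h] by simp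
    finally show ?thesis .
  qed
  have Q1: "Q one_W11 = (\<lambda>x. 0)" unfolding Q_def L0_one[OF L] m1 by (simp add: Nc_def)
  show ?thesis
  proof (intro exI conjI ballI)
    show "bounded_operator_on W11 W11_norm Q" by (rule bQ)
    show "L0 f P h = (\<lambda>x. of_nat (card P) * (\<integral>y. h y \<partial>\<mu>) * one_W11 x + Q h x)" for h
      by (simp add: Q_def Nc_def m_def)
    show "Q one_W11 = (\<lambda>x. 0)" by (rule Q1)
    show "(\<integral>y. Q h y \<partial>\<mu>) = 0" if "h \<in> W11" for h using mQ[OF that] by (simp add: m_def)
    show "spectrum_on W11 W11_norm Q \<subseteq> {z. norm z \<le> 1}" by (rule spectrum_power_bounded[OF bQ pb])
  qed
qed

end

context balanced_measure
begin

text \<open>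
  Split \<open>h\<close> over the branches. On the branch \<open>I\<close> it equals \<open>k I \<circ> f\<close>, where \<open>k I\<close> is \<open>h\<close> composed
  with the inverse branch, and the \<open>k I\<close> sum to \<open>L0 h\<close>.
\<close>

lemma L0_dual:
  assumes L: "\<forall>h\<in>W11. L0 f P h \<in> W11" and h: "h \<in> W11"
  shows "(\<integral>x. L0 f P h x \<partial>\<mu>) = of_nat (card P) * (\<integral>x. h x \<partial>\<mu>)"
proof -
  define k where "k = (\<lambda>I t. if t \<in> {0<..<1} then h (inv_branch I t) else 0)"
  have km: "k I \<in> borel_measurable \<mu>" if I: "I \<in> P" for I
  proof -
    have "continuous_on {0<..<1} (\<lambda>t. h (inv_branch I t))"
    proof (rule continuous_on_compose2[OF W11D(1)[OF h] inv_branch_cont[OF I]])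
      show "inv_branch I ` {0<..<1} \<subseteq> {0..1}"
      proof
        fix z assume "z \<in> inv_branch I ` {0<..<1}"
        then obtain t where t: "z = inv_branch I t" "t \<in> {0<..<1}" by (rule imageE)
        then have "z \<in> I" using inv_branch(1)[OF I] by simp
        then have "z \<in> {0<..<1}" using branch_subset(1)[OF I] by blast
        then show "z \<in> {0..1}" by simp
      qed
    qed
    then have "(\<lambda>t. if t \<in> {0<..<1} then h (inv_branch I t) else 0) \<in> borel_measurable borel"
      by (intro borel_measurable_continuous_on_if) auto
    then have "k I \<in> borel_measurable borel" by (simp only: k_def)
    then have "k I \<in> borel_measurable (restrict_space borel {0..1})" by (rule measurable_restrict_space1)
    then show ?thesis using measurable_cong_sets[OF \<mu>_sets refl] by blast
  qed
  have kb: "norm (k I x) \<le> W11_norm h" for I x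
    unfolding k_def using norm_le_W11_norm[OF h] W11_norm_nonneg[of h] by simp
  have ki: "integrable \<mu> (k I)" if "I \<in> P" for I
    by (rule integrable_const_bound[OF _ km[OF that]]) (rule AE_I2, rule kb)
  have hm: "h \<in> borel_measurable \<mu>" and hi: "integrable \<mu> h"
    using W11_integrable[OF prob_space_axioms \<mu>_sets h] by auto
  have hI: "integrable \<mu> (\<lambda>x. indicator I x *\<^sub>R h x)" if "I \<in> P" for I
    by (rule integrable_mult_indicator[OF branch_sets[OF that] hi])
  have "(\<integral>x. h x \<partial>\<mu>) = (\<integral>x. (\<Sum>I\<in>P. indicator I x *\<^sub>R h x) \<partial>\<mu>)"
  proof (rule integral_cong_AE[OF hm])
    show "(\<lambda>x. \<Sum>I\<in>P. indicator I x *\<^sub>R h x) \<in> borel_measurable \<mu>"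
      by (rule borel_measurable_sum) (use hI in \<open>blast intro: borel_measurable_integrable\<close>)
    show "AE x in \<mu>. h x = (\<Sum>I\<in>P. indicator I x *\<^sub>R h x)"
      using AE_not_cut AE_space
    proof eventually_elim
      case (elim x)
      then have "x \<in> \<Union>P" by (simp add: cuts_def \<mu>_space)
      then obtain J where J: "J \<in> P" "x \<in> J" by blast
      have "(\<Sum>I\<in>P. indicator I x *\<^sub>R h x) = (\<Sum>I\<in>P. if I = J then h x else 0)"
      proof (rule sum.cong[OF refl])
        fix I assume "I \<in> P"
        then have "I \<noteq> J \<Longrightarrow> x \<notin> I" using J P_props(2) by (auto simp: disjoint_def)
        then show "indicator I x *\<^sub>R h x = (if I = J then h x else 0)" using J(2) by auto
      qed
      then show ?case using J(1) P_props(1) by simp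
    qed
  qed
  also have "\<dots> = (\<Sum>I\<in>P. \<integral>x. indicator I x *\<^sub>R h x \<partial>\<mu>)"
    by (rule Bochner_Integration.integral_sum) (rule hI)
  finally have e1: "(\<integral>x. h x \<partial>\<mu>) = (\<Sum>I\<in>P. \<integral>x. indicator I x *\<^sub>R h x \<partial>\<mu>)" .
  have e2: "of_nat (card P) * (\<integral>x. indicator I x *\<^sub>R h x \<partial>\<mu>) = (\<integral>x. k I x \<partial>\<mu>)" if I: "I \<in> P" for I
  proof -
    have "(\<integral>x. indicator I x *\<^sub>R h x \<partial>\<mu>) = (\<integral>x. indicator I x *\<^sub>R k I (f x) \<partial>\<mu>)"
    proof (rule Bochner_Integration.integral_cong[OF refl])
      fix x
      show "indicator I x *\<^sub>R h x = indicator I x *\<^sub>R k I (f x)"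
      proof (cases "x \<in> I")
        case True
        then have "k I (f x) = h x" unfolding k_def using branch_values[OF I True] inv_branch_f[OF I True] by simp
        then show ?thesis by simp
      qed simp
    qed
    then show ?thesis using integral_branch[OF I km[OF I]] by simp
  qed
  have "(\<integral>x. L0 f P h x \<partial>\<mu>) = (\<integral>x. (\<Sum>I\<in>P. k I x) \<partial>\<mu>)"
  proof (rule integral_cong_AE)
    have "L0 f P h \<in> W11" using L h by blast
    then show "L0 f P h \<in> borel_measurable \<mu>" by (rule W11_integrable(1)[OF prob_space_axioms \<mu>_sets])
    show "(\<lambda>x. \<Sum>I\<in>P. k I x) \<in> borel_measurable \<mu>" by (rule borel_measurable_sum) (rule km)
    show "AE x in \<mu>. L0 f P h x = (\<Sum>I\<in>P. k I x)"
      using AE_not_cut AE_space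
    proof eventually_elim
      case (elim x)
      have "x \<noteq> 0" "x \<noteq> 1" using elim(1) zero_one_cuts by auto
      then have "x \<in> {0<..<1}" using elim(2) by (simp add: \<mu>_space)
      then show ?case by (simp add: L0_interior k_def)
    qed
  qed
  also have "\<dots> = (\<Sum>I\<in>P. \<integral>x. k I x \<partial>\<mu>)" by (rule Bochner_Integration.integral_sum) (rule ki)
  also have "\<dots> = of_nat (card P) * (\<Sum>I\<in>P. \<integral>x. indicator I x *\<^sub>R h x \<partial>\<mu>)"
    unfolding sum_distrib_left by (rule sum.cong[OF refl]) (simp add: e2)
  finally show ?thesis using e1 by simp
qed

end

context full_branch_map
begin

text \<open>
  With one branch \<open>f\<close> is continuous and has a fixed point \<open>p\<close>. The identity \<open>L0 h (f y) = h y\<close>,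
  clear inside the interval, extends to \<open>p\<close> by continuity even if \<open>p\<close> is an end point. All
  entropies vanish, so the unit mass at \<open>p\<close> has maximal entropy.
\<close>

lemma single_branch_measure:
  assumes N: "card P = 1" and c: "continuous_on {0..1} f" and L: "\<forall>h\<in>W11. L0 f P h \<in> W11"
  shows "\<exists>\<mu>. max_entropy_measure f \<mu> \<and> (\<forall>h\<in>W11. (\<integral>x. L0 f P h x \<partial>\<mu>) = of_nat (card P) * (\<integral>x. h x \<partial>\<mu>))"
proof -
  obtain I where PI: "P = {I}" using N by (rule card_1_singletonE)
  have "closure I = {0..1}" using P_props(4) PI by simp
  then have "{Inf I..Sup I} = {0..1}" using interval(3)[of I] PI by simp
  then have "Inf I = 0 \<and> Sup I = 1" using interval(2)[of I] PI by (simp add: Icc_eq_Icc)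
  then have I01: "I = {0<..<1}"
  proof -
    assume *: "Inf I = 0 \<and> Sup I = 1"
    have "I = {Inf I<..<Sup I}" by (rule interval(1)) (simp add: PI)
    also have "\<dots> = {0<..<1}" by (simp only: *)
    finally show ?thesis .
  qed
  have fim: "f \<in> {0..1} \<rightarrow> {0..1}" using f_range by blast
  obtain p where p: "p \<in> {0..1}" "f p = p"
    by (rule brouwer[OF compact_Icc _ _ c fim]) (auto intro: that)
  define \<mu> where "\<mu> = return (restrict_space borel {0..1::real}) p"
  have s: "sets \<mu> = sets (restrict_space borel {0..1})" by (simp add: \<mu>_def)
  have sp: "space \<mu> = {0..1}" by (simp add: \<mu>_def space_restrict_space)
  have ps: "prob_space \<mu>" unfolding \<mu>_def by (rule prob_space_return) (use p in \<open>simp add: space_restrict_space\<close>)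
  have fm: "f \<in> measurable \<mu> \<mu>" by (rule f_measurable[OF s])
  have inv: "invariant_prob f \<mu>"
    unfolding invariant_prob_def
  proof (intro conjI ps s fm)
    show "distr \<mu> \<mu> f = \<mu>"
    proof (rule measure_eqI)
      fix B assume "B \<in> sets (distr \<mu> \<mu> f)"
      then have B: "B \<in> sets \<mu>" by simp
      have fB: "f -` B \<inter> space \<mu> \<in> sets \<mu>" by (rule measurable_sets[OF fm B])
      have em: "emeasure \<mu> C = indicator C p" if "C \<in> sets \<mu>" for C
        using that unfolding \<mu>_def by (intro emeasure_return) simp
      have "emeasure (distr \<mu> \<mu> f) B = indicator (f -` B \<inter> space \<mu>) p"
        unfolding emeasure_distr[OF fm B] by (rule em[OF fB])
      also have "\<dots> = indicator B p" using p sp by (simp add: indicator_def)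
      finally show "emeasure (distr \<mu> \<mu> f) B = emeasure \<mu> B" by (simp only: em[OF B])
    qed simp
  qed
  have int: "(\<integral>x. h x \<partial>\<mu>) = h p" if "h \<in> W11" for h
  proof -
    have "h \<in> borel_measurable (restrict_space borel {0..1})"
      by (rule borel_measurable_continuous_on_restrict[OF W11D(1)[OF that]])
    then show ?thesis unfolding \<mu>_def by (rule integral_return[rotated]) (use p in \<open>simp add: space_restrict_space\<close>)
  qed
  have dual: "(\<integral>x. L0 f P h x \<partial>\<mu>) = of_nat (card P) * (\<integral>x. h x \<partial>\<mu>)" if h: "h \<in> W11" for h
  proof -
    have LW: "L0 f P h \<in> W11" using L h by blast
    have eq: "L0 f P h (f y) - h y = 0" if y: "y \<in> {0<..<1}" for y
    proof -
      have "I \<in> P" "y \<in> I" using PI I01 y by auto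
      then have "f y \<in> {0<..<1}" "inv_branch I (f y) = y" using branch_values inv_branch_f by auto
      then show ?thesis using L0_interior[of "f y" h] by (simp add: PI)
    qed
    have "L0 f P h (f p) - h p = 0"
    proof (rule continuous_constant_on_closure[of "{0<..<1}" "\<lambda>y. L0 f P h (f y) - h y"])
      have "continuous_on {0..1} (\<lambda>y. L0 f P h (f y))"
        by (rule continuous_on_compose2[OF W11D(1)[OF LW] c]) (use f_range in auto)
      then show "continuous_on (closure {0<..<1}) (\<lambda>y. L0 f P h (f y) - h y)"
        using continuous_on_diff[OF _ W11D(1)[OF h]] by simp
      show "p \<in> closure {0<..<1}" using p(1) by simp
    qed (rule eq)
    then show ?thesis using int[OF LW] int[OF h] p(2) N by simp
  qed
  have part: "partition_on (space \<mu>) {space \<mu>}" by (rule partition_onI) (use sp in auto)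
  have "max_entropy_measure f \<mu>"
  proof (rule max_entropy_measureI[OF inv _ _ part])
    have "finite {space \<mu>}" "{space \<mu>} \<subseteq> sets \<mu>" by auto
    then interpret S: finite_partition_system \<mu> f "{space \<mu>}"
      by (intro finite_partition_system.intro finite_partition_system_axioms.intro part ps)
         (use inv in \<open>simp_all only: invariant_prob_def\<close>)
    have "0 \<le> entropy_wrt_partition \<mu> f {space \<mu>}"
      by (rule LIMSEQ_le_const[OF S.entropy_LIMSEQ]) (use S.cyl_entropy_nonneg in auto)
    then show "ln (real (card P)) \<le> entropy_wrt_partition \<mu> f {space \<mu>}" using N by simp
  qed auto
  then show ?thesis using dual by blast
qed

lemma conformal_measure_exists:
  assumes c: "card P = 1 \<longrightarrow> continuous_on {0..1} f" and L: "\<forall>h\<in>W11. L0 f P h \<in> W11"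
  shows "\<exists>\<mu>. max_entropy_measure f \<mu> \<and> (\<forall>h\<in>W11. (\<integral>x. L0 f P h x \<partial>\<mu>) = of_nat (card P) * (\<integral>x. h x \<partial>\<mu>))"
proof (cases "card P = 1")
  case True
  then show ?thesis using single_branch_measure[OF True _ L] c by blast
next
  case False
  then have "2 \<le> card P" using card_P_pos by simp
  then obtain \<mu> where "balanced \<mu>" using balanced_exists by blast
  then interpret balanced_measure f P \<mu>
    by (intro balanced_measure.intro full_branch_map_axioms balanced_measure_axioms.intro)
  show ?thesis using balanced_max_entropy L0_dual[OF L] by blast
qed

end

theorem theorem4p5:
  fixes f :: "real \<Rightarrow> real" and P :: "real set set" and N :: nat
  assumes "full_branch f P" and "card P = N"
    and "N = 1 \<longrightarrow> continuous_on {0..1} f"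
    and "\<forall>h\<in>W11. L0 f P h \<in> W11"
  shows "\<exists>(\<mu>\<^sub>B\<^sub>M :: real measure) (Q :: (real \<Rightarrow> complex) \<Rightarrow> real \<Rightarrow> complex).
           max_entropy_measure f \<mu>\<^sub>B\<^sub>M \<and>
           bounded_operator_on W11 W11_norm Q \<and>
           (\<forall>h\<in>W11. L0 f P h =
              (\<lambda>x. of_nat N * (\<integral>y. h y \<partial>\<mu>\<^sub>B\<^sub>M) * one_W11 x + Q h x)) \<and>
           Q one_W11 = (\<lambda>x. 0) \<and>
           (\<forall>h\<in>W11. (\<integral>y. Q h y \<partial>\<mu>\<^sub>B\<^sub>M) = 0) \<and>
           spectrum_on W11 W11_norm Q \<subseteq> {z. norm z \<le> 1}"
proof -
  interpret full_branch_map f P using assms(1) by (rule full_branch_map.intro)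
  obtain \<mu> where \<mu>: "max_entropy_measure f \<mu>"
    "\<forall>h\<in>W11. (\<integral>x. L0 f P h x \<partial>\<mu>) = of_nat (card P) * (\<integral>x. h x \<partial>\<mu>)"
    using conformal_measure_exists[OF _ assms(4)] assms(2,3) by blast
  have ps: "prob_space \<mu>" and s: "sets \<mu> = sets (restrict_space borel {0..1})"
    using \<mu>(1) by (simp_all only: max_entropy_measure_def invariant_prob_def)
  obtain Q where "bounded_operator_on W11 W11_norm Q \<and>
           (\<forall>h\<in>W11. L0 f P h = (\<lambda>x. of_nat (card P) * (\<integral>y. h y \<partial>\<mu>) * one_W11 x + Q h x)) \<and>
           Q one_W11 = (\<lambda>x. 0) \<and> (\<forall>h\<in>W11. (\<integral>y. Q h y \<partial>\<mu>) = 0) \<and>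
           spectrum_on W11 W11_norm Q \<subseteq> {z. norm z \<le> 1}"
    using spectral_decomposition[OF assms(4) ps s] \<mu>(2) by blast
  then show ?thesis using \<mu>(1) assms(2) by blast
qed

end
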